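(* Let $\epsilon\in\mathbb R$. Assume the following. (1) The support $\mathcal X$ of $X$ is a compact subset of $\mathbb R^d$ and $\mathcal X_0$ is an inner closed subset of $\mathcal X$ (a closed set lying in the interior of $\mathcal X$) with nonempty interior. (2) The p.d.f. $g$ of $X$ is strictly positive over $\mathcal X_0$ and has continuous second order partial derivatives over $\mathcal X$. (3) $m$ has continuous second order partial derivatives over $\mathcal X$. (4) The i.i.d. errors $\varepsilon,\varepsilon_i$ are centered, have finite 6th moments, and are independent of the covariates $X,X_i$. (5) The p.d.f. $f$ of $\varepsilon$ has bounded continuous second order derivatives over $\mathbb R$ and, for $h_p(e)=e^pf(e)$, $\sup_{e\in\mathbb R}|h_p^{(k)}(e)|<\infty$ for integers $p,k\in[0,2]$. (6) $K_0$ is symmetric, continuous over $\mathbb R^d$ with support contained in $[-1/2,1/2]^d$, and $\int K_0(z)\,dz=1$. (7) $K_1$ has compact support, is three times continuously differentiable over $\mathbb R$, $\int K_1(v)\,dv=1$ and $\int vK_1(v)\,dv=0$. (8) $b_0$ decreases to $0$ and, for $d^*=\sup\{d+2,2d\}$, $nb_0^{d^*}/\ln n\to\infty$ and $\ln(1/b_0)/\ln(\ln n)\to\infty$. (9) $b_1$ decreases to $0$ and $n^{d+8}b_1^{7(d+4)}\to\infty$. Then, as $n\to\infty$, $$\widehat f_{1n}(\epsilon)-f(\epsilon)=O_{\mathbb P}\left(\bigl(AMSE(b_1)+R_n(b_0,b_1)\bigr)^{1/2}\right),$$ where $$AMSE(b_1)=\mathbb E_n\left[\left(\widetilde f_{1n}(\epsilon)-f(\epsilon)\right)^2\right]=O_{\mathbb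 P}\left(b_1^4+\frac1{nb_1}\right)$$ and $$R_n(b_0,b_1)=b_0^4+\left[\frac1{(nb_1^5)^{1/2}}+\left(\frac{b_0^d}{b_1^3}\right)^{1/2}\right]^2\left(b_0^4+\frac1{nb_0^d}\right)^2+\left[\frac1{b_1}+\left(\frac{b_0^d}{b_1^7}\right)^{1/2}\right]^2\left(b_0^4+\frac1{nb_0^d}\right)^3.$$
   Context: $(X,Y),(X_1,Y_1),\dots,(X_n,Y_n)$ are i.i.d. with $Y$ real and $X$ in $\mathbb R^d$; $m(x)=\mathbb E[Y|X=x]$, $Y_i=m(X_i)+\varepsilon_i$. Bandwidths $b_0,b_1$ depend on $n$. $\mathbb E_n[\cdot]$ is the conditional expectation given $X_1,\dots,X_n$. Leave-one-out regression estimator and estimated residuals: $$\widehat m_{in}=\frac{\sum_{j\ne i}Y_jK_0\left(\frac{X_j-X_i}{b_0}\right)}{\sum_{j\neq i}K_0\left(\frac{X_j-X_i}{b_0}\right)},\qquad \widehat\varepsilon_i=Y_i-\widehat m_{in}.$$ Density estimators: $$\widehat f_{1n}(\epsilon)=\frac{\sum_{i=1}^n\mathbf 1(X_i\in\mathcal X_0)K_1\left(\frac{\widehat\varepsilon_i-\epsilon}{b_1}\right)}{b_1\sum_{i=1}^n\mathbf 1(X_i\in\mathcal X_0)},\qquad \widetilde f_{1n}(\epsilon)=\frac{\sum_{i=1}^n\mathbf 1(X_i\in\mathcal X_0)K_1\left(\frac{\varepsilon_i-\epsilon}{b_1}\right)}{b_1\sum_{i=1}^n\mathbf 1(X_i\in\mathcal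 X_0)}.$$ *)

theory Defs
  imports "HOL-Probability.Probability"
begin

text \<open>Topological support of the law of a random variable.\<close>

definition law_support :: "'w measure \<Rightarrow> ('w \<Rightarrow> 'a::topological_space) \<Rightarrow> 'a set" where
  "law_support M X =
    {x. \<forall>U. open U \<and> x \<in> U \<longrightarrow> measure (distr M borel X) U > 0}"

text \<open>Derivatives along the coordinate directions are taken relative to \<open>S\<close>, i.e. along
  increments that stay in \<open>S\<close>. At interior points of \<open>S\<close> these are the ordinary partial
  derivatives; values of \<open>u\<close> outside \<open>S\<close> are irrelevant, so a density may jump to \<open>0\<close> at the
  boundary of its support.\<close>

definition continuous_second_partials_on ::
    "(real^'d) set \<Rightarrow> (real^'d \<Rightarrow> real) \<Rightarrow> bool" where
  "continuous_second_partials_on S u \<longleftrightarrow>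
    (\<exists>(D1 :: 'd \<Rightarrow> real^'d \<Rightarrow> real) (D2 :: 'd \<Rightarrow> 'd \<Rightarrow> real^'d \<Rightarrow> real).
      (\<forall>i. \<forall>x\<in>S. ((\<lambda>t. u (x + t *\<^sub>R axis i 1)) has_real_derivative D1 i x)
          (at 0 within {t. x + t *\<^sub>R axis i 1 \<in> S})) \<and>
      (\<forall>i j. \<forall>x\<in>S. ((\<lambda>t. D1 i (x + t *\<^sub>R axis j 1)) has_real_derivative D2 i j x)
          (at 0 within {t. x + t *\<^sub>R axis j 1 \<in> S})) \<and>
      (\<forall>i j. continuous_on S (D2 i j)))"

definition continuously_differentiable :: "nat \<Rightarrow> (real \<Rightarrow> real) \<Rightarrow> bool" where
  "continuously_differentiable k u \<longleftrightarrow>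
    (\<forall>j<k. \<forall>x. (deriv ^^ j) u field_differentiable at x) \<and>
    continuous_on UNIV ((deriv ^^ k) u)"

text \<open>\<open>U n = O\<^sub>P(V n)\<close>; the normalising sequence \<open>V\<close> may itself be random.\<close>

definition bigO_prob :: "'w measure \<Rightarrow> (nat \<Rightarrow> 'w \<Rightarrow> real) \<Rightarrow> (nat \<Rightarrow> 'w \<Rightarrow> real) \<Rightarrow> bool" where
  "bigO_prob M U V \<longleftrightarrow>
    (\<forall>\<delta>>0. \<exists>C>0. \<forall>\<^sub>F n in sequentially.
      measure M {\<omega> \<in> space M. \<bar>U n \<omega>\<bar> > C * \<bar>V n \<omega>\<bar>} \<le> \<delta>)"

text \<open>In the estimators, \<open>x\<close>, \<open>y\<close> and \<open>r\<close> are realised values (of covariates, responses and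
  residuals) with indices \<open>1, \<dots>, n\<close>, and \<open>b\<close> is a bandwidth. A ratio with zero denominator
  is \<open>0\<close>.\<close>

definition regression_loo ::
    "(real^'d \<Rightarrow> real) \<Rightarrow> real \<Rightarrow> nat \<Rightarrow> (nat \<Rightarrow> real^'d) \<Rightarrow> (nat \<Rightarrow> real) \<Rightarrow> nat \<Rightarrow> real" where
  "regression_loo K b n x y i =
    (\<Sum>j\<in>{1..n} - {i}. y j * K ((x j - x i) /\<^sub>R b)) /
    (\<Sum>j\<in>{1..n} - {i}. K ((x j - x i) /\<^sub>R b))"

definition estimated_residual ::
    "(real^'d \<Rightarrow> real) \<Rightarrow> real \<Rightarrow> nat \<Rightarrow> (nat \<Rightarrow> real^'d) \<Rightarrow> (nat \<Rightarrow> real) \<Rightarrow> nat \<Rightarrow> real" where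
  "estimated_residual K b n x y i = y i - regression_loo K b n x y i"

definition trimmed_density ::
    "(real^'d) set \<Rightarrow> (real \<Rightarrow> real) \<Rightarrow> real \<Rightarrow> nat \<Rightarrow> (nat \<Rightarrow> real^'d) \<Rightarrow> (nat \<Rightarrow> real) \<Rightarrow> real \<Rightarrow> real"
  where
  "trimmed_density S K b n x r e =
    (\<Sum>i=1..n. indicator S (x i) * K ((r i - e) / b)) /
    (b * (\<Sum>i=1..n. indicator S (x i)))"

definition f_hat ::
    "(real^'d) set \<Rightarrow> (real^'d \<Rightarrow> real) \<Rightarrow> (real \<Rightarrow> real) \<Rightarrow> real \<Rightarrow> real \<Rightarrow> nat \<Rightarrow>
     (nat \<Rightarrow> real^'d) \<Rightarrow> (nat \<Rightarrow> real) \<Rightarrow> real \<Rightarrow> real" where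
  "f_hat S K0 K1 b0 b1 n x y e =
    trimmed_density S K1 b1 n x (estimated_residual K0 b0 n x y) e"

definition f_tilde ::
    "(real^'d) set \<Rightarrow> (real \<Rightarrow> real) \<Rightarrow> real \<Rightarrow> nat \<Rightarrow>
     (nat \<Rightarrow> real^'d) \<Rightarrow> (nat \<Rightarrow> real) \<Rightarrow> real \<Rightarrow> real" where
  "f_tilde S K1 b1 n x eps e = trimmed_density S K1 b1 n x eps e"

text \<open>Conditional expectation given \<open>X\<^sub>1, \<dots>, X\<^sub>n\<close>; \<open>X 0\<close> is not conditioned on.\<close>

definition cond_exp_sample ::
    "'w measure \<Rightarrow> (nat \<Rightarrow> 'w \<Rightarrow> real^'d) \<Rightarrow> nat \<Rightarrow> ('w \<Rightarrow> real) \<Rightarrow> 'w \<Rightarrow> real" where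
  "cond_exp_sample M X n =
    real_cond_exp M (vimage_algebra (space M) (\<lambda>\<omega>. \<lambda>i\<in>{1..n}. X i \<omega>) (Pi\<^sub>M {1..n} (\<lambda>_. borel)))"

definition amse ::
    "'w measure \<Rightarrow> (real^'d) set \<Rightarrow> (real \<Rightarrow> real) \<Rightarrow> (nat \<Rightarrow> 'w \<Rightarrow> real^'d) \<Rightarrow>
     (nat \<Rightarrow> 'w \<Rightarrow> real) \<Rightarrow> (real \<Rightarrow> real) \<Rightarrow> real \<Rightarrow> real \<Rightarrow> nat \<Rightarrow> 'w \<Rightarrow> real" where
  "amse M S K1 X eps f e b1 n =
    cond_exp_sample M X n
      (\<lambda>\<omega>. (f_tilde S K1 b1 n (\<lambda>i. X i \<omega>) (\<lambda>i. eps i \<omega>) e - f e)\<^sup>2)"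

definition remainder_rate :: "nat \<Rightarrow> nat \<Rightarrow> real \<Rightarrow> real \<Rightarrow> real" where
  "remainder_rate d n b0 b1 =
    b0 ^ 4
    + (1 / sqrt (real n * b1 ^ 5) + sqrt (b0 ^ d / b1 ^ 3))\<^sup>2 * (b0 ^ 4 + 1 / (real n * b0 ^ d))\<^sup>2
    + (1 / b1 + sqrt (b0 ^ d / b1 ^ 7))\<^sup>2 * (b0 ^ 4 + 1 / (real n * b0 ^ d)) ^ 3"

end

theory Submission
  imports Defs
begin

text \<open>Conditionally on the design, the estimated residual is \<open>\<epsilon>\<^sub>i + \<delta>\<^sub>i\<close>, where \<open>\<delta>\<^sub>i\<close> is affine in the other
  errors. Split the effect of \<open>\<delta>\<^sub>i\<close> on the kernel into its mean over \<open>\<epsilon>\<^sub>i\<close> and a centred part.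
  The mean part moves the derivatives from \<open>K\<^sub>1\<close> to \<open>f\<close>. Its linear term carries the factor
  \<open>\<integral> K\<^sub>1(v) f'(e + b\<^sub>1 v) dv\<close>, which \<open>f'\<^sup>2 \<le> 4 L f\<close> bounds by the variance of the infeasible
  estimator, hence by the AMSE; this is what controls the average error of order \<open>n\<^sup>-\<^sup>1\<^sup>/\<^sup>2\<close> when \<open>b\<^sub>0\<^sup>4\<close>
  may be smaller than \<open>1/n\<close>. For the centred parts \<open>G\<^sub>i\<close>, the cross moment of \<open>G\<^sub>i\<close> and \<open>G\<^sub>j\<close> equals
  that of the increments of \<open>G\<^sub>i\<close> and \<open>G\<^sub>j\<close> under deletion of \<open>\<epsilon>\<^sub>j\<close> and \<open>\<epsilon>\<^sub>i\<close>, which is of the order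
  of the squared smoothing weights. A Chernoff bound shows that the random design satisfies the required
  bounds on denominators, biases and neighbour counts with probability tending to one.\<close>

section \<open>Sampling from product measures\<close>

text \<open>The obstacle is that the AMSE need not be bounded below by a multiple of
  \<open>1 / (n * b1)\<close>: \<open>f\<close> may vanish at \<open>e\<close>, and then the
  variance of the infeasible estimator is of smaller order than usual. Averaged noise of order
  \<open>n^(-1/2)\<close> can therefore not be absorbed by a crude rate; it has to be compared with
  the variance actually present. This is possible because a nonnegative function with Lipschitz
  derivative has a small derivative wherever it is small, so that squared slope and variance are
  controlled by one and the same integral, with weight \<open>K1(v)^2 * f(e + b1 * v)\<close>. All
  estimates are in mean absolute value for a frozen design. The conditional expectation is then an
  ordinary integral over a product of error laws and the random normaliser is a constant, so a
  Markov inequality on each fibre transfers the bound. In \<open>remainder_rate\<close>, the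
  smoothing noise of the centred parts is matched with the product of \<open>b0^d / b1^3\<close> and
  \<open>(1 / (n * b0^d))^2\<close>; the remaining terms are matched with \<open>b0^4\<close> or
  with the AMSE.\<close>

lemma measurable_PiM_pair:
  "(\<lambda>(x, y). \<lambda>i\<in>I. (x i, y i)) \<in> PiM I S \<Otimes>\<^sub>M PiM I T \<rightarrow>\<^sub>M PiM I (\<lambda>i. S i \<Otimes>\<^sub>M T i)"
  unfolding split_beta' by (rule measurable_restrict) measurable

text \<open>It suffices to test boxes. The section of a zipped box at \<open>x\<close> is again a
  box, so Fubini leaves a product of one-dimensional integrals, each being the measure of one side
  under \<open>\<mu> \<Otimes>\<^sub>M \<nu>\<close>.\<close>

lemma distr_PiM_pair:
  fixes \<mu> :: "'a measure" and \<nu> :: "'b measure"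
  assumes "prob_space \<mu>" "prob_space \<nu>" "finite I"
  shows "distr (PiM I (\<lambda>_. \<mu>) \<Otimes>\<^sub>M PiM I (\<lambda>_. \<nu>)) (PiM I (\<lambda>_. \<mu> \<Otimes>\<^sub>M \<nu>)) (\<lambda>(x, y). \<lambda>i\<in>I. (x i, y i))
    = PiM I (\<lambda>_. \<mu> \<Otimes>\<^sub>M \<nu>)"
    (is "distr (?P \<Otimes>\<^sub>M ?Q) ?R ?h = ?R")
proof -
  interpret \<mu>: prob_space \<mu> by fact
  interpret \<nu>: prob_space \<nu> by fact
  interpret P: product_prob_space "\<lambda>_. \<mu>" I by unfold_locales
  interpret Q: product_prob_space "\<lambda>_. \<nu>" I by unfold_locales
  interpret mn: pair_prob_space \<mu> \<nu> ..
  interpret PQ: pair_prob_space ?P ?Q ..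
  interpret R: product_prob_space "\<lambda>_. \<mu> \<Otimes>\<^sub>M \<nu>" I by unfold_locales
  note h = measurable_PiM_pair[of I "\<lambda>_. \<mu>" "\<lambda>_. \<nu>"]
  show ?thesis
  proof (rule R.PiM_eqI)
    fix A assume A: "\<And>i. i \<in> I \<Longrightarrow> A i \<in> sets (\<mu> \<Otimes>\<^sub>M \<nu>)"
    have box: "Pi\<^sub>E I A \<in> sets ?R" using A assms(3) by auto
    have "emeasure (distr (?P \<Otimes>\<^sub>M ?Q) ?R ?h) (Pi\<^sub>E I A)
        = emeasure (?P \<Otimes>\<^sub>M ?Q) (?h -` Pi\<^sub>E I A \<inter> space (?P \<Otimes>\<^sub>M ?Q))"
      using h box by (rule emeasure_distr)
    also have "\<dots> = (\<integral>\<^sup>+x. emeasure ?Q (Pair x -` (?h -` Pi\<^sub>E I A \<inter> space (?P \<Otimes>\<^sub>M ?Q))) \<partial>?P)"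
      by (rule Q.P.emeasure_pair_measure_alt) (rule measurable_sets[OF h box])
    also have "\<dots> = (\<integral>\<^sup>+x. (\<Prod>i\<in>I. emeasure \<nu> (Pair (x i) -` A i)) \<partial>?P)"
    proof (rule nn_integral_cong)
      fix x assume x: "x \<in> space ?P"
      have "Pair x -` (?h -` Pi\<^sub>E I A \<inter> space (?P \<Otimes>\<^sub>M ?Q)) = Pi\<^sub>E I (\<lambda>i. Pair (x i) -` A i)"
        using x sets.sets_into_space[OF A]
        by (fastforce simp: space_pair_measure space_PiM PiE_iff extensional_def)
      also have "emeasure ?Q \<dots> = (\<Prod>i\<in>I. emeasure \<nu> (Pair (x i) -` A i))"
        using A assms(3) by (intro Q.emeasure_PiM) (auto intro: sets_Pair1)
      finally show "emeasure ?Q (Pair x -` (?h -` Pi\<^sub>E I A \<inter> space (?P \<Otimes>\<^sub>M ?Q)))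
          = (\<Prod>i\<in>I. emeasure \<nu> (Pair (x i) -` A i))" .
    qed
    also have "\<dots> = (\<Prod>i\<in>I. \<integral>\<^sup>+x. emeasure \<nu> (Pair x -` A i) \<partial>\<mu>)"
      using A assms(3) by (intro P.product_nn_integral_prod) (auto intro: \<nu>.measurable_emeasure_Pair)
    also have "\<dots> = (\<Prod>i\<in>I. emeasure (\<mu> \<Otimes>\<^sub>M \<nu>) (A i))"
      using A by (intro prod.cong) (auto simp: \<nu>.emeasure_pair_measure_alt)
    finally show "emeasure (distr (?P \<Otimes>\<^sub>M ?Q) ?R ?h) (Pi\<^sub>E I A) = (\<Prod>i\<in>I. emeasure (\<mu> \<Otimes>\<^sub>M \<nu>) (A i))" .
  qed (use assms in simp_all)
qed

text \<open>Independence across indices and independence inside every pair combine to independence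
  of the whole design from the whole error vector: the vector of pairs has a product law, and
  unzipping regroups its factors. This is what justifies integrating over the errors with the design
  held fixed.\<close>

lemma (in prob_space) distr_sample_pair:
  assumes fin: "finite I" "I \<noteq> {}"
    and ind: "indep_vars (\<lambda>_. S \<Otimes>\<^sub>M T) (\<lambda>i \<omega>. (X i \<omega>, Z i \<omega>)) I"
    and pair: "\<And>i. i \<in> I \<Longrightarrow> distr M (S \<Otimes>\<^sub>M T) (\<lambda>\<omega>. (X i \<omega>, Z i \<omega>)) = \<mu> \<Otimes>\<^sub>M \<nu>"
    and p: "prob_space \<mu>" "prob_space \<nu>" "sets \<mu> = sets S" "sets \<nu> = sets T"
  shows "distr M (PiM I (\<lambda>_. S) \<Otimes>\<^sub>M PiM I (\<lambda>_. T)) (\<lambda>\<omega>. (\<lambda>i\<in>I. X i \<omega>, \<lambda>i\<in>I. Z i \<omega>))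
    = PiM I (\<lambda>_. \<mu>) \<Otimes>\<^sub>M PiM I (\<lambda>_. \<nu>)"
proof -
  define zip where "zip = (\<lambda>(x :: 'b \<Rightarrow> 'c, y :: 'b \<Rightarrow> 'd). \<lambda>i\<in>I. (x i, y i))"
  define unzip where "unzip = (\<lambda>z :: 'b \<Rightarrow> 'c \<times> 'd. (\<lambda>i\<in>I. fst (z i), \<lambda>i\<in>I. snd (z i)))"
  have rv: "\<And>i. i \<in> I \<Longrightarrow> (\<lambda>\<omega>. (X i \<omega>, Z i \<omega>)) \<in> M \<rightarrow>\<^sub>M S \<Otimes>\<^sub>M T"
    using ind by (auto simp: indep_vars_def)
  have rvv: "(\<lambda>\<omega>. \<lambda>i\<in>I. (X i \<omega>, Z i \<omega>)) \<in> M \<rightarrow>\<^sub>M PiM I (\<lambda>_. S \<Otimes>\<^sub>M T)"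
    by (rule measurable_restrict) (rule rv)
  have u: "unzip \<in> PiM I (\<lambda>_. S \<Otimes>\<^sub>M T) \<rightarrow>\<^sub>M PiM I (\<lambda>_. S) \<Otimes>\<^sub>M PiM I (\<lambda>_. T)"
    unfolding unzip_def by (intro measurable_Pair measurable_restrict) measurable
  have s1: "sets (PiM I (\<lambda>_. \<mu>)) = sets (PiM I (\<lambda>_. S))" "sets (PiM I (\<lambda>_. \<nu>)) = sets (PiM I (\<lambda>_. T))"
    "sets (PiM I (\<lambda>_. \<mu> \<Otimes>\<^sub>M \<nu>)) = sets (PiM I (\<lambda>_. S \<Otimes>\<^sub>M T))"
    using p by (auto intro!: sets_PiM_cong sets_pair_measure_cong)
  have z: "zip \<in> PiM I (\<lambda>_. \<mu>) \<Otimes>\<^sub>M PiM I (\<lambda>_. \<nu>) \<rightarrow>\<^sub>M PiM I (\<lambda>_. \<mu> \<Otimes>\<^sub>M \<nu>)"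
    unfolding zip_def by (rule measurable_PiM_pair)
  have u': "unzip \<in> PiM I (\<lambda>_. \<mu> \<Otimes>\<^sub>M \<nu>) \<rightarrow>\<^sub>M PiM I (\<lambda>_. S) \<Otimes>\<^sub>M PiM I (\<lambda>_. T)"
    using u measurable_cong_sets[OF s1(3) refl] by blast
  have "distr M (PiM I (\<lambda>_. S) \<Otimes>\<^sub>M PiM I (\<lambda>_. T)) (\<lambda>\<omega>. (\<lambda>i\<in>I. X i \<omega>, \<lambda>i\<in>I. Z i \<omega>))
     = distr (distr M (PiM I (\<lambda>_. S \<Otimes>\<^sub>M T)) (\<lambda>\<omega>. \<lambda>i\<in>I. (X i \<omega>, Z i \<omega>)))
        (PiM I (\<lambda>_. S) \<Otimes>\<^sub>M PiM I (\<lambda>_. T)) unzip"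
    by (subst distr_distr[OF u rvv]) (auto intro!: distr_cong restrict_ext simp: unzip_def)
  also have "distr M (PiM I (\<lambda>_. S \<Otimes>\<^sub>M T)) (\<lambda>\<omega>. \<lambda>i\<in>I. (X i \<omega>, Z i \<omega>)) = PiM I (\<lambda>_. \<mu> \<Otimes>\<^sub>M \<nu>)"
    using ind fin(2) rv by (subst (asm) indep_vars_iff_distr_eq_PiM') (auto simp: pair cong: PiM_cong)
  also have "\<dots> = distr (PiM I (\<lambda>_. \<mu>) \<Otimes>\<^sub>M PiM I (\<lambda>_. \<nu>)) (PiM I (\<lambda>_. \<mu> \<Otimes>\<^sub>M \<nu>)) zip"
    unfolding zip_def by (rule distr_PiM_pair[symmetric]) (use p fin in auto)
  also have "distr \<dots> (PiM I (\<lambda>_. S) \<Otimes>\<^sub>M PiM I (\<lambda>_. T)) unzip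
      = distr (PiM I (\<lambda>_. \<mu>) \<Otimes>\<^sub>M PiM I (\<lambda>_. \<nu>)) (PiM I (\<lambda>_. \<mu>) \<Otimes>\<^sub>M PiM I (\<lambda>_. \<nu>)) (\<lambda>z. z)"
    using s1 by (subst distr_distr[OF u' z], intro distr_cong)
      (auto simp: unzip_def zip_def space_pair_measure space_PiM PiE_iff intro!: sets_pair_measure_cong extensionalityI[of _ I])
  also have "\<dots> = PiM I (\<lambda>_. \<mu>) \<Otimes>\<^sub>M PiM I (\<lambda>_. \<nu>)" by (rule distr_id)
  finally show ?thesis .
qed

lemma measurable_PiM_fun_upd:
  assumes "i \<in> I"
  shows "(\<lambda>(y, t). y(i := t)) \<in> PiM I (\<lambda>_. N) \<Otimes>\<^sub>M N \<rightarrow>\<^sub>M PiM I (\<lambda>_. N)"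
proof -
  have "(\<lambda>z. \<lambda>j\<in>I. if j = i then snd z else fst z j) \<in> PiM I (\<lambda>_. N) \<Otimes>\<^sub>M N \<rightarrow>\<^sub>M PiM I (\<lambda>_. N)"
    by (rule measurable_restrict) auto
  also have "?this \<longleftrightarrow> (\<lambda>(y, t). y(i := t)) \<in> PiM I (\<lambda>_. N) \<Otimes>\<^sub>M N \<rightarrow>\<^sub>M PiM I (\<lambda>_. N)"
    using assms by (intro measurable_cong)
      (auto simp: space_pair_measure space_PiM PiE_iff extensional_def fun_eq_iff)
  finally show ?thesis .
qed

text \<open>Invariance under resampling is the form in which single errors get integrated out: the
  index set need not be split, and the discarded old coordinate is harmless because it carries total
  mass one.\<close>

lemma distr_PiM_fun_upd:
  fixes \<nu> :: "'b measure"
  assumes "prob_space \<nu>" "finite I" "i \<in> I"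
  shows "distr (PiM I (\<lambda>_. \<nu>) \<Otimes>\<^sub>M \<nu>) (PiM I (\<lambda>_. \<nu>)) (\<lambda>(y, t). y(i := t)) = PiM I (\<lambda>_. \<nu>)"
    (is "distr ?P ?Q ?h = ?Q")
proof -
  interpret prob_space \<nu> by fact
  interpret Q: product_prob_space "\<lambda>_. \<nu>" I by unfold_locales
  interpret PP: pair_prob_space ?Q \<nu> ..
  note h = measurable_PiM_fun_upd[OF assms(3), of \<nu>]
  show ?thesis
  proof (rule Q.PiM_eqI)
    fix A assume A: "\<And>j. j \<in> I \<Longrightarrow> A j \<in> sets \<nu>"
    \<comment> \<open>The old value at \<open>i\<close> is forgotten, so the preimage of a box puts
      no constraint on it.\<close>
    define B where "B = (\<lambda>j. if j = i then space \<nu> else A j)"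
    have box: "Pi\<^sub>E I A \<in> sets ?Q" using A assms by auto
    have "?h -` Pi\<^sub>E I A \<inter> space ?P = Pi\<^sub>E I B \<times> A i"
      using assms(3) sets.sets_into_space[OF A] 
      by (auto simp: space_pair_measure space_PiM PiE_iff extensional_def B_def split: if_splits)
        blast+
    then have "emeasure (distr ?P ?Q ?h) (Pi\<^sub>E I A) = emeasure ?P (Pi\<^sub>E I B \<times> A i)"
      using emeasure_distr[OF h box] by simp
    also have "\<dots> = (\<Prod>j\<in>I. emeasure \<nu> (B j)) * emeasure \<nu> (A i)"
      using A assms by (subst emeasure_pair_measure_Times)
        (auto simp: B_def intro!: Q.emeasure_PiM sets_PiM_I_finite arg_cong2[where f = "(*)"])
    also have "(\<Prod>j\<in>I. emeasure \<nu> (B j)) = (\<Prod>j\<in>I - {i}. emeasure \<nu> (A j))"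
      using assms by (subst prod.remove[of I i]) (auto simp: B_def emeasure_space_1 intro!: prod.cong)
    also have "\<dots> * emeasure \<nu> (A i) = (\<Prod>j\<in>I. emeasure \<nu> (A j))"
      using assms prod.remove[of I i "\<lambda>j. emeasure \<nu> (A j)"] by (simp add: mult.commute)
    finally show "emeasure (distr ?P ?Q ?h) (Pi\<^sub>E I A) = (\<Prod>j\<in>I. emeasure \<nu> (A j))" .
  qed (use assms in simp_all)
qed

lemma
  fixes \<nu> :: "'b measure" and h :: "('i \<Rightarrow> 'b) \<Rightarrow> real"
  assumes "prob_space \<nu>" "finite I" "i \<in> I" "integrable (PiM I (\<lambda>_. \<nu>)) h"
  shows integral_PiM_resample:
      "(\<integral>y. (\<integral>t. h (y(i := t)) \<partial>\<nu>) \<partial>PiM I (\<lambda>_. \<nu>)) = (\<integral>y. h y \<partial>PiM I (\<lambda>_. \<nu>))"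
    and integrable_PiM_resample: "integrable (PiM I (\<lambda>_. \<nu>)) (\<lambda>y. \<integral>t. h (y(i := t)) \<partial>\<nu>)"
proof -
  interpret prob_space \<nu> by fact
  interpret Q: product_prob_space "\<lambda>_. \<nu>" I by unfold_locales
  interpret PP: pair_prob_space "PiM I (\<lambda>_. \<nu>)" \<nu> ..
  note m = measurable_PiM_fun_upd[OF assms(3), of \<nu>]
  note d = distr_PiM_fun_upd[OF assms(1-3)]
  have hm: "h \<in> borel_measurable (PiM I (\<lambda>_. \<nu>))" using assms(4) by auto
  have int: "integrable (PiM I (\<lambda>_. \<nu>) \<Otimes>\<^sub>M \<nu>) (\<lambda>(y, t). h (y(i := t)))"
    using integrable_distr_eq[OF m, of h] hm assms(4) d by (simp add: split_beta')
  have "(\<integral>y. h y \<partial>PiM I (\<lambda>_. \<nu>)) = (\<integral>z. h (case z of (y, t) \<Rightarrow> y(i := t)) \<partial>(PiM I (\<lambda>_. \<nu>) \<Otimes>\<^sub>M \<nu>))"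
    using integral_distr[OF m hm] d by simp
  also have "\<dots> = (\<integral>y. (\<integral>t. h (y(i := t)) \<partial>\<nu>) \<partial>PiM I (\<lambda>_. \<nu>))"
    using PP.integral_fst'[OF int] by (simp add: split_beta')
  finally show "(\<integral>y. (\<integral>t. h (y(i := t)) \<partial>\<nu>) \<partial>PiM I (\<lambda>_. \<nu>)) = (\<integral>y. h y \<partial>PiM I (\<lambda>_. \<nu>))" ..
  show "integrable (PiM I (\<lambda>_. \<nu>)) (\<lambda>y. \<integral>t. h (y(i := t)) \<partial>\<nu>)"
    using PP.integrable_fst'[OF int] by simp
qed

text \<open>Orthogonality by resampling: the factor that ignores coordinate \<open>i\<close> is
  pulled out of the inner integral, and the centred factor vanishes. It serves the raw errors, the
  centred kernel terms \<open>\<zeta>\<close> and the centred increments \<open>G\<close>.\<close>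

lemma integral_PiM_mult_zero:
  fixes \<nu> :: "'b measure" and h k :: "('i \<Rightarrow> 'b) \<Rightarrow> real"
  assumes "prob_space \<nu>" "finite I" "i \<in> I" "integrable (PiM I (\<lambda>_. \<nu>)) (\<lambda>y. h y * k y)"
    and h: "\<And>y. (\<integral>t. h (y(i := t)) \<partial>\<nu>) = 0"
    and k: "\<And>y t. k (y(i := t)) = k y"
  shows "(\<integral>y. h y * k y \<partial>PiM I (\<lambda>_. \<nu>)) = 0"
  using integral_PiM_resample[OF assms(1-4)] by (simp add: h k)

lemma
  fixes \<nu> :: "'b measure" and h :: "'b \<Rightarrow> real"
  assumes "prob_space \<nu>" "finite I" "i \<in> I" "integrable \<nu> h"
  shows integral_PiM_component1: "(\<integral>y. h (y i) \<partial>PiM I (\<lambda>_. \<nu>)) = (\<integral>t. h t \<partial>\<nu>)"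
    and integrable_PiM_component1: "integrable (PiM I (\<lambda>_. \<nu>)) (\<lambda>y. h (y i))"
proof -
  interpret prob_space \<nu> by fact
  interpret Q: product_prob_space "\<lambda>_. \<nu>" I by unfold_locales
  have d: "distr (PiM I (\<lambda>_. \<nu>)) \<nu> (\<lambda>y. y i) = \<nu>"
    using Q.PiM_component assms by auto
  have m: "(\<lambda>y. y i) \<in> PiM I (\<lambda>_. \<nu>) \<rightarrow>\<^sub>M \<nu>" using assms by auto
  show "(\<integral>y. h (y i) \<partial>PiM I (\<lambda>_. \<nu>)) = (\<integral>t. h t \<partial>\<nu>)"
    using integral_distr[OF m, of h] assms d by simp
  show "integrable (PiM I (\<lambda>_. \<nu>)) (\<lambda>y. h (y i))"
    using integrable_distr_eq[OF m, of h] assms d by simp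
qed

section \<open>Kernel smoothing of a density with Lipschitz derivative\<close>

lemma
  fixes \<phi> :: "real \<Rightarrow> real"
  assumes m: "\<phi> \<in> borel_measurable borel" and r: "a \<le> c"
    and out: "\<And>v. v \<notin> {a..c} \<Longrightarrow> \<phi> v = 0" and le: "\<And>v. v \<in> {a..c} \<Longrightarrow> \<bar>\<phi> v\<bar> \<le> C"
  shows integrable_bounded_support: "integrable lborel \<phi>"
    and integral_bounded_support: "\<bar>\<integral>v. \<phi> v \<partial>lborel\<bar> \<le> (c - a) * C"
proof -
  have i: "integrable lborel (\<lambda>v. C * indicator {a..c} v :: real)"
    by (intro integrable_mult_right integrable_real_indicator) (auto simp: r)
  have b: "\<bar>\<phi> v\<bar> \<le> C * indicator {a..c} v" for v
    using out[of v] le[of v] by (auto simp: indicator_def)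
  show int: "integrable lborel \<phi>"
    by (rule Bochner_Integration.integrable_bound[OF i]) (use m b in \<open>auto intro!: AE_I2 order_trans[OF b]\<close>)
  have "\<bar>\<integral>v. \<phi> v \<partial>lborel\<bar> \<le> (\<integral>v. \<bar>\<phi> v\<bar> \<partial>lborel)" by (rule integral_abs_bound)
  also have "\<dots> \<le> (\<integral>v. C * indicator {a..c} v \<partial>lborel)"
    by (intro integral_mono integrable_abs int i b)
  also have "\<dots> = (c - a) * C" using r by simp
  finally show "\<bar>\<integral>v. \<phi> v \<partial>lborel\<bar> \<le> (c - a) * C" .
qed

text \<open>Cauchy-Schwarz against the indicator of the support, obtained by expanding the square of
  \<open>\<phi>\<close> minus its mean value \<open>k\<close> there.\<close>

lemma integral_square_le_bounded_support:
  fixes \<phi> :: "real \<Rightarrow> real"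
  assumes r: "a < c" and out: "\<And>v. v \<notin> {a..c} \<Longrightarrow> \<phi> v = 0"
    and i1: "integrable lborel \<phi>" and i2: "integrable lborel (\<lambda>v. (\<phi> v)\<^sup>2)"
  shows "(\<integral>v. \<phi> v \<partial>lborel)\<^sup>2 \<le> (c - a) * (\<integral>v. (\<phi> v)\<^sup>2 \<partial>lborel)"
proof -
  define I where "I = (\<integral>v. \<phi> v \<partial>lborel)"
  define k where "k = I / (c - a)"
  have i3: "integrable lborel (\<lambda>v. k\<^sup>2 * indicator {a..c} v :: real)"
    by (intro integrable_mult_right integrable_real_indicator) (use r in auto)
  have "(\<phi> v - k)\<^sup>2 * indicator {a..c} v = (\<phi> v)\<^sup>2 - 2 * k * \<phi> v + k\<^sup>2 * indicator {a..c} v" for v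
    using out[of v] by (auto simp: indicator_def power2_eq_square algebra_simps)
  then have "0 \<le> (\<phi> v)\<^sup>2 - 2 * k * \<phi> v + k\<^sup>2 * indicator {a..c} v" for v
    by (metis indicator_pos_le zero_le_mult_iff zero_le_power2)
  then have "0 \<le> (\<integral>v. (\<phi> v)\<^sup>2 - 2 * k * \<phi> v + k\<^sup>2 * indicator {a..c} v \<partial>lborel)"
    by (intro Bochner_Integration.integral_nonneg)
  also have "\<dots> = (\<integral>v. (\<phi> v)\<^sup>2 \<partial>lborel) - 2 * k * I + k\<^sup>2 * (c - a)"
    using i1 i2 i3 r by (simp add: I_def)
  finally have "0 \<le> (c - a) * ((\<integral>v. (\<phi> v)\<^sup>2 \<partial>lborel) - 2 * k * I + k\<^sup>2 * (c - a))"
    using r by simp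
  also have "\<dots> = (c - a) * (\<integral>v. (\<phi> v)\<^sup>2 \<partial>lborel) - 2 * (k * (c - a)) * I + (k * (c - a))\<^sup>2"
    by (simp add: algebra_simps power2_eq_square)
  also have "k * (c - a) = I" using r by (simp add: k_def)
  finally show ?thesis using r by (simp add: I_def power2_eq_square)
qed

text \<open>A bounded second derivative enters as the Lipschitz constant \<open>L\<close> of
  \<open>f'\<close>. Strict positivity of \<open>L\<close> allows the division in
  \<open>deriv_square_le\<close>; enlarging \<open>L\<close> costs nothing.\<close>

locale smooth_density =
  fixes f f' :: "real \<Rightarrow> real" and A L :: real
  assumes f_nonneg: "0 \<le> f t" and f_le: "f t \<le> A"
    and f_deriv: "(f has_real_derivative f' t) (at t)"
    and f'_lipschitz: "\<bar>f' s - f' t\<bar> \<le> L * \<bar>s - t\<bar>" and L_pos: "0 < L"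
    and prob_f: "prob_space (density lborel (\<lambda>t. ennreal (f t)))"
begin

abbreviation "\<nu> \<equiv> density lborel (\<lambda>t. ennreal (f t))"

sublocale prob_space \<nu> by (rule prob_f)

lemma taylor: "\<bar>f (x + h) - f x - f' x * h\<bar> \<le> L * h\<^sup>2"
proof -
  have "\<exists>\<xi>. \<bar>\<xi> - x\<bar> \<le> \<bar>h\<bar> \<and> f (x + h) - f x = h * f' \<xi>"
  proof (cases h "0 :: real" rule: linorder_cases)
    case equal then show ?thesis by (auto intro: exI[of _ x])
  next
    case greater
    then show ?thesis using MVT2[of x "x + h" f f'] f_deriv by force
  next
    case less
    then obtain z where "z > x + h" "z < x" "f x - f (x + h) = (x - (x + h)) * f' z"
      using MVT2[of "x + h" x f f'] f_deriv by force
    then show ?thesis by (intro exI[of _ z]) auto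
  qed
  then obtain \<xi> where \<xi>: "\<bar>\<xi> - x\<bar> \<le> \<bar>h\<bar>" "f (x + h) - f x = h * f' \<xi>" by blast
  have "\<bar>f (x + h) - f x - f' x * h\<bar> = \<bar>h\<bar> * \<bar>f' \<xi> - f' x\<bar>"
    using \<xi>(2) by (simp only: abs_mult[symmetric]) (simp add: algebra_simps)
  also have "\<dots> \<le> \<bar>h\<bar> * (L * \<bar>h\<bar>)"
    using order_trans[OF f'_lipschitz mult_left_mono[OF \<xi>(1)]] L_pos by (intro mult_left_mono) auto
  finally show ?thesis by (simp add: power2_eq_square mult_ac)
qed

text \<open>Nonnegativity of \<open>f\<close> is tested at the minimiser
  \<open>- f' x / (2 * L)\<close> of the parabola in \<open>h\<close> that dominates
  \<open>f (x + h)\<close> by \<open>taylor\<close>. The constant is not sharp, since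
  \<open>taylor\<close> has \<open>L\<close> in place of \<open>L / 2\<close>.\<close>

lemma deriv_square_le: "(f' x)\<^sup>2 \<le> 4 * L * f x"
proof -
  have "0 \<le> f (x + - f' x / (2 * L))" by (rule f_nonneg)
  also have "\<dots> \<le> f x + f' x * (- f' x / (2 * L)) + L * (- f' x / (2 * L))\<^sup>2"
    using taylor[of x "- f' x / (2 * L)"] by linarith
  also have "\<dots> = f x - (f' x)\<^sup>2 / (4 * L)"
    using L_pos by (simp add: field_simps power2_eq_square)
  finally show ?thesis using L_pos by (simp add: field_simps)
qed

lemma f_measurable[measurable]: "f \<in> borel_measurable borel"
  by (intro borel_measurable_continuous_onI continuous_at_imp_continuous_on)
    (auto intro: DERIV_isCont f_deriv)

lemma f'_continuous: "continuous_on UNIV f'"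
proof (rule continuous_on_iff[THEN iffD2], intro ballI allI impI)
  fix x e :: real assume "e > 0"
  then show "\<exists>d>0. \<forall>x'\<in>UNIV. dist x' x < d \<longrightarrow> dist (f' x') (f' x) < e"
    using L_pos f'_lipschitz[of _ x]
    by (intro exI[of _ "e / L"]) (auto simp: dist_real_def pos_less_divide_eq mult.commute intro: le_less_trans)
qed

lemma f'_measurable[measurable]: "f' \<in> borel_measurable borel"
  by (intro borel_measurable_continuous_onI f'_continuous)

lemma integral_\<nu>:
  fixes \<phi> :: "real \<Rightarrow> real"
  assumes "\<phi> \<in> borel_measurable borel"
  shows "(\<integral>t. \<phi> t \<partial>\<nu>) = (\<integral>t. \<phi> t * f t \<partial>lborel)"
  using assms f_nonneg by (subst integral_density) (auto simp: mult.commute)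

lemma integral_\<nu>_affine:
  fixes \<phi> :: "real \<Rightarrow> real"
  assumes [measurable]: "\<phi> \<in> borel_measurable borel" and "b > 0"
  shows "(\<integral>t. \<phi> ((t - e) / b) \<partial>\<nu>) = b * (\<integral>v. \<phi> v * f (e + b * v) \<partial>lborel)"
proof -
  have "(\<integral>t. \<phi> ((t - e) / b) \<partial>\<nu>) = (\<integral>t. \<phi> ((t - e) / b) * f t \<partial>lborel)"
    by (rule integral_\<nu>) measurable
  also have "\<dots> = b * (\<integral>v. \<phi> v * f (e + b * v) \<partial>lborel)"
    using lborel_integral_real_affine[of b "\<lambda>t. \<phi> ((t - e) / b) * f t" e] \<open>b > 0\<close> by simp
  finally show ?thesis .
qed

end

locale kernel_density = smooth_density +
  fixes K :: "real \<Rightarrow> real" and B \<Lambda> \<rho> :: real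
  assumes K_le: "\<bar>K v\<bar> \<le> B" and K_lipschitz: "\<bar>K u - K v\<bar> \<le> \<Lambda> * \<bar>u - v\<bar>"
    and K_cont: "continuous_on UNIV K"
    and K_supp: "\<rho> < \<bar>v\<bar> \<Longrightarrow> K v = 0" and \<rho>_pos: "0 < \<rho>"
    and K_int: "(\<integral>v. K v \<partial>lborel) = 1" and K_first: "(\<integral>v. v * K v \<partial>lborel) = 0"
begin

lemma K_measurable[measurable]: "K \<in> borel_measurable borel"
  by (intro borel_measurable_continuous_onI K_cont)

lemma B_nonneg: "0 \<le> B" using K_le[of 0] by linarith
lemma A_nonneg: "0 \<le> A" using f_nonneg[of 0] f_le[of 0] by linarith
lemma \<Lambda>_nonneg: "0 \<le> \<Lambda>" using K_lipschitz[of 1 0] by simp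

lemma supp_out: "v \<notin> {-\<rho>..\<rho>} \<Longrightarrow> K v = 0" using K_supp[of v] by auto

text \<open>\<open>b * V b e\<close> is the second moment of the kernel term under the error law
  (\<open>kernel_second_moment\<close>), and \<open>- b * slope b e\<close> is the derivative at
  zero of the mean kernel term under a shift of the error
  (\<open>kernel_shift_mean\<close>).\<close>

definition "V b e = (\<integral>v. (K v)\<^sup>2 * f (e + b * v) \<partial>lborel)"
definition "slope b e = (\<integral>v. K v * f' (e + b * v) \<partial>lborel)"

lemma K_sq_le: "(K v)\<^sup>2 \<le> B\<^sup>2" using K_le[of v] B_nonneg by (metis abs_le_square_iff abs_of_nonneg)

lemma V_integrable: "integrable lborel (\<lambda>v. (K v)\<^sup>2 * f (e + b * v))"
  and V_le: "V b e \<le> 2 * \<rho> * (B\<^sup>2 * A)" and V_nonneg: "0 \<le> V b e"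
proof -
  have le: "\<bar>(K v)\<^sup>2 * f (e + b * v)\<bar> \<le> B\<^sup>2 * A" for v
    using K_sq_le[of v] f_nonneg f_le by (simp add: abs_mult mult_mono)
  show "integrable lborel (\<lambda>v. (K v)\<^sup>2 * f (e + b * v))"
    by (rule integrable_bounded_support[where a = "-\<rho>" and c = \<rho>, OF _ _ _ le]) (use \<rho>_pos supp_out in auto)
  have "\<bar>V b e\<bar> \<le> (\<rho> - - \<rho>) * (B\<^sup>2 * A)" unfolding V_def
    by (rule integral_bounded_support[OF _ _ _ le]) (use \<rho>_pos supp_out in auto)
  then show "V b e \<le> 2 * \<rho> * (B\<^sup>2 * A)" by simp
  show "0 \<le> V b e" unfolding V_def by (intro Bochner_Integration.integral_nonneg) (use f_nonneg in auto)
qed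

lemma Kf_integrable: "integrable lborel (\<lambda>v. K v * f (e + b * v))"
  by (rule integrable_bounded_support[of _ "-\<rho>" \<rho> "B * A"])
    (use \<rho>_pos supp_out K_le f_nonneg f_le B_nonneg in \<open>auto simp: abs_mult intro!: mult_mono\<close>)

text \<open>One factor \<open>f\<close> is bounded by \<open>A\<close>, the other is kept so that
  the integrand of \<open>V\<close> reappears. The squared mean of the kernel term is thereby a
  factor \<open>b\<close> smaller than its second moment, and the variance keeps at least half of
  the latter once \<open>b\<close> is small.\<close>

lemma Kf_square_le: "(\<integral>v. K v * f (e + b * v) \<partial>lborel)\<^sup>2 \<le> 2 * \<rho> * A * V b e"
proof -
  have le: "(K v * f (e + b * v))\<^sup>2 \<le> A * ((K v)\<^sup>2 * f (e + b * v))" for v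
    using mult_left_mono[OF mult_right_mono[OF f_le f_nonneg, of "e + b * v" "e + b * v"], of "(K v)\<^sup>2"]
    by (simp add: power_mult_distrib power2_eq_square mult_ac)
  have i2: "integrable lborel (\<lambda>v. (K v * f (e + b * v))\<^sup>2)"
    by (rule Bochner_Integration.integrable_bound[OF integrable_mult_right[OF V_integrable[of e b], of A]])
      (use le in \<open>auto intro!: AE_I2 order_trans[OF le]\<close>)
  have "(\<integral>v. K v * f (e + b * v) \<partial>lborel)\<^sup>2 \<le> (\<rho> - - \<rho>) * (\<integral>v. (K v * f (e + b * v))\<^sup>2 \<partial>lborel)"
    by (rule integral_square_le_bounded_support) (use \<rho>_pos supp_out Kf_integrable i2 in auto)
  also have "(\<integral>v. (K v * f (e + b * v))\<^sup>2 \<partial>lborel) \<le> (\<integral>v. A * ((K v)\<^sup>2 * f (e + b * v)) \<partial>lborel)"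
    by (intro integral_mono i2 integrable_mult_right V_integrable le)
  finally show ?thesis using \<rho>_pos by (simp add: V_def mult_ac)
qed

lemma Kf'_integrable: "integrable lborel (\<lambda>v. K v * f' (e + b * v))"
proof (rule integrable_bounded_support[of _ "-\<rho>" \<rho> "B * (\<bar>f' e\<bar> + L * (\<bar>b\<bar> * \<rho>))"])
  fix v assume v: "v \<in> {-\<rho>..\<rho>}"
  have "\<bar>f' (e + b * v)\<bar> \<le> \<bar>f' e\<bar> + L * \<bar>b * v\<bar>"
    using f'_lipschitz[of "e + b * v" e] by simp
  also have "L * \<bar>b * v\<bar> \<le> L * (\<bar>b\<bar> * \<rho>)"
    unfolding abs_mult using v L_pos by (intro mult_left_mono) auto
  finally show "\<bar>K v * f' (e + b * v)\<bar> \<le> B * (\<bar>f' e\<bar> + L * (\<bar>b\<bar> * \<rho>))"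
    unfolding abs_mult using K_le B_nonneg by (intro mult_mono) auto
qed (use \<rho>_pos supp_out in auto)

text \<open>After Cauchy-Schwarz on the support of \<open>K\<close>, the pointwise bound of
  \<open>f'\<close> squared by \<open>f\<close> produces exactly the integrand of \<open>V\<close>.
  No lower bound on \<open>f\<close> near \<open>e\<close> is involved.\<close>

lemma slope_square_le: "(slope b e)\<^sup>2 \<le> 8 * L * \<rho> * V b e"
proof -
  have le: "(K v * f' (e + b * v))\<^sup>2 \<le> 4 * L * ((K v)\<^sup>2 * f (e + b * v))" for v
    using mult_left_mono[OF deriv_square_le[of "e + b * v"], of "(K v)\<^sup>2"]
    by (simp add: power_mult_distrib mult_ac)
  have i2: "integrable lborel (\<lambda>v. (K v * f' (e + b * v))\<^sup>2)"
    by (rule Bochner_Integration.integrable_bound[OF integrable_mult_right[OF V_integrable[of e b], of "4 * L"]])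
      (use le in \<open>auto intro!: AE_I2 order_trans[OF le]\<close>)
  have "(slope b e)\<^sup>2 \<le> (\<rho> - - \<rho>) * (\<integral>v. (K v * f' (e + b * v))\<^sup>2 \<partial>lborel)" unfolding slope_def
    by (rule integral_square_le_bounded_support) (use \<rho>_pos supp_out Kf'_integrable i2 in auto)
  also have "(\<integral>v. (K v * f' (e + b * v))\<^sup>2 \<partial>lborel) \<le> (\<integral>v. 4 * L * ((K v)\<^sup>2 * f (e + b * v)) \<partial>lborel)"
    by (intro integral_mono i2 integrable_mult_right V_integrable le)
  finally show ?thesis using \<rho>_pos by (simp add: V_def mult_ac)
qed

lemma K_integrable: "integrable lborel K"
  by (rule integrable_bounded_support[of _ "-\<rho>" \<rho> B]) (use \<rho>_pos supp_out K_le in auto)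

lemma vK_integrable: "integrable lborel (\<lambda>v. v * K v)"
  by (rule integrable_bounded_support[of _ "-\<rho>" \<rho> "\<rho> * B"])
    (use \<rho>_pos supp_out K_le in \<open>auto simp: abs_mult intro!: mult_mono\<close>)

text \<open>The linear Taylor term is annihilated by the vanishing first moment of \<open>K\<close>,
  which leaves a bias of order \<open>b\<^sup>2\<close>.\<close>

lemma kernel_bias:
  assumes b: "b > 0"
  shows "\<bar>(\<integral>t. K ((t - e) / b) / b \<partial>\<nu>) - f e\<bar> \<le> 2 * \<rho> * (B * (L * (b * \<rho>)\<^sup>2))"
proof -
  define r where "r = (\<lambda>v. K v * (f (e + b * v) - f e - f' e * (b * v)))"
  have r: "r = (\<lambda>v. K v * f (e + b * v) - f e * K v - f' e * b * (v * K v))"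
    by (auto simp: r_def algebra_simps)
  have "(\<integral>t. K ((t - e) / b) / b \<partial>\<nu>) = (\<integral>v. K v * f (e + b * v) \<partial>lborel)"
    using integral_\<nu>_affine[of K b e] b by simp
  then have "(\<integral>t. K ((t - e) / b) / b \<partial>\<nu>) - f e = (\<integral>v. r v \<partial>lborel)"
    unfolding r using Kf_integrable K_integrable vK_integrable
    by (simp add: K_int K_first)
  also have "\<bar>\<dots>\<bar> \<le> (\<rho> - - \<rho>) * (B * (L * (b * \<rho>)\<^sup>2))"
  proof (rule integral_bounded_support)
    fix v assume v: "v \<in> {-\<rho>..\<rho>}"
    have "\<bar>f (e + b * v) - f e - f' e * (b * v)\<bar> \<le> L * (b * v)\<^sup>2" by (rule taylor)
    also have "(b * v)\<^sup>2 \<le> (b * \<rho>)\<^sup>2"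
      unfolding abs_le_square_iff[symmetric] abs_mult using v b by (intro mult_left_mono) auto
    finally show "\<bar>r v\<bar> \<le> B * (L * (b * \<rho>)\<^sup>2)" using L_pos B_nonneg K_le
      unfolding r_def abs_mult by (intro mult_mono) auto
  qed (use \<rho>_pos supp_out in \<open>auto simp: r_def\<close>)
  finally show ?thesis by simp
qed

lemma kernel_second_moment:
  assumes b: "b > 0"
  shows "(\<integral>t. (K ((t - e) / b))\<^sup>2 \<partial>\<nu>) = b * V b e"
  using integral_\<nu>_affine[of "\<lambda>v. (K v)\<^sup>2" b e] b by (simp add: V_def)

lemma kernel_mean_square_le:
  assumes b: "b > 0"
  shows "(\<integral>t. K ((t - e) / b) \<partial>\<nu>)\<^sup>2 \<le> b\<^sup>2 * (2 * \<rho> * A * V b e)"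
  using integral_\<nu>_affine[of K b e] b Kf_square_le[where b=b and e=e] by (simp add: power_mult_distrib)

text \<open>The substitution carries the shift from the kernel into the density, so the expansion is
  one of \<open>f\<close>. The error is \<open>b * s\<^sup>2\<close> up to a constant, whereas a
  second order expansion of \<open>K\<close> itself would cost a further factor
  \<open>1 / b\<^sup>2\<close>.\<close>

lemma kernel_shift_mean:
  assumes b: "b > 0"
  shows "\<bar>(\<integral>t. K ((t + s - e) / b) - K ((t - e) / b) \<partial>\<nu>) + b * s * slope b e\<bar>
    \<le> b * (2 * \<rho> * (B * (L * s\<^sup>2)))"
proof -
  define r where "r = (\<lambda>v. K v * (f (e + b * v + - s) - f (e + b * v) - f' (e + b * v) * - s))"
  have r: "r = (\<lambda>v. K v * f (e - s + b * v) - K v * f (e + b * v) + s * (K v * f' (e + b * v)))"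
    by (auto simp: r_def algebra_simps)
  have i: "integrable \<nu> (\<lambda>t. K ((t - e) / b))" for e
    by (rule integrable_const_bound[of _ B]) (use K_le in auto)
  have eq: "K ((t + s - e) / b) = K ((t - (e - s)) / b)" for t by (simp add: algebra_simps)
  have h1: "(\<integral>t. K ((t + s - e) / b) - K ((t - e) / b) \<partial>\<nu>)
      = b * (\<integral>v. K v * f (e - s + b * v) \<partial>lborel) - b * (\<integral>v. K v * f (e + b * v) \<partial>lborel)"
    unfolding eq using i by (simp add: integral_\<nu>_affine[OF K_measurable b])
  have h2: "(\<integral>v. r v \<partial>lborel) = (\<integral>v. K v * f (e - s + b * v) \<partial>lborel)
      - (\<integral>v. K v * f (e + b * v) \<partial>lborel) + s * slope b e"
    unfolding r using Kf_integrable Kf'_integrable by (simp add: slope_def)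
  have "(\<integral>t. K ((t + s - e) / b) - K ((t - e) / b) \<partial>\<nu>) + b * s * slope b e = b * (\<integral>v. r v \<partial>lborel)"
    unfolding h1 h2 by (simp add: algebra_simps)
  also have "\<bar>\<dots>\<bar> \<le> b * ((\<rho> - - \<rho>) * (B * (L * s\<^sup>2)))"
  proof -
    have "\<bar>\<integral>v. r v \<partial>lborel\<bar> \<le> (\<rho> - - \<rho>) * (B * (L * s\<^sup>2))"
    proof (rule integral_bounded_support)
      fix v
      show "\<bar>r v\<bar> \<le> B * (L * s\<^sup>2)"
        unfolding r_def abs_mult using K_le B_nonneg taylor[of "e + b * v" "- s"]
        by (intro mult_mono) auto
    qed (use \<rho>_pos supp_out in \<open>auto simp: r_def\<close>)
    then show ?thesis using b by (simp add: abs_mult)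
  qed
  finally show ?thesis by simp
qed

text \<open>The Lipschitz bound gives \<open>(s - s')\<^sup>2 / b\<^sup>2\<close>, and the increment
  lives on a set of length of order \<open>b\<close>, which restores one power of
  \<open>b\<close>.\<close>

lemma kernel_shift_square:
  assumes b: "b > 0"
  shows "(\<integral>t. (K ((t + s - e) / b) - K ((t + s' - e) / b))\<^sup>2 \<partial>\<nu>) \<le> 4 * A * \<rho> * \<Lambda>\<^sup>2 * (s - s')\<^sup>2 / b"
proof -
  define S where "S = (\<lambda>s. {e - s - \<rho> * b..e - s + \<rho> * b})"
  define c where "c = A * (\<Lambda>\<^sup>2 * (s - s')\<^sup>2 / b\<^sup>2)"
  have out: "K ((t + s - e) / b) = 0" if "t \<notin> S s" for s t
  proof (rule K_supp)
    have "\<rho> * b < \<bar>t + s - e\<bar>" using that by (auto simp: S_def)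
    then show "\<rho> < \<bar>(t + s - e) / b\<bar>" using b by (simp add: abs_mult pos_less_divide_eq)
  qed
  \<comment> \<open>The two support intervals are kept separately, whatever the distance between the
    shifts, so the bound holds for all \<open>s\<close> and \<open>s'\<close>.\<close>
  have i: "integrable lborel (\<lambda>t. c * (indicator (S s) t + indicator (S s') t) :: real)"
    using \<rho>_pos b by (intro integrable_mult_right Bochner_Integration.integrable_add integrable_real_indicator)
      (auto simp: S_def emeasure_lborel_Icc_eq)
  have c0: "0 \<le> c" using A_nonneg by (simp add: c_def)
  have le: "(K ((t + s - e) / b) - K ((t + s' - e) / b))\<^sup>2 * f t \<le> c * (indicator (S s) t + indicator (S s') t)" for t
  proof (cases "t \<in> S s \<union> S s'")
    case False
    then show ?thesis using out[of t s] out[of t s'] by simp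
  next
    case True
    have "\<bar>K ((t + s - e) / b) - K ((t + s' - e) / b)\<bar> \<le> \<Lambda> * \<bar>(s - s') / b\<bar>"
      using K_lipschitz[of "(t + s - e) / b" "(t + s' - e) / b"] by (simp add: diff_divide_distrib[symmetric])
    then have "(K ((t + s - e) / b) - K ((t + s' - e) / b))\<^sup>2 \<le> (\<Lambda> * ((s - s') / b))\<^sup>2"
      unfolding abs_le_square_iff[symmetric] by (simp add: abs_mult \<Lambda>_nonneg)
    then have "(K ((t + s - e) / b) - K ((t + s' - e) / b))\<^sup>2 * f t \<le> (\<Lambda> * ((s - s') / b))\<^sup>2 * A"
      using f_nonneg f_le by (intro mult_mono) auto
    also have "\<dots> = c * 1" by (simp add: c_def power_mult_distrib power_divide mult_ac)
    also have "\<dots> \<le> c * (indicator (S s) t + indicator (S s') t)"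
      using True c0 by (intro mult_left_mono) (auto simp: indicator_def)
    finally show ?thesis .
  qed
  have "(\<integral>t. (K ((t + s - e) / b) - K ((t + s' - e) / b))\<^sup>2 \<partial>\<nu>)
      = (\<integral>t. (K ((t + s - e) / b) - K ((t + s' - e) / b))\<^sup>2 * f t \<partial>lborel)"
    by (rule integral_\<nu>) measurable
  also have "\<dots> \<le> (\<integral>t. c * (indicator (S s) t + indicator (S s') t) \<partial>lborel)"
    by (rule integral_mono_AE') (use i le f_nonneg c0 in auto)
  also have "\<dots> = c * (4 * \<rho> * b)"
  proof -
    have "integrable lborel (indicator (S s) :: real \<Rightarrow> real)" "measure lborel (S s) = 2 * \<rho> * b" for s
      using \<rho>_pos b by (auto simp: S_def emeasure_lborel_Icc_eq)
    then show ?thesis by simp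
  qed
  also have "\<dots> = 4 * A * \<rho> * \<Lambda>\<^sup>2 * (s - s')\<^sup>2 / b"
    using b by (simp add: c_def field_simps power2_eq_square)
  finally show ?thesis .
qed

end

section \<open>The estimator for a fixed design\<close>

lemma (in prob_space) square_integral_le:
  fixes h :: "'a \<Rightarrow> real"
  assumes "integrable M h" "integrable M (\<lambda>x. (h x)\<^sup>2)"
  shows "(\<integral>x. h x \<partial>M)\<^sup>2 \<le> (\<integral>x. (h x)\<^sup>2 \<partial>M)"
  using variance_eq[OF assms] variance_positive[of h] by simp

lemma (in prob_space) integral_abs_le_sqrt:
  fixes h :: "'a \<Rightarrow> real"
  assumes "h \<in> borel_measurable M" "integrable M (\<lambda>x. (h x)\<^sup>2)"
  shows "(\<integral>x. \<bar>h x\<bar> \<partial>M) \<le> sqrt (\<integral>x. (h x)\<^sup>2 \<partial>M)"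
  using square_integral_le[of "\<lambda>x. \<bar>h x\<bar>"] assms square_integrable_imp_integrable[OF assms]
  by (intro real_le_rsqrt) auto

text \<open>The design is frozen here: weights \<open>w\<close> and biases \<open>\<beta>\<close>
  are constants, and only the errors, with law \<open>Q\<close>, are random. \<open>J\<close>
  collects the indices that survive trimming, while the weights run over all of \<open>I\<close>.
  The assumption \<open>loo\<close> is what makes \<open>\<delta> i\<close> free of the error with
  index \<open>i\<close>.\<close>

locale loo_design = kernel_density +
  fixes I J :: "nat set" and w :: "nat \<Rightarrow> nat \<Rightarrow> real" and \<beta> :: "nat \<Rightarrow> real" and b e :: real
  assumes finite_I: "finite I" and JI: "J \<subseteq> I" and J_ne: "J \<noteq> {}" and b_pos: "0 < b"
    and loo: "\<And>i. i \<in> J \<Longrightarrow> w i i = 0"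
    and moment2: "integrable \<nu> (\<lambda>t. t\<^sup>2)" and centred: "(\<integral>t. t \<partial>\<nu>) = 0"
begin

abbreviation "Q \<equiv> PiM I (\<lambda>_. \<nu>)"
abbreviation "s2 \<equiv> (\<integral>t. t\<^sup>2 \<partial>\<nu>)"
abbreviation "N \<equiv> real (card J)"

sublocale Q: product_prob_space "\<lambda>_. \<nu>" I
  by unfold_locales

lemma finite_J: "finite J" using finite_I JI finite_subset by blast
lemma N_pos: "0 < N" using finite_J J_ne by (simp add: card_gt_0_iff)
lemma s2_nonneg: "0 \<le> s2" by (intro Bochner_Integration.integral_nonneg) auto

lemma prob_UNIV: "measure \<nu> UNIV = 1" using prob_space by simp

lemma moment1: "integrable \<nu> (\<lambda>t. t)"
  using square_integrable_imp_integrable[of "\<lambda>t. t"] moment2 by simp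

lemma component_measurable: "i \<in> I \<Longrightarrow> (\<lambda>y. y i) \<in> borel_measurable Q"
  using measurable_component_singleton[of i I "\<lambda>_. \<nu>"] by simp

lemma square_integrable_component: "i \<in> I \<Longrightarrow> integrable Q (\<lambda>y. (y i)\<^sup>2)"
  and integrable_component: "i \<in> I \<Longrightarrow> integrable Q (\<lambda>y. y i)"
  and integral_component: "i \<in> I \<Longrightarrow> (\<integral>y. y i \<partial>Q) = 0"
  and integral_square_component: "i \<in> I \<Longrightarrow> (\<integral>y. (y i)\<^sup>2 \<partial>Q) = s2"
  using integrable_PiM_component1[OF prob_f finite_I _ moment2] integrable_PiM_component1[OF prob_f finite_I _ moment1]
    integral_PiM_component1[OF prob_f finite_I _ moment2] integral_PiM_component1[OF prob_f finite_I _ moment1]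
  by (auto simp: centred)

lemma integrable_component_mult:
  assumes "i \<in> I" "j \<in> I"
  shows "integrable Q (\<lambda>y. y i * y j)"
proof (rule Bochner_Integration.integrable_bound)
  show "integrable Q (\<lambda>y. (y i)\<^sup>2 + (y j)\<^sup>2)" using assms square_integrable_component by auto
  have "\<bar>u * v\<bar> \<le> \<bar>u\<^sup>2 + v\<^sup>2\<bar>" for u v :: real
  proof -
    have "2 * \<bar>u * v\<bar> \<le> u\<^sup>2 + v\<^sup>2"
      using sum_squares_bound[of "\<bar>u\<bar>" "\<bar>v\<bar>"] by (simp add: abs_mult)
    then show ?thesis using abs_ge_zero[of "u * v"] by linarith
  qed
  then show "AE y in Q. norm (y i * y j) \<le> norm ((y i)\<^sup>2 + (y j)\<^sup>2)" by simp
qed (use assms component_measurable in \<open>auto intro!: borel_measurable_times\<close>)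

lemma integral_component_mult:
  assumes "i \<in> I" "j \<in> I" "i \<noteq> j"
  shows "(\<integral>y. y i * y j \<partial>Q) = 0"
  using assms integrable_component_mult
  by (intro integral_PiM_mult_zero[OF prob_f finite_I assms(1)]) (auto simp: centred)

lemma
  shows integrable_linear_square: "integrable Q (\<lambda>y. (\<Sum>j\<in>I. c j * y j)\<^sup>2)"
    and integral_linear_square: "(\<integral>y. (\<Sum>j\<in>I. c j * y j)\<^sup>2 \<partial>Q) = s2 * (\<Sum>j\<in>I. (c j)\<^sup>2)"
    and integrable_linear: "integrable Q (\<lambda>y. \<Sum>j\<in>I. c j * y j)"
    and integral_linear: "(\<integral>y. (\<Sum>j\<in>I. c j * y j) \<partial>Q) = 0"
proof -
  have eq: "(\<Sum>j\<in>I. c j * y j)\<^sup>2 = (\<Sum>j\<in>I. \<Sum>k\<in>I. c j * c k * (y j * y k))" for y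
    unfolding power2_eq_square sum_product by (intro sum.cong refl) (simp add: mult_ac)
  show "integrable Q (\<lambda>y. (\<Sum>j\<in>I. c j * y j)\<^sup>2)"
    unfolding eq by (intro Bochner_Integration.integrable_sum integrable_mult_right integrable_component_mult)
  have "(\<integral>y. (\<Sum>j\<in>I. c j * y j)\<^sup>2 \<partial>Q) = (\<Sum>j\<in>I. \<Sum>k\<in>I. c j * c k * (\<integral>y. y j * y k \<partial>Q))"
    unfolding eq using integrable_component_mult by (simp add: Bochner_Integration.integral_sum)
  also have "\<dots> = (\<Sum>j\<in>I. \<Sum>k\<in>I. if k = j then s2 * (c j)\<^sup>2 else 0)"
    using integral_component_mult integral_square_component
    by (intro sum.cong refl) (auto simp: power2_eq_square)
  finally show "(\<integral>y. (\<Sum>j\<in>I. c j * y j)\<^sup>2 \<partial>Q) = s2 * (\<Sum>j\<in>I. (c j)\<^sup>2)"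
    using finite_I by (simp add: sum_distrib_left)
  show "integrable Q (\<lambda>y. \<Sum>j\<in>I. c j * y j)"
    by (intro Bochner_Integration.integrable_sum integrable_mult_right integrable_component)
  show "(\<integral>y. (\<Sum>j\<in>I. c j * y j) \<partial>Q) = 0"
    using integrable_component integral_component by (simp add: Bochner_Integration.integral_sum)
qed

definition "\<delta> i y = - \<beta> i - (\<Sum>j\<in>I. w i j * y j)"

lemma \<delta>_measurable: "\<delta> i \<in> borel_measurable Q"
  unfolding \<delta>_def using component_measurable
  by (intro borel_measurable_diff borel_measurable_sum borel_measurable_times borel_measurable_const) auto

lemma \<delta>_upd: 
  assumes "j \<in> I"
  shows "\<delta> i (y(j := t)) = \<delta> i y - w i j * (t - y j)"
proof -
  have "(\<Sum>k\<in>I. w i k * (y(j := t)) k) = w i j * t + (\<Sum>k\<in>I - {j}. w i k * y k)"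
    using assms finite_I by (subst sum.remove[of I j]) auto
  moreover have "(\<Sum>k\<in>I. w i k * y k) = w i j * y j + (\<Sum>k\<in>I - {j}. w i k * y k)"
    using assms finite_I by (subst sum.remove[of I j]) auto
  ultimately show ?thesis by (simp add: \<delta>_def algebra_simps)
qed

lemma \<delta>_upd_self: "i \<in> J \<Longrightarrow> \<delta> i (y(i := t)) = \<delta> i y"
  using \<delta>_upd[of i i y t] loo JI by auto

lemma
  shows integrable_\<delta>_square: "integrable Q (\<lambda>y. (\<delta> i y)\<^sup>2)"
    and integral_\<delta>_square: "(\<integral>y. (\<delta> i y)\<^sup>2 \<partial>Q) = (\<beta> i)\<^sup>2 + s2 * (\<Sum>j\<in>I. (w i j)\<^sup>2)"
proof -
  have eq: "(\<delta> i y)\<^sup>2 = (\<beta> i)\<^sup>2 + 2 * \<beta> i * (\<Sum>j\<in>I. w i j * y j) + (\<Sum>j\<in>I. w i j * y j)\<^sup>2" for y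
    by (simp add: \<delta>_def power2_eq_square algebra_simps)
  show "integrable Q (\<lambda>y. (\<delta> i y)\<^sup>2)"
    unfolding eq
    by (intro Bochner_Integration.integrable_add integrable_mult_right integrable_linear integrable_linear_square) simp
  show "(\<integral>y. (\<delta> i y)\<^sup>2 \<partial>Q) = (\<beta> i)\<^sup>2 + s2 * (\<Sum>j\<in>I. (w i j)\<^sup>2)"
    unfolding eq using integrable_linear integrable_linear_square integral_linear integral_linear_square
    by (simp add: Q.P.prob_space)
qed

section \<open>Mean and centred part of the kernel increment; cross moments of the centred
  parts\<close>

definition "mean s = (\<integral>t. K ((t + s - e) / b) - K ((t - e) / b) \<partial>\<nu>)"
definition "\<Gamma> t s = K ((t + s - e) / b) - K ((t - e) / b) - mean s"

definition "c1 = 4 * A * \<rho> * \<Lambda>\<^sup>2 / b"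

lemma c1_nonneg: "0 \<le> c1" using A_nonneg \<rho>_pos b_pos by (auto simp: c1_def)

lemma mean_measurable[measurable]: "mean \<in> borel_measurable borel"
  unfolding mean_def by measurable

lemma \<Gamma>_measurable[measurable]: 
  assumes [measurable]: "u \<in> borel_measurable R" "v \<in> borel_measurable R"
  shows "(\<lambda>x. \<Gamma> (u x) (v x)) \<in> borel_measurable R"
  unfolding \<Gamma>_def by measurable

lemma K_integrable_shift: "integrable \<nu> (\<lambda>t. K ((t + s - e) / b))"
  by (rule integrable_const_bound[of _ B]) (use K_le in auto)

lemma mean_le: "\<bar>mean s\<bar> \<le> 2 * B"
proof -
  have "\<bar>K u - K v\<bar> \<le> 2 * B" for u v using K_le[of u] K_le[of v] by linarith
  then have "(\<integral>t. \<bar>K ((t + s - e) / b) - K ((t - e) / b)\<bar> \<partial>\<nu>) \<le> 2 * B"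
    using K_integrable_shift[of s] K_integrable_shift[of 0]
    by (intro integral_le_const) auto
  then show ?thesis unfolding mean_def by (rule order_trans[OF integral_abs_bound])
qed

lemma \<Gamma>_le: "\<bar>\<Gamma> t s\<bar> \<le> 4 * B"
  unfolding \<Gamma>_def using K_le[of "(t + s - e) / b"] K_le[of "(t - e) / b"] mean_le[of s] by linarith

lemma \<Gamma>_mean_zero: "(\<integral>t. \<Gamma> t s \<partial>\<nu>) = 0"
  using K_integrable_shift[of s] K_integrable_shift[of 0]
  unfolding \<Gamma>_def by (simp add: mean_def prob_UNIV)

lemma \<Gamma>_zero[simp]: "\<Gamma> t 0 = 0"
  by (simp add: \<Gamma>_def mean_def)

text \<open>The difference is an uncentred kernel increment minus its own mean, and centring can
  only lower a second moment.\<close>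

lemma \<Gamma>_square_diff: "(\<integral>t. (\<Gamma> t s - \<Gamma> t s')\<^sup>2 \<partial>\<nu>) \<le> c1 * (s - s')\<^sup>2"
proof -
  define h where "h = (\<lambda>t. K ((t + s - e) / b) - K ((t + s' - e) / b))"
  have hb: "\<bar>h t\<bar> \<le> 2 * B" for t
    unfolding h_def using K_le[of "(t + s - e) / b"] K_le[of "(t + s' - e) / b"] by linarith
  have hm: "h \<in> borel_measurable \<nu>" unfolding h_def by measurable
  have h: "integrable \<nu> h" by (rule integrable_const_bound[of _ "2 * B"]) (use hb hm in auto)
  have "(h t)\<^sup>2 \<le> (2 * B)\<^sup>2" for t
    using power_mono[OF hb abs_ge_zero, of t 2] by (simp only: power2_abs)
  then have h2: "integrable \<nu> (\<lambda>t. (h t)\<^sup>2)"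
    using hm by (intro integrable_const_bound[of _ "(2 * B)\<^sup>2"] AE_I2 borel_measurable_power) (simp_all only: real_norm_def abs_power2)
  have "(\<integral>t. h t \<partial>\<nu>) = mean s - mean s'"
    using K_integrable_shift[of s] K_integrable_shift[of s'] K_integrable_shift[of 0]
    unfolding h_def mean_def by simp
  then have "\<Gamma> t s - \<Gamma> t s' = h t - (\<integral>t. h t \<partial>\<nu>)" for t by (simp add: \<Gamma>_def h_def)
  then have "(\<integral>t. (\<Gamma> t s - \<Gamma> t s')\<^sup>2 \<partial>\<nu>) = variance h" by simp
  also have "\<dots> \<le> (\<integral>t. (h t)\<^sup>2 \<partial>\<nu>)" using variance_eq[OF h h2] by simp
  also have "\<dots> \<le> c1 * (s - s')\<^sup>2"
    using kernel_shift_square[OF b_pos, of s e s'] by (simp only: h_def c1_def times_divide_eq_left)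
  finally show ?thesis .
qed

definition "G i y = \<Gamma> (y i) (\<delta> i y)"
text \<open>Error \<open>j\<close> is deleted from the shift alone; the own error \<open>y i\<close>
  stays. Zero is the mean of the error, so for distinct indices the change in the shift has second
  moment \<open>s2 * (w i j)\<^sup>2\<close>.\<close>

definition "G' i j y = \<Gamma> (y i) (\<delta> i (y(j := 0)))"

lemma G_measurable: "i \<in> I \<Longrightarrow> G i \<in> borel_measurable Q"
  unfolding G_def using component_measurable by (intro \<Gamma>_measurable \<delta>_measurable) auto

lemma G'_measurable:
  assumes "i \<in> I" "j \<in> I"
  shows "G' i j \<in> borel_measurable Q"
  unfolding G'_def \<delta>_upd[OF assms(2)] using assms component_measurable
  by (intro \<Gamma>_measurable borel_measurable_diff borel_measurable_times borel_measurable_const \<delta>_measurable) auto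

lemma G_le: "\<bar>G i y\<bar> \<le> 4 * B" and G'_le: "\<bar>G' i j y\<bar> \<le> 4 * B"
  by (simp_all add: G_def G'_def \<Gamma>_le)

lemma bounded_mult_integrable:
  fixes u v :: "(nat \<Rightarrow> real) \<Rightarrow> real"
  assumes [measurable]: "u \<in> borel_measurable Q" "v \<in> borel_measurable Q"
    and "\<And>y. \<bar>u y\<bar> \<le> C" "\<And>y. \<bar>v y\<bar> \<le> C"
  shows "integrable Q (\<lambda>y. u y * v y)"
proof (rule Q.P.integrable_const_bound[of _ "C * C"])
  have "0 \<le> C" using assms(3)[of undefined] by linarith
  then show "AE y in Q. norm (u y * v y) \<le> C * C" using assms(3,4) by (auto simp: abs_mult intro!: AE_I2 mult_mono)
qed measurable

text \<open>Since \<open>\<delta> i\<close> ignores coordinate \<open>i\<close>, resampling that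
  coordinate leaves the shift fixed, and the inner integral is the one in
  \<open>\<Gamma>_square_diff\<close> with second shift zero.\<close>

lemma G_square_le:
  assumes i: "i \<in> J"
  shows "(\<integral>y. (G i y)\<^sup>2 \<partial>Q) \<le> c1 * ((\<beta> i)\<^sup>2 + s2 * (\<Sum>j\<in>I. (w i j)\<^sup>2))"
proof -
  have iI: "i \<in> I" using i JI by auto
  have int: "integrable Q (\<lambda>y. (G i y)\<^sup>2)"
    unfolding power2_eq_square by (intro bounded_mult_integrable[of _ _ "4 * B"] G_le G_measurable iI)
  have "(\<integral>y. (G i y)\<^sup>2 \<partial>Q) = (\<integral>y. (\<integral>t. (G i (y(i := t)))\<^sup>2 \<partial>\<nu>) \<partial>Q)"
    by (rule integral_PiM_resample[OF prob_f finite_I iI int, symmetric])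
  also have "\<dots> \<le> (\<integral>y. c1 * (\<delta> i y)\<^sup>2 \<partial>Q)"
  proof (rule integral_mono)
    show "integrable Q (\<lambda>y. \<integral>t. (G i (y(i := t)))\<^sup>2 \<partial>\<nu>)"
      by (rule integrable_PiM_resample[OF prob_f finite_I iI int])
    show "(\<integral>t. (G i (y(i := t)))\<^sup>2 \<partial>\<nu>) \<le> c1 * (\<delta> i y)\<^sup>2" for y
      using \<Gamma>_square_diff[of "\<delta> i y" 0] by (simp add: G_def \<delta>_upd_self i)
  qed (use integrable_\<delta>_square in auto)
  also have "\<dots> = c1 * ((\<beta> i)\<^sup>2 + s2 * (\<Sum>j\<in>I. (w i j)\<^sup>2))"
    by (simp only: integral_mult_right_zero integral_\<delta>_square)
  finally show ?thesis .
qed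

text \<open>Again coordinate \<open>i\<close> is integrated first, with both shifts fixed. They
  differ only through error \<open>j\<close>, so one squared weight comes out instead of the whole
  sum of them.\<close>

lemma G_influence_square_le:
  assumes i: "i \<in> J" and j: "j \<in> I" "i \<noteq> j"
  shows "(\<integral>y. (G i y - G' i j y)\<^sup>2 \<partial>Q) \<le> c1 * (s2 * (w i j)\<^sup>2)"
proof -
  have iI: "i \<in> I" using i JI by auto
  have "\<bar>G i y - G' i j y\<bar> \<le> 8 * B" for y using G_le[of i y] G'_le[of i j y] by linarith
  then have int: "integrable Q (\<lambda>y. (G i y - G' i j y)\<^sup>2)"
    unfolding power2_eq_square
    by (intro bounded_mult_integrable[of _ _ "8 * B"] borel_measurable_diff G_measurable G'_measurable iI j)
  have "(\<integral>y. (G i y - G' i j y)\<^sup>2 \<partial>Q) = (\<integral>y. (\<integral>t. (G i (y(i := t)) - G' i j (y(i := t)))\<^sup>2 \<partial>\<nu>) \<partial>Q)"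
    by (rule integral_PiM_resample[OF prob_f finite_I iI int, symmetric])
  also have "\<dots> \<le> (\<integral>y. c1 * (w i j)\<^sup>2 * (y j)\<^sup>2 \<partial>Q)"
  proof (rule integral_mono)
    show "integrable Q (\<lambda>y. \<integral>t. (G i (y(i := t)) - G' i j (y(i := t)))\<^sup>2 \<partial>\<nu>)"
      by (rule integrable_PiM_resample[OF prob_f finite_I iI int])
    fix y
    have "\<delta> i (y(i := t, j := 0)) = \<delta> i (y(j := 0))" for t
      using j by (subst fun_upd_twist) (auto simp: \<delta>_upd_self i)
    then have "(\<integral>t. (G i (y(i := t)) - G' i j (y(i := t)))\<^sup>2 \<partial>\<nu>)
        = (\<integral>t. (\<Gamma> t (\<delta> i y) - \<Gamma> t (\<delta> i (y(j := 0))))\<^sup>2 \<partial>\<nu>)"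
      using j by (simp add: G_def G'_def \<delta>_upd_self i)
    also have "\<dots> \<le> c1 * (\<delta> i y - \<delta> i (y(j := 0)))\<^sup>2" by (rule \<Gamma>_square_diff)
    also have "(\<delta> i y - \<delta> i (y(j := 0)))\<^sup>2 = (w i j)\<^sup>2 * (y j)\<^sup>2"
      by (simp add: \<delta>_upd[OF j(1)] power_mult_distrib)
    finally show "(\<integral>t. (G i (y(i := t)) - G' i j (y(i := t)))\<^sup>2 \<partial>\<nu>) \<le> c1 * (w i j)\<^sup>2 * (y j)\<^sup>2"
      by (simp only: mult.assoc)
  qed (intro integrable_mult_right square_integrable_component j)
  also have "\<dots> = c1 * (s2 * (w i j)\<^sup>2)"
    using j by (simp add: integral_square_component)
  finally show ?thesis .
qed

text \<open>Since \<open>G i\<close> has mean zero in its own coordinate, the cross moment only sees how each factor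
  reacts to the other one's error; this replaces a third order expansion of the kernel.\<close>

lemma G_cross_eq:
  assumes i: "i \<in> J" and j: "j \<in> J" and ij: "i \<noteq> j"
  shows "(\<integral>y. G i y * G j y \<partial>Q) = (\<integral>y. (G i y - G' i j y) * (G j y - G' j i y) \<partial>Q)"
proof -
  have I: "i \<in> I" "j \<in> I" using i j JI by auto
  have tw: "\<delta> i (y(i := t, j := 0)) = \<delta> i (y(j := 0))" if "i \<in> J" "i \<noteq> j" for i j t y
    using that by (subst fun_upd_twist) (auto simp: \<delta>_upd_self)
  have int: "integrable Q (\<lambda>y. G i y * G j y)" "integrable Q (\<lambda>y. G i y * G' j i y)"
      "integrable Q (\<lambda>y. G j y * G' i j y)" "integrable Q (\<lambda>y. G' i j y * G' j i y)"
    by (intro bounded_mult_integrable[of _ _ "4 * B"] G_le G'_le G_measurable G'_measurable I)+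
  have z1: "(\<integral>y. G i y * G' j i y \<partial>Q) = 0"
    by (rule integral_PiM_mult_zero[OF prob_f finite_I I(1)])
      (use int ij i in \<open>auto simp: G_def G'_def \<delta>_upd_self \<Gamma>_mean_zero\<close>)
  have z2: "(\<integral>y. G j y * G' i j y \<partial>Q) = 0"
    by (rule integral_PiM_mult_zero[OF prob_f finite_I I(2)])
      (use int ij j in \<open>auto simp: G_def G'_def \<delta>_upd_self \<Gamma>_mean_zero\<close>)
  have z3: "(\<integral>y. G' i j y * G' j i y \<partial>Q) = 0"
    by (rule integral_PiM_mult_zero[OF prob_f finite_I I(1)])
      (use int ij i in \<open>auto simp: G'_def tw \<Gamma>_mean_zero\<close>)
  have "(\<lambda>y. (G i y - G' i j y) * (G j y - G' j i y))
      = (\<lambda>y. G i y * G j y - G i y * G' j i y - G j y * G' i j y + G' i j y * G' j i y)"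
    by (auto simp: algebra_simps)
  then show ?thesis using int z1 z2 z3 by simp
qed

text \<open>Young's inequality separates the two influences, and each is paid with its own squared
  weight. The arithmetic mean makes the bound symmetric, which suits the summation over all
  pairs.\<close>

lemma G_cross_le:
  assumes i: "i \<in> J" and j: "j \<in> J" and ij: "i \<noteq> j"
  shows "(\<integral>y. G i y * G j y \<partial>Q) \<le> c1 * s2 * ((w i j)\<^sup>2 + (w j i)\<^sup>2) / 2"
proof -
  have I: "i \<in> I" "j \<in> I" using i j JI by auto
  define u where "u = (\<lambda>y. G i y - G' i j y)"
  define v where "v = (\<lambda>y. G j y - G' j i y)"
  have b: "\<bar>u y\<bar> \<le> 8 * B" "\<bar>v y\<bar> \<le> 8 * B" for y
    unfolding u_def v_def using G_le[of i y] G'_le[of i j y] G_le[of j y] G'_le[of j i y] by linarith+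
  have uv: "u \<in> borel_measurable Q" "v \<in> borel_measurable Q"
    unfolding u_def v_def by (intro borel_measurable_diff G_measurable G'_measurable I)+
  have int: "integrable Q (\<lambda>y. u y * v y)" "integrable Q (\<lambda>y. (u y)\<^sup>2)" "integrable Q (\<lambda>y. (v y)\<^sup>2)"
    unfolding power2_eq_square by (intro bounded_mult_integrable[of _ _ "8 * B"] b uv)+
  have "(\<integral>y. u y * v y \<partial>Q) \<le> (\<integral>y. ((u y)\<^sup>2 + (v y)\<^sup>2) / 2 \<partial>Q)"
  proof (rule integral_mono)
    show "u y * v y \<le> ((u y)\<^sup>2 + (v y)\<^sup>2) / 2" for y
      using sum_squares_bound[of "u y" "v y"] by simp
  qed (use int in simp_all)
  also have "\<dots> = ((\<integral>y. (u y)\<^sup>2 \<partial>Q) + (\<integral>y. (v y)\<^sup>2 \<partial>Q)) / 2" using int by simp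
  also have "\<dots> \<le> (c1 * (s2 * (w i j)\<^sup>2) + c1 * (s2 * (w j i)\<^sup>2)) / 2"
    unfolding u_def v_def
    by (rule divide_right_mono[OF add_mono[OF G_influence_square_le[OF i I(2) ij] G_influence_square_le[OF j I(1) ij[symmetric]]]])
      simp
  also have "\<dots> = c1 * s2 * ((w i j)\<^sup>2 + (w j i)\<^sup>2) / 2" by (simp only: distrib_left mult.assoc)
  finally show ?thesis
    unfolding G_cross_eq[OF assms] u_def v_def .
qed

text \<open>The off-diagonal terms together cost no more than the sum of all squared weights, so the
  bound has the order of the diagonal: the centred parts add up as if they were uncorrelated.
  Cauchy-Schwarz on the whole sum would lose a factor \<open>N\<close>.\<close>

lemma G_sum_square_le:
  shows "(\<integral>y. (\<Sum>i\<in>J. G i y)\<^sup>2 \<partial>Q) \<le> c1 * (\<Sum>i\<in>J. (\<beta> i)\<^sup>2 + 2 * s2 * (\<Sum>j\<in>I. (w i j)\<^sup>2))"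
proof -
  have int: "integrable Q (\<lambda>y. G i y * G j y)" if "i \<in> J" "j \<in> J" for i j
  proof -
    have "i \<in> I" "j \<in> I" using that JI by auto
    then show ?thesis
      by (intro bounded_mult_integrable[of _ _ "4 * B"] G_le G_measurable)
  qed
  have "(\<integral>y. (\<Sum>i\<in>J. G i y)\<^sup>2 \<partial>Q) = (\<Sum>i\<in>J. \<Sum>j\<in>J. (\<integral>y. G i y * G j y \<partial>Q))"
  proof -
    have "(\<Sum>i\<in>J. G i y)\<^sup>2 = (\<Sum>i\<in>J. \<Sum>j\<in>J. G i y * G j y)" for y
      by (simp add: power2_eq_square sum_product)
    then have "(\<integral>y. (\<Sum>i\<in>J. G i y)\<^sup>2 \<partial>Q) = (\<integral>y. (\<Sum>i\<in>J. \<Sum>j\<in>J. G i y * G j y) \<partial>Q)" by simp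
    also have "\<dots> = (\<Sum>i\<in>J. \<integral>y. (\<Sum>j\<in>J. G i y * G j y) \<partial>Q)"
      by (intro Bochner_Integration.integral_sum Bochner_Integration.integrable_sum int)
    also have "\<dots> = (\<Sum>i\<in>J. \<Sum>j\<in>J. (\<integral>y. G i y * G j y \<partial>Q))"
      by (intro sum.cong refl Bochner_Integration.integral_sum int)
    finally show ?thesis .
  qed
  also have "\<dots> \<le> (\<Sum>i\<in>J. \<Sum>j\<in>J. (if j = i then c1 * ((\<beta> i)\<^sup>2 + s2 * (\<Sum>j\<in>I. (w i j)\<^sup>2)) else 0)
      + c1 * s2 * ((w i j)\<^sup>2 + (w j i)\<^sup>2) / 2)"
  proof (intro sum_mono)
    fix i j assume ij: "i \<in> J" "j \<in> J"
    have nn: "0 \<le> c1 * s2 * ((w i j)\<^sup>2 + (w j i)\<^sup>2) / 2"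
      using c1_nonneg s2_nonneg by (intro divide_nonneg_pos mult_nonneg_nonneg) auto
    show "(\<integral>y. G i y * G j y \<partial>Q) \<le> (if j = i then c1 * ((\<beta> i)\<^sup>2 + s2 * (\<Sum>j\<in>I. (w i j)\<^sup>2)) else 0)
      + c1 * s2 * ((w i j)\<^sup>2 + (w j i)\<^sup>2) / 2"
    proof (cases "j = i")
      case True
      have "(\<integral>y. G i y * G i y \<partial>Q) = (\<integral>y. (G i y)\<^sup>2 \<partial>Q)" by (simp add: power2_eq_square)
      with True show ?thesis using add_mono[OF G_square_le[OF ij(1)] nn] by simp
    next
      case False
      then show ?thesis using G_cross_le[OF ij] by simp
    qed
  qed
  also have "\<dots> = (\<Sum>i\<in>J. c1 * ((\<beta> i)\<^sup>2 + s2 * (\<Sum>j\<in>I. (w i j)\<^sup>2)))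
      + c1 * s2 / 2 * ((\<Sum>i\<in>J. \<Sum>j\<in>J. (w i j)\<^sup>2) + (\<Sum>i\<in>J. \<Sum>j\<in>J. (w j i)\<^sup>2))"
  proof -
    have "(\<Sum>i\<in>J. \<Sum>j\<in>J. c1 * s2 * ((w i j)\<^sup>2 + (w j i)\<^sup>2) / 2)
        = c1 * s2 / 2 * (\<Sum>i\<in>J. \<Sum>j\<in>J. ((w i j)\<^sup>2 + (w j i)\<^sup>2))"
      by (simp only: sum_distrib_left) (intro sum.cong refl, simp)
    then show ?thesis using finite_J by (simp only: sum.distrib) simp
  qed
  \<comment> \<open>Both indices run over \<open>J\<close>, so column sums of squares turn into row
    sums; the rows are then enlarged to \<open>I\<close>.\<close>
  also have "(\<Sum>i\<in>J. \<Sum>j\<in>J. (w j i)\<^sup>2) = (\<Sum>i\<in>J. \<Sum>j\<in>J. (w i j)\<^sup>2)" by (rule sum.swap)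
  also have "c1 * s2 / 2 * ((\<Sum>i\<in>J. \<Sum>j\<in>J. (w i j)\<^sup>2) + (\<Sum>i\<in>J. \<Sum>j\<in>J. (w i j)\<^sup>2))
      \<le> c1 * s2 / 2 * (2 * (\<Sum>i\<in>J. \<Sum>j\<in>I. (w i j)\<^sup>2))"
  proof (rule mult_left_mono)
    have "(\<Sum>i\<in>J. \<Sum>j\<in>J. (w i j)\<^sup>2) \<le> (\<Sum>i\<in>J. \<Sum>j\<in>I. (w i j)\<^sup>2)"
      using JI finite_I by (intro sum_mono sum_mono2) auto
    then show "(\<Sum>i\<in>J. \<Sum>j\<in>J. (w i j)\<^sup>2) + (\<Sum>i\<in>J. \<Sum>j\<in>J. (w i j)\<^sup>2) \<le> 2 * (\<Sum>i\<in>J. \<Sum>j\<in>I. (w i j)\<^sup>2)" by simp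
    show "0 \<le> c1 * s2 / 2" using c1_nonneg s2_nonneg by (intro divide_nonneg_pos mult_nonneg_nonneg) auto
  qed
  also have "(\<Sum>i\<in>J. c1 * ((\<beta> i)\<^sup>2 + s2 * (\<Sum>j\<in>I. (w i j)\<^sup>2))) + c1 * s2 / 2 * (2 * (\<Sum>i\<in>J. \<Sum>j\<in>I. (w i j)\<^sup>2))
      = c1 * (\<Sum>i\<in>J. (\<beta> i)\<^sup>2 + 2 * s2 * (\<Sum>j\<in>I. (w i j)\<^sup>2))"
    by (simp add: sum.distrib sum_distrib_left[symmetric] distrib_left)
  finally show ?thesis by simp
qed

end

section \<open>Mean absolute error of the feasible estimator for a frozen design\<close>

context loo_design begin

text \<open>\<open>fh\<close> and \<open>ft\<close> are the feasible and the infeasible estimator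
  with the trimming indicators absorbed into \<open>J\<close>; \<open>msq\<close> is the value taken
  by the AMSE at this design.\<close>

definition "fh y = (\<Sum>i\<in>J. K ((y i + \<delta> i y - e) / b)) / (b * N)"
definition "ft y = (\<Sum>i\<in>J. K ((y i - e) / b)) / (b * N)"
definition "msq = (\<integral>y. (ft y - f e)\<^sup>2 \<partial>Q)"
definition "\<kappa> = (\<integral>t. K ((t - e) / b) \<partial>\<nu>)"
definition "\<zeta> i y = K ((y i - e) / b) - \<kappa>"

lemma J_I: "i \<in> J \<Longrightarrow> i \<in> I" using JI by auto

lemma K_component_measurable: "i \<in> J \<Longrightarrow> (\<lambda>y. K ((y i - e) / b)) \<in> borel_measurable Q"
  using component_measurable[of i] J_I by (intro measurable_compose[OF _ K_measurable]) auto

lemma ft_measurable: "ft \<in> borel_measurable Q"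
  unfolding ft_def using K_component_measurable
  by (intro borel_measurable_divide borel_measurable_sum borel_measurable_const) auto

lemma \<kappa>_le: "\<bar>\<kappa>\<bar> \<le> B"
proof -
  have "(\<integral>t. \<bar>K ((t - e) / b)\<bar> \<partial>\<nu>) \<le> B"
    using K_integrable_shift[of 0] K_le by (intro integral_le_const) auto
  then show ?thesis unfolding \<kappa>_def by (rule order_trans[OF integral_abs_bound])
qed

lemma \<zeta>_le: "\<bar>\<zeta> i y\<bar> \<le> 2 * B"
  using K_le[of "(y i - e) / b"] \<kappa>_le unfolding \<zeta>_def by linarith

lemma \<zeta>_measurable: "i \<in> J \<Longrightarrow> \<zeta> i \<in> borel_measurable Q"
  unfolding \<zeta>_def by (intro borel_measurable_diff K_component_measurable borel_measurable_const)

lemma \<zeta>_integrable: "i \<in> J \<Longrightarrow> j \<in> J \<Longrightarrow> integrable Q (\<lambda>y. \<zeta> i y * \<zeta> j y)"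
  by (intro bounded_mult_integrable[of _ _ "2 * B"] \<zeta>_measurable \<zeta>_le)

lemma K_square_integrable: "integrable \<nu> (\<lambda>t. (K ((t - e) / b))\<^sup>2)"
  by (intro integrable_const_bound[of _ "B\<^sup>2"] AE_I2)
    (use K_sq_le in \<open>simp_all only: real_norm_def abs_power2\<close>, measurable)

lemma integral_\<zeta>_mult:
  assumes i: "i \<in> J" and j: "j \<in> J"
  shows "(\<integral>y. \<zeta> i y * \<zeta> j y \<partial>Q) = (if j = i then b * V b e - \<kappa>\<^sup>2 else 0)"
proof (cases "j = i")
  case True
  have K: "integrable \<nu> (\<lambda>t. K ((t - e) / b))" using K_integrable_shift[of 0] by simp
  have sq: "(K ((t - e) / b) - \<kappa>)\<^sup>2 = (K ((t - e) / b))\<^sup>2 - 2 * \<kappa> * K ((t - e) / b) + \<kappa>\<^sup>2" for t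
    by (simp add: power2_eq_square algebra_simps)
  have sqi: "integrable \<nu> (\<lambda>t. (K ((t - e) / b) - \<kappa>)\<^sup>2)"
    unfolding sq using K K_square_integrable by simp
  have "(\<integral>y. \<zeta> i y * \<zeta> j y \<partial>Q) = (\<integral>y. (K ((y i - e) / b) - \<kappa>)\<^sup>2 \<partial>Q)"
    by (simp add: True \<zeta>_def power2_eq_square)
  also have "\<dots> = (\<integral>t. (K ((t - e) / b) - \<kappa>)\<^sup>2 \<partial>\<nu>)"
    by (rule integral_PiM_component1[OF prob_f finite_I J_I[OF i] sqi])
  also have "\<dots> = b * V b e - 2 * \<kappa> * \<kappa> + \<kappa>\<^sup>2"
    unfolding sq using K K_square_integrable
    by (simp add: kernel_second_moment[OF b_pos] \<kappa>_def[symmetric] prob_UNIV)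
  finally show ?thesis using True by (simp add: power2_eq_square)
next
  case False
  have K: "integrable \<nu> (\<lambda>t. K ((t - e) / b))" using K_integrable_shift[of 0] by simp
  have "(\<integral>y. \<zeta> i y * \<zeta> j y \<partial>Q) = 0"
  proof (rule integral_PiM_mult_zero[OF prob_f finite_I J_I[OF i] \<zeta>_integrable[OF i j]])
    show "(\<integral>t. \<zeta> i (y(i := t)) \<partial>\<nu>) = 0" for y
      using K by (simp add: \<zeta>_def \<kappa>_def[symmetric] prob_UNIV)
    show "\<zeta> j (y(i := t)) = \<zeta> j y" for y t using False by (simp add: \<zeta>_def)
  qed
  then show ?thesis using False by simp
qed

lemma ft_eq: "ft y - f e = (\<kappa> / b - f e) + (\<Sum>i\<in>J. \<zeta> i y) / (b * N)"
  using N_pos b_pos by (simp add: ft_def \<zeta>_def sum_subtractf diff_divide_distrib)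

lemma integrable_\<zeta>: "i \<in> J \<Longrightarrow> integrable Q (\<zeta> i)"
  by (intro Q.P.integrable_const_bound[of _ "2 * B"] AE_I2) (simp_all add: \<zeta>_le \<zeta>_measurable)

lemma integral_\<zeta>: "i \<in> J \<Longrightarrow> (\<integral>y. \<zeta> i y \<partial>Q) = 0"
  using integral_PiM_mult_zero[OF prob_f finite_I J_I, of i "\<zeta> i" "\<lambda>_. 1"] integrable_\<zeta>[of i] K_integrable_shift[of 0]
  by (simp add: \<zeta>_def[of i "_(i := _)"] \<kappa>_def[symmetric] prob_UNIV)

text \<open>The decomposition into squared bias and variance is kept as an identity, because it is
  read in both directions: as an upper bound in \<open>msq_le\<close> and as a lower bound in
  \<open>V_le_msq\<close>.\<close>

lemma
  shows ft_square_integrable: "integrable Q (\<lambda>y. (ft y - f e)\<^sup>2)"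
    and msq_eq: "msq = (\<kappa> / b - f e)\<^sup>2 + (b * V b e - \<kappa>\<^sup>2) / (b\<^sup>2 * N)"
proof -
  define a where "a = \<kappa> / b - f e"
  define d where "d = 1 / (b * N)"
  have eq: "(ft y - f e)\<^sup>2 = a\<^sup>2 + 2 * a * d * (\<Sum>i\<in>J. \<zeta> i y) + d\<^sup>2 * (\<Sum>i\<in>J. \<Sum>j\<in>J. \<zeta> i y * \<zeta> j y)" for y
    unfolding ft_eq a_def[symmetric] sum_product[symmetric]
    by (simp add: d_def power2_eq_square algebra_simps add_divide_distrib)
  have i1: "integrable Q (\<lambda>y. 2 * a * d * (\<Sum>i\<in>J. \<zeta> i y))"
    by (intro integrable_mult_right Bochner_Integration.integrable_sum integrable_\<zeta>)
  have i2: "integrable Q (\<lambda>y. d\<^sup>2 * (\<Sum>i\<in>J. \<Sum>j\<in>J. \<zeta> i y * \<zeta> j y))"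
    by (intro integrable_mult_right Bochner_Integration.integrable_sum \<zeta>_integrable)
  have i0: "integrable Q (\<lambda>y. a\<^sup>2)" by simp
  show "integrable Q (\<lambda>y. (ft y - f e)\<^sup>2)"
    unfolding eq by (intro Bochner_Integration.integrable_add i0 i1 i2)
  have z1: "(\<integral>y. (\<Sum>i\<in>J. \<zeta> i y) \<partial>Q) = 0"
    by (subst Bochner_Integration.integral_sum) (simp_all add: integrable_\<zeta> integral_\<zeta>)
  have "(\<integral>y. (\<Sum>i\<in>J. \<Sum>j\<in>J. \<zeta> i y * \<zeta> j y) \<partial>Q) = (\<Sum>i\<in>J. \<integral>y. (\<Sum>j\<in>J. \<zeta> i y * \<zeta> j y) \<partial>Q)"
    by (intro Bochner_Integration.integral_sum Bochner_Integration.integrable_sum \<zeta>_integrable)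
  also have "\<dots> = (\<Sum>i\<in>J. \<Sum>j\<in>J. \<integral>y. \<zeta> i y * \<zeta> j y \<partial>Q)"
    by (intro sum.cong refl Bochner_Integration.integral_sum \<zeta>_integrable)
  also have "\<dots> = (\<Sum>i\<in>J. \<Sum>j\<in>J. if j = i then b * V b e - \<kappa>\<^sup>2 else 0)"
    by (intro sum.cong refl integral_\<zeta>_mult)
  also have "\<dots> = N * (b * V b e - \<kappa>\<^sup>2)" using finite_J by simp
  finally have z2: "(\<integral>y. (\<Sum>i\<in>J. \<Sum>j\<in>J. \<zeta> i y * \<zeta> j y) \<partial>Q) = N * (b * V b e - \<kappa>\<^sup>2)" .
  have "msq = (\<integral>y. a\<^sup>2 \<partial>Q) + (\<integral>y. 2 * a * d * (\<Sum>i\<in>J. \<zeta> i y) \<partial>Q)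
      + (\<integral>y. d\<^sup>2 * (\<Sum>i\<in>J. \<Sum>j\<in>J. \<zeta> i y * \<zeta> j y) \<partial>Q)"
    unfolding msq_def eq
    by (simp only: Bochner_Integration.integral_add[OF Bochner_Integration.integrable_add[OF i0 i1] i2]
        Bochner_Integration.integral_add[OF i0 i1])
  also have "\<dots> = a\<^sup>2 + d\<^sup>2 * (N * (b * V b e - \<kappa>\<^sup>2))"
    by (simp only: integral_mult_right_zero z1 z2) (simp add: Q.P.prob_space)
  also have "d\<^sup>2 * (N * (b * V b e - \<kappa>\<^sup>2)) = (b * V b e - \<kappa>\<^sup>2) / (b\<^sup>2 * N)"
    using N_pos b_pos by (simp add: d_def field_simps power2_eq_square)
  finally show "msq = (\<kappa> / b - f e)\<^sup>2 + (b * V b e - \<kappa>\<^sup>2) / (b\<^sup>2 * N)" by (simp add: a_def)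
qed

lemma msq_le: "msq \<le> (2 * \<rho> * (B * (L * (b * \<rho>)\<^sup>2)))\<^sup>2 + 2 * \<rho> * (B\<^sup>2 * A) / (b * N)"
proof -
  have "\<bar>\<kappa> / b - f e\<bar> \<le> 2 * \<rho> * (B * (L * (b * \<rho>)\<^sup>2))"
    using kernel_bias[OF b_pos, of e] by (simp add: \<kappa>_def)
  then have "(\<kappa> / b - f e)\<^sup>2 \<le> (2 * \<rho> * (B * (L * (b * \<rho>)\<^sup>2)))\<^sup>2"
    by (metis abs_ge_zero power2_abs power_mono)
  moreover have "(b * V b e - \<kappa>\<^sup>2) / (b\<^sup>2 * N) \<le> b * (2 * \<rho> * (B\<^sup>2 * A)) / (b\<^sup>2 * N)"
  proof (rule divide_right_mono)
    have "b * V b e \<le> b * (2 * \<rho> * (B\<^sup>2 * A))" using b_pos by (intro mult_left_mono V_le) auto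
    then show "b * V b e - \<kappa>\<^sup>2 \<le> b * (2 * \<rho> * (B\<^sup>2 * A))"
      using zero_le_power2[of \<kappa>] by linarith
  qed (use N_pos b_pos in simp)
  moreover have "b * (2 * \<rho> * (B\<^sup>2 * A)) / (b\<^sup>2 * N) = 2 * \<rho> * (B\<^sup>2 * A) / (b * N)"
    using b_pos by (simp add: power2_eq_square)
  ultimately show ?thesis by (simp only: msq_eq)
qed

text \<open>The mean squared error dominates the variance
  \<open>(b * V b e - \<kappa>\<^sup>2) / (b\<^sup>2 * N)\<close>. For small \<open>b\<close> the
  subtracted square is at most half of \<open>b * V b e\<close>, so the second moment itself is
  controlled, also where \<open>f\<close> is tiny.\<close>

lemma V_le_msq:
  assumes "4 * \<rho> * A * b \<le> 1"
  shows "V b e \<le> 2 * b * N * msq"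
proof -
  have "\<kappa>\<^sup>2 \<le> b\<^sup>2 * (2 * \<rho> * A * V b e)"
    using kernel_mean_square_le[OF b_pos, of e] by (simp only: \<kappa>_def)
  also have "\<dots> = (4 * \<rho> * A * b) * (b * V b e / 2)" by (simp add: power2_eq_square)
  also have "\<dots> \<le> 1 * (b * V b e / 2)"
    using assms b_pos V_nonneg[of b e] by (intro mult_right_mono) auto
  finally have "b * V b e / 2 / (b\<^sup>2 * N) \<le> (b * V b e - \<kappa>\<^sup>2) / (b\<^sup>2 * N)"
    using N_pos b_pos by (intro divide_right_mono) auto
  also have "\<dots> \<le> msq" by (simp add: msq_eq)
  finally show ?thesis using N_pos b_pos by (simp add: field_simps power2_eq_square)
qed

abbreviation "c2 \<equiv> 2 * \<rho> * (B * L)"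

lemma mean_expand: "\<bar>mean s + b * s * slope b e\<bar> \<le> b * (c2 * s\<^sup>2)"
  using kernel_shift_mean[OF b_pos, of s e] by (simp add: mean_def mult_ac)

lemma fh_eq: "fh y - ft y = ((\<Sum>i\<in>J. G i y) + (\<Sum>i\<in>J. mean (\<delta> i y))) / (b * N)"
proof -
  have "K ((y i + \<delta> i y - e) / b) - K ((y i - e) / b) = G i y + mean (\<delta> i y)" for i
    unfolding G_def \<Gamma>_def by simp
  then show ?thesis
    unfolding fh_def ft_def diff_divide_distrib[symmetric] sum_subtractf[symmetric] sum.distrib[symmetric]
    by simp
qed

text \<open>The five contributions are the infeasible estimator, the biases through the slope, the
  averaged noise through the slope, the quadratic remainder of the mean parts, and the centred
  parts. The averaged noise is the delicate one: it is governed by the column sums of the weights,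
  bounded by \<open>c\<close>, so that \<open>l\<close> has second moment of order \<open>N\<close>
  and \<open>l / N\<close> has order \<open>N^(-1/2)\<close>.\<close>

lemma integral_abs_error_le:
  assumes \<beta>0: "\<And>i. i \<in> J \<Longrightarrow> \<bar>\<beta> i\<bar> \<le> \<beta>0" and W: "\<And>i. i \<in> J \<Longrightarrow> (\<Sum>j\<in>I. (w i j)\<^sup>2) \<le> W"
    and c: "\<And>j. j \<in> I \<Longrightarrow> \<bar>\<Sum>i\<in>J. w i j\<bar> \<le> c" and k: "real (card I) \<le> k * N"
    and b_small: "4 * \<rho> * A * b \<le> 1"
  shows "integrable Q (\<lambda>y. \<bar>fh y - f e\<bar>)"
    and "(\<integral>y. \<bar>fh y - f e\<bar> \<partial>Q) \<le> sqrt msq + \<bar>slope b e\<bar> * \<beta>0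
      + sqrt (16 * L * \<rho> * s2 * c\<^sup>2 * k * b * msq) + c2 * (\<beta>0\<^sup>2 + s2 * W)
      + sqrt (c1 * (\<beta>0\<^sup>2 + 2 * s2 * W) / N) / b"
proof -
  define a where "a = slope b e"
  \<comment> \<open>Column sums: \<open>C j\<close> is the total weight with which error
    \<open>j\<close> enters the smoothed values, and \<open>l\<close> is the total noise.\<close>
  define C where "C = (\<lambda>j. \<Sum>i\<in>J. w i j)"
  define l where "l = (\<lambda>y. \<Sum>j\<in>I. C j * y j)"
  have \<beta>sq: "(\<beta> i)\<^sup>2 \<le> \<beta>0\<^sup>2" if "i \<in> J" for i
    using power_mono[OF \<beta>0[OF that] abs_ge_zero, of 2] by (simp only: power2_abs)
  have sum_\<delta>: "(\<Sum>i\<in>J. \<delta> i y) = - (\<Sum>i\<in>J. \<beta> i) - l y" for y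
  proof -
    have "(\<Sum>i\<in>J. \<delta> i y) = (\<Sum>i\<in>J. - \<beta> i) - (\<Sum>i\<in>J. \<Sum>j\<in>I. w i j * y j)"
      unfolding \<delta>_def by (rule sum_subtractf)
    also have "(\<Sum>i\<in>J. \<Sum>j\<in>I. w i j * y j) = (\<Sum>j\<in>I. \<Sum>i\<in>J. w i j * y j)" by (rule sum.swap)
    also have "\<dots> = l y" unfolding l_def C_def sum_distrib_right ..
    finally show ?thesis by (simp only: sum_negf)
  qed
  have mean_sum: "\<bar>\<Sum>i\<in>J. mean (\<delta> i y)\<bar> / (b * N)
      \<le> \<bar>a\<bar> * \<beta>0 + \<bar>a\<bar> / N * \<bar>l y\<bar> + c2 / N * (\<Sum>i\<in>J. (\<delta> i y)\<^sup>2)" for y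
  proof -
    \<comment> \<open>The linear term is summed over \<open>i\<close> before absolute values are
      taken, so that the noise can average out; only the quadratic remainder is bounded term by
      term.\<close>
    have "(\<Sum>i\<in>J. mean (\<delta> i y) + b * \<delta> i y * a)
        = (\<Sum>i\<in>J. mean (\<delta> i y)) + (\<Sum>i\<in>J. b * a * \<delta> i y)"
      unfolding sum.distrib by (intro arg_cong2[where f = "(+)"] sum.cong refl) (simp only: mult_ac)
    then have "(\<Sum>i\<in>J. mean (\<delta> i y))
        = (\<Sum>i\<in>J. mean (\<delta> i y) + b * \<delta> i y * a) - b * a * (\<Sum>i\<in>J. \<delta> i y)"
      unfolding sum_distrib_left by linarith
    moreover have "\<bar>\<Sum>i\<in>J. mean (\<delta> i y) + b * \<delta> i y * a\<bar> \<le> (\<Sum>i\<in>J. b * (c2 * (\<delta> i y)\<^sup>2))"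
      unfolding a_def by (rule order_trans[OF sum_abs]) (intro sum_mono mean_expand)
    ultimately have "\<bar>\<Sum>i\<in>J. mean (\<delta> i y)\<bar>
        \<le> (\<Sum>i\<in>J. b * (c2 * (\<delta> i y)\<^sup>2)) + \<bar>b * a * (\<Sum>i\<in>J. \<delta> i y)\<bar>"
      by linarith
    also have "\<bar>b * a * (\<Sum>i\<in>J. \<delta> i y)\<bar> \<le> b * \<bar>a\<bar> * (N * \<beta>0 + \<bar>l y\<bar>)"
    proof -
      have "\<bar>\<Sum>i\<in>J. \<beta> i\<bar> \<le> N * \<beta>0"
        using sum_bounded_above[of J "\<lambda>i. \<bar>\<beta> i\<bar>" \<beta>0] \<beta>0 by (intro order_trans[OF sum_abs]) auto
      then have "\<bar>\<Sum>i\<in>J. \<delta> i y\<bar> \<le> N * \<beta>0 + \<bar>l y\<bar>" unfolding sum_\<delta> by linarith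
      then have "b * \<bar>a\<bar> * \<bar>\<Sum>i\<in>J. \<delta> i y\<bar> \<le> b * \<bar>a\<bar> * (N * \<beta>0 + \<bar>l y\<bar>)"
        using b_pos by (intro mult_left_mono) auto
      then show ?thesis using b_pos by (simp only: abs_mult abs_of_pos)
    qed
    finally have "\<bar>\<Sum>i\<in>J. mean (\<delta> i y)\<bar> / (b * N)
        \<le> (b * (c2 * (\<Sum>i\<in>J. (\<delta> i y)\<^sup>2)) + b * \<bar>a\<bar> * (N * \<beta>0 + \<bar>l y\<bar>)) / (b * N)"
      unfolding sum_distrib_left[symmetric] using b_pos N_pos by (intro divide_right_mono) simp_all
    also have "\<dots> = \<bar>a\<bar> * \<beta>0 + \<bar>a\<bar> / N * \<bar>l y\<bar> + c2 / N * (\<Sum>i\<in>J. (\<delta> i y)\<^sup>2)"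
    proof -
      have "(b * p + b * q * (N * \<beta>0 + r)) / (b * N) = q * \<beta>0 + q / N * r + p / N" for p q r
        using b_pos N_pos by (simp add: field_simps)
      then show ?thesis by simp
    qed
    finally show ?thesis .
  qed
  \<comment> \<open>A pointwise majorant of the error whose expectation splits into the five
    contributions. It also yields integrability of the error itself.\<close>
  define D where "D = (\<lambda>y. \<bar>ft y - f e\<bar> + 1 / (b * N) * \<bar>\<Sum>i\<in>J. G i y\<bar>
      + (\<bar>a\<bar> * \<beta>0 + \<bar>a\<bar> / N * \<bar>l y\<bar> + c2 / N * (\<Sum>i\<in>J. (\<delta> i y)\<^sup>2)))"
  have le: "\<bar>fh y - f e\<bar> \<le> D y" for y
  proof -
    have "\<bar>fh y - f e\<bar> \<le> \<bar>ft y - f e\<bar> + \<bar>fh y - ft y\<bar>" by simp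
    also have "\<bar>fh y - ft y\<bar> \<le> \<bar>\<Sum>i\<in>J. G i y\<bar> / (b * N) + \<bar>\<Sum>i\<in>J. mean (\<delta> i y)\<bar> / (b * N)"
      unfolding fh_eq using b_pos N_pos
      by (simp add: add_divide_distrib[symmetric] divide_right_mono abs_triangle_ineq)
    finally show ?thesis using mean_sum[of y] by (simp add: D_def)
  qed
  have ft_m: "(\<lambda>y. ft y - f e) \<in> borel_measurable Q"
    by (intro borel_measurable_diff ft_measurable borel_measurable_const)
  have G_m: "(\<lambda>y. \<Sum>i\<in>J. G i y) \<in> borel_measurable Q"
    by (intro borel_measurable_sum G_measurable J_I)
  have G_i: "integrable Q (\<lambda>y. (\<Sum>i\<in>J. G i y)\<^sup>2)"
  proof -
    have "(\<Sum>i\<in>J. G i y)\<^sup>2 = (\<Sum>i\<in>J. \<Sum>j\<in>J. G i y * G j y)" for y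
      by (simp add: power2_eq_square sum_product)
    moreover have "integrable Q (\<lambda>y. \<Sum>i\<in>J. \<Sum>j\<in>J. G i y * G j y)"
      by (intro Bochner_Integration.integrable_sum bounded_mult_integrable[of _ _ "4 * B"] G_le G_measurable J_I)
    ultimately show ?thesis by simp
  qed
  have l_i: "integrable Q l" "integrable Q (\<lambda>y. (l y)\<^sup>2)"
    unfolding l_def by (rule integrable_linear, rule integrable_linear_square)
  note int = integrable_abs[OF Q.P.square_integrable_imp_integrable[OF ft_m ft_square_integrable]]
    integrable_abs[OF Q.P.square_integrable_imp_integrable[OF G_m G_i]] integrable_abs[OF l_i(1)]
  have int\<delta>: "integrable Q (\<lambda>y. \<Sum>i\<in>J. (\<delta> i y)\<^sup>2)"
    by (intro Bochner_Integration.integrable_sum integrable_\<delta>_square)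
  have D_i: "integrable Q D"
    unfolding D_def by (intro Bochner_Integration.integrable_add integrable_mult_right int int\<delta>) simp
  have fh_m: "fh \<in> borel_measurable Q"
    unfolding fh_def
    by (intro borel_measurable_divide borel_measurable_sum borel_measurable_const
        measurable_compose[OF _ K_measurable] borel_measurable_diff borel_measurable_add
        component_measurable \<delta>_measurable J_I)
  show fh_i: "integrable Q (\<lambda>y. \<bar>fh y - f e\<bar>)"
    by (rule Bochner_Integration.integrable_bound[OF D_i])
      (use fh_m order_trans[OF le abs_ge_self] in auto)
  have s2': "0 \<le> 2 * s2" using s2_nonneg by linarith
  have b1: "(\<integral>y. \<bar>ft y - f e\<bar> \<partial>Q) \<le> sqrt msq"
    unfolding msq_def by (rule Q.P.integral_abs_le_sqrt[OF ft_m ft_square_integrable])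
  have b2: "1 / (b * N) * (\<integral>y. \<bar>\<Sum>i\<in>J. G i y\<bar> \<partial>Q) \<le> sqrt (c1 * (\<beta>0\<^sup>2 + 2 * s2 * W) / N) / b"
  proof -
    have "(\<integral>y. \<bar>\<Sum>i\<in>J. G i y\<bar> \<partial>Q) \<le> sqrt (\<integral>y. (\<Sum>i\<in>J. G i y)\<^sup>2 \<partial>Q)"
      by (rule Q.P.integral_abs_le_sqrt[OF G_m G_i])
    also have "\<dots> \<le> sqrt (c1 * (\<Sum>i\<in>J. (\<beta> i)\<^sup>2 + 2 * s2 * (\<Sum>j\<in>I. (w i j)\<^sup>2)))"
      by (intro real_sqrt_le_mono G_sum_square_le)
    also have "\<dots> \<le> sqrt (c1 * (\<Sum>i\<in>J. \<beta>0\<^sup>2 + 2 * s2 * W))"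
      by (intro real_sqrt_le_mono mult_left_mono sum_mono add_mono \<beta>sq W c1_nonneg s2') assumption+
    also have "c1 * (\<Sum>i\<in>J. \<beta>0\<^sup>2 + 2 * s2 * W) = N\<^sup>2 * (c1 * (\<beta>0\<^sup>2 + 2 * s2 * W) / N)"
    proof -
      have "c1 * (N * r) = N\<^sup>2 * (c1 * r / N)" for r using N_pos by (simp add: power2_eq_square)
      then show ?thesis by (simp only: sum_constant)
    qed
    also have "sqrt \<dots> = N * sqrt (c1 * (\<beta>0\<^sup>2 + 2 * s2 * W) / N)"
      using N_pos by (simp only: real_sqrt_mult real_sqrt_abs abs_of_nat)
    finally have "(\<integral>y. \<bar>\<Sum>i\<in>J. G i y\<bar> \<partial>Q) \<le> N * sqrt (c1 * (\<beta>0\<^sup>2 + 2 * s2 * W) / N)" .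
    then have "1 / (b * N) * (\<integral>y. \<bar>\<Sum>i\<in>J. G i y\<bar> \<partial>Q) \<le> 1 / (b * N) * (N * sqrt (c1 * (\<beta>0\<^sup>2 + 2 * s2 * W) / N))"
      using N_pos b_pos by (intro mult_left_mono) auto
    then show ?thesis using N_pos by simp
  qed
  \<comment> \<open>The squared slope is at most a multiple of \<open>b * N * msq\<close>, and the
    second moment of \<open>l\<close> at most a multiple of \<open>N\<close>. Both factors
    \<open>N\<close> cancel against \<open>1 / N\<^sup>2\<close>, leaving
    \<open>b * msq\<close>.\<close>
  have b3: "\<bar>a\<bar> / N * (\<integral>y. \<bar>l y\<bar> \<partial>Q) \<le> sqrt (16 * L * \<rho> * s2 * c\<^sup>2 * k * b * msq)"
  proof -
    have "(\<integral>y. (l y)\<^sup>2 \<partial>Q) = s2 * (\<Sum>j\<in>I. (C j)\<^sup>2)" unfolding l_def by (rule integral_linear_square)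
    also have "\<dots> \<le> s2 * (\<Sum>j\<in>I. c\<^sup>2)"
    proof (intro mult_left_mono sum_mono s2_nonneg)
      fix j assume "j \<in> I"
      then show "(C j)\<^sup>2 \<le> c\<^sup>2" using power_mono[OF c abs_ge_zero, of j 2] by (simp only: C_def power2_abs)
    qed
    also have "\<dots> \<le> s2 * (c\<^sup>2 * (k * N))"
    proof (rule mult_left_mono[OF _ s2_nonneg])
      have "(\<Sum>j\<in>I. c\<^sup>2) = c\<^sup>2 * real (card I)" by simp
      also have "\<dots> \<le> c\<^sup>2 * (k * N)" by (rule mult_left_mono[OF k zero_le_power2])
      finally show "(\<Sum>j\<in>I. c\<^sup>2) \<le> c\<^sup>2 * (k * N)" .
    qed
    finally have 1: "(\<integral>y. (l y)\<^sup>2 \<partial>Q) \<le> s2 * (c\<^sup>2 * (k * N))" .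
    have "a\<^sup>2 \<le> 8 * L * \<rho> * V b e" unfolding a_def by (rule slope_square_le)
    also have "\<dots> \<le> 8 * L * \<rho> * (2 * b * N * msq)"
      using L_pos \<rho>_pos by (intro mult_left_mono V_le_msq b_small) auto
    finally have 2: "a\<^sup>2 \<le> 8 * L * \<rho> * (2 * b * N * msq)" .
    have "(\<bar>a\<bar> / N * (\<integral>y. \<bar>l y\<bar> \<partial>Q))\<^sup>2 = a\<^sup>2 * (\<integral>y. \<bar>l y\<bar> \<partial>Q)\<^sup>2 / N\<^sup>2"
      by (simp add: power_mult_distrib power_divide)
    also have "\<dots> \<le> 8 * L * \<rho> * (2 * b * N * msq) * (s2 * (c\<^sup>2 * (k * N))) / N\<^sup>2"
    proof (intro divide_right_mono mult_mono 2)
      have "(\<integral>y. \<bar>l y\<bar> \<partial>Q)\<^sup>2 \<le> (\<integral>y. \<bar>l y\<bar>\<^sup>2 \<partial>Q)"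
        by (rule Q.P.square_integral_le) (simp_all only: power2_abs l_i integrable_abs)
      then show "(\<integral>y. \<bar>l y\<bar> \<partial>Q)\<^sup>2 \<le> s2 * (c\<^sup>2 * (k * N))"
        using 1 unfolding power2_abs by linarith
    qed (use order_trans[OF zero_le_power2 2] in simp_all)
    also have "\<dots> = 16 * L * \<rho> * s2 * c\<^sup>2 * k * b * msq"
      using N_pos by (simp add: power2_eq_square)
    finally show ?thesis by (rule real_le_rsqrt)
  qed
  have b4: "c2 / N * (\<integral>y. (\<Sum>i\<in>J. (\<delta> i y)\<^sup>2) \<partial>Q) \<le> c2 * (\<beta>0\<^sup>2 + s2 * W)"
  proof -
    have "(\<integral>y. (\<Sum>i\<in>J. (\<delta> i y)\<^sup>2) \<partial>Q) = (\<Sum>i\<in>J. (\<beta> i)\<^sup>2 + s2 * (\<Sum>j\<in>I. (w i j)\<^sup>2))"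
      unfolding Bochner_Integration.integral_sum[OF integrable_\<delta>_square]
      by (intro sum.cong refl integral_\<delta>_square)
    also have "\<dots> \<le> (\<Sum>i\<in>J. \<beta>0\<^sup>2 + s2 * W)"
      by (intro sum_mono add_mono mult_left_mono \<beta>sq W s2_nonneg) assumption+
    also have "\<dots> = N * (\<beta>0\<^sup>2 + s2 * W)" by (simp only: sum_constant)
    finally have "c2 / N * (\<integral>y. (\<Sum>i\<in>J. (\<delta> i y)\<^sup>2) \<partial>Q) \<le> c2 / N * (N * (\<beta>0\<^sup>2 + s2 * W))"
    proof (rule mult_left_mono)
      show "0 \<le> c2 / N" using \<rho>_pos L_pos B_nonneg by (intro divide_nonneg_nonneg mult_nonneg_nonneg) simp_all
    qed
    also have "\<dots> = c2 * (\<beta>0\<^sup>2 + s2 * W)" using N_pos by simp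
    finally show ?thesis .
  qed
  have "(\<integral>y. \<bar>fh y - f e\<bar> \<partial>Q) \<le> (\<integral>y. D y \<partial>Q)"
    by (intro integral_mono fh_i D_i le)
  also have "\<dots> = (\<integral>y. \<bar>ft y - f e\<bar> \<partial>Q) + 1 / (b * N) * (\<integral>y. \<bar>\<Sum>i\<in>J. G i y\<bar> \<partial>Q)
      + (\<bar>a\<bar> * \<beta>0 + \<bar>a\<bar> / N * (\<integral>y. \<bar>l y\<bar> \<partial>Q) + c2 / N * (\<integral>y. (\<Sum>i\<in>J. (\<delta> i y)\<^sup>2) \<partial>Q))"
    unfolding D_def
    by (simp only: Bochner_Integration.integral_add Bochner_Integration.integrable_add integrable_mult_right
        integral_mult_right_zero int int\<delta> Q.P.integrable_const lebesgue_integral_const Q.P.prob_space scaleR_one)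
  finally show "(\<integral>y. \<bar>fh y - f e\<bar> \<partial>Q) \<le> sqrt msq + \<bar>slope b e\<bar> * \<beta>0
      + sqrt (16 * L * \<rho> * s2 * c\<^sup>2 * k * b * msq) + c2 * (\<beta>0\<^sup>2 + s2 * W)
      + sqrt (c1 * (\<beta>0\<^sup>2 + 2 * s2 * W) / N) / b"
    using b1 b2 b3 b4 unfolding a_def by linarith
qed

end

section \<open>Second order expansions in several variables\<close>

text \<open>The increment is added one coordinate at a time. Every intermediate point has each
  coordinate increment between zero and that of \<open>h\<close>, so it stays within
  \<open>norm h\<close> of \<open>x\<close>, and each leg is a mean value estimate in one variable.
  Only directional derivatives are required along the way.\<close>

lemma coordinate_walk:
  fixes u :: "real^'d \<Rightarrow> real"
  assumes D: "\<And>i y. y \<in> cball x (norm h) \<Longrightarrow>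
      ((\<lambda>t. u (y + t *\<^sub>R axis i 1)) has_real_derivative D i y) (at 0)"
    and M: "\<And>i y. y \<in> cball x (norm h) \<Longrightarrow> \<bar>D i y - c i\<bar> \<le> M"
  shows "\<bar>u (x + h) - u x - (\<Sum>i\<in>UNIV. c i * h $ i)\<bar> \<le> M * (\<Sum>i\<in>UNIV. \<bar>h $ i\<bar>)"
proof -
  define p where "p = (\<lambda>J. \<chi> i. if i \<in> J then h $ i else 0)"
  have "finite J \<Longrightarrow> \<bar>u (x + p J) - u x - (\<Sum>i\<in>J. c i * h $ i)\<bar> \<le> M * (\<Sum>i\<in>J. \<bar>h $ i\<bar>)" for J
  proof (induction J rule: finite_induct)
    case empty
    have "p {} = 0" by (simp add: p_def vec_eq_iff)
    then show ?case by simp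
  next
    case (insert k J)
    define y where "y = x + p J"
    define q where "q = (\<lambda>t. u (y + t *\<^sub>R axis k 1) - c k * t)"
    have p: "p (insert k J) = p J + h $ k *\<^sub>R axis k 1"
      using insert.hyps by (simp add: p_def vec_eq_iff axis_def)
    have mem: "y + t *\<^sub>R axis k 1 \<in> cball x (norm h)" if "t \<in> closed_segment 0 (h $ k)" for t
    proof -
      have t: "\<bar>t\<bar> \<le> \<bar>h $ k\<bar>"
        using that by (auto simp: closed_segment_eq_real_ivl split: if_splits)
      have "norm (p J + t *\<^sub>R axis k 1) \<le> norm h"
        using insert.hyps t by (intro norm_le_componentwise_cart) (auto simp: p_def axis_def)
      moreover have "dist x (y + t *\<^sub>R axis k 1) = norm (p J + t *\<^sub>R axis k 1)"
        unfolding dist_commute[of x] by (simp add: y_def dist_norm)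
      ultimately show ?thesis by simp
    qed
    have "norm (q (h $ k) - q 0) \<le> M * norm (h $ k - 0)"
    proof (rule field_differentiable_bound[OF convex_closed_segment])
      fix t assume t: "t \<in> closed_segment 0 (h $ k)"
      have "((\<lambda>s. u (y + t *\<^sub>R axis k 1 + s *\<^sub>R axis k 1)) has_real_derivative D k (y + t *\<^sub>R axis k 1)) (at 0)"
        by (rule D[OF mem[OF t]])
      then have "((\<lambda>s. u (y + (s + t) *\<^sub>R axis k 1)) has_real_derivative D k (y + t *\<^sub>R axis k 1)) (at 0)"
        by (simp add: scaleR_left_distrib add_ac)
      then have "((\<lambda>s. u (y + s *\<^sub>R axis k 1)) has_real_derivative D k (y + t *\<^sub>R axis k 1)) (at t)"
        using DERIV_shift[of "\<lambda>s. u (y + s *\<^sub>R axis k 1)" _ 0 t] by simp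
      then have "(q has_real_derivative D k (y + t *\<^sub>R axis k 1) - c k * 1) (at t)"
        unfolding q_def by (intro DERIV_diff DERIV_cmult DERIV_ident)
      then show "(q has_real_derivative D k (y + t *\<^sub>R axis k 1) - c k) (at t within closed_segment 0 (h $ k))"
        by (simp add: has_field_derivative_at_within)
      show "norm (D k (y + t *\<^sub>R axis k 1) - c k) \<le> M" using M[OF mem[OF t]] by simp
    qed auto
    then have step: "\<bar>u (x + p (insert k J)) - u (x + p J) - c k * h $ k\<bar> \<le> M * \<bar>h $ k\<bar>"
      by (simp add: q_def y_def p add.assoc algebra_simps)
    have "u (x + p (insert k J)) - u x - (\<Sum>i\<in>insert k J. c i * h $ i)
        = (u (x + p (insert k J)) - u (x + p J) - c k * h $ k) + (u (x + p J) - u x - (\<Sum>i\<in>J. c i * h $ i))"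
      using insert.hyps by simp
    also have "\<bar>\<dots>\<bar> \<le> M * \<bar>h $ k\<bar> + M * (\<Sum>i\<in>J. \<bar>h $ i\<bar>)"
      by (rule order_trans[OF abs_triangle_ineq add_mono[OF step insert.IH]])
    finally show ?case using insert.hyps by (simp add: distrib_left)
  qed
  from this[of UNIV] show ?thesis by (simp add: p_def vec_lambda_eta)
qed

lemma sum_abs_component_le: "(\<Sum>i\<in>UNIV. \<bar>h $ i\<bar>) \<le> real CARD('d) * norm (h :: real^'d)"
  using sum_bounded_above[of UNIV "\<lambda>i. \<bar>h $ i\<bar>" "norm h"] by (simp add: component_le_norm_cart)

text \<open>Partial derivatives alone give neither continuity nor boundedness. A Lipschitz estimate
  around the points of \<open>T\<close> does, and this lemma carries such bounds from the second
  partials down to the first ones and to the function.\<close>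

lemma bounded_on_compact_of_local_lipschitz:
  fixes v :: "'a::metric_space \<Rightarrow> real"
  assumes T: "compact T" and R: "R > 0" and C: "C \<ge> 0"
    and lip: "\<And>x y. x \<in> T \<Longrightarrow> y \<in> cball x R \<Longrightarrow> \<bar>v y - v x\<bar> \<le> C * dist x y"
  shows "continuous_on T v" and "\<exists>B. \<forall>x\<in>T. \<bar>v x\<bar> \<le> B"
proof -
  show cont: "continuous_on T v"
    unfolding continuous_on_iff
  proof (intro ballI allI impI)
    fix x :: "'a" and e :: real assume x: "x \<in> T" and e: "e > 0"
    have "dist (v y) (v x) < e" if "y \<in> T" "dist y x < min R (e / (C + 1))" for y
    proof -
      have "\<bar>v y - v x\<bar> \<le> C * dist x y" using that x by (intro lip) (auto simp: dist_commute)
      also have "\<dots> \<le> (C + 1) * dist x y" by (intro mult_right_mono) auto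
      also have "\<dots> < e" using that C by (simp add: dist_commute pos_less_divide_eq mult.commute)
      finally show ?thesis by (simp add: dist_real_def)
    qed
    then show "\<exists>d>0. \<forall>y\<in>T. dist y x < d \<longrightarrow> dist (v y) (v x) < e"
      using R e C by (intro exI[of _ "min R (e / (C + 1))"]) auto
  qed
  have "bounded (v ` T)" by (intro compact_imp_bounded compact_continuous_image cont T)
  then show "\<exists>B. \<forall>x\<in>T. \<bar>v x\<bar> \<le> B" by (auto simp: bounded_iff)
qed

text \<open>Bounds descend from the second derivatives: these are bounded on a compact neighbourhood
  of \<open>T\<close>, hence the first ones are Lipschitz around \<open>T\<close> and bounded on it,
  hence \<open>u\<close> has a second order expansion. \<open>G\<close> is the gradient.\<close>

lemma continuous_second_partials_taylor:
  fixes u :: "real^'d \<Rightarrow> real"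
  assumes C2: "continuous_second_partials_on S u" and T: "compact T" "T \<subseteq> interior S"
  obtains r C and G :: "real^'d \<Rightarrow> real^'d" where "0 < r" "0 \<le> C"
    "\<And>x h. x \<in> T \<Longrightarrow> norm h \<le> r \<Longrightarrow> \<bar>u (x + h) - u x\<bar> \<le> C * norm h"
    "\<And>x h. x \<in> T \<Longrightarrow> norm h \<le> r \<Longrightarrow> \<bar>u (x + h) - u x - G x \<bullet> h\<bar> \<le> C * (norm h)\<^sup>2"
    "\<And>x. x \<in> T \<Longrightarrow> norm (G x) \<le> C"
    "\<And>x h. x \<in> T \<Longrightarrow> norm h \<le> r \<Longrightarrow> \<bar>u (x + h)\<bar> \<le> C"
    "continuous_on T u"
proof -
  obtain D1 D2 where
    D1: "\<And>i x. x \<in> S \<Longrightarrow> ((\<lambda>t. u (x + t *\<^sub>R axis i 1)) has_real_derivative D1 i x)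
        (at 0 within {t. x + t *\<^sub>R axis i 1 \<in> S})" and
    D2: "\<And>i j x. x \<in> S \<Longrightarrow> ((\<lambda>t. D1 i (x + t *\<^sub>R axis j 1)) has_real_derivative D2 i j x)
        (at 0 within {t. x + t *\<^sub>R axis j 1 \<in> S})" and
    D2c: "\<And>i j. continuous_on S (D2 i j)"
    using C2 unfolding continuous_second_partials_on_def by blast
  \<comment> \<open>At interior points small increments in any direction stay in \<open>S\<close>,
    so the relative derivatives become ordinary ones.\<close>
  have at: "(at (0 :: real) within {t. x + t *\<^sub>R axis i 1 \<in> S}) = at 0" if "x \<in> interior S" for x i
  proof (rule at_within_interior)
    have "open ((\<lambda>t :: real. x + t *\<^sub>R axis i 1) -` interior S)"
      by (intro open_vimage open_interior continuous_intros)
    moreover have "(0 :: real) \<in> (\<lambda>t. x + t *\<^sub>R axis i 1) -` interior S" using that by simp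
    moreover have "(\<lambda>t. x + t *\<^sub>R axis i 1) -` interior S \<subseteq> {t. x + t *\<^sub>R axis i 1 \<in> S}"
      using interior_subset by auto
    ultimately show "0 \<in> interior {t. x + t *\<^sub>R axis i 1 \<in> S}" by (rule interiorI)
  qed
  obtain R where R: "R > 0" "(\<Union>x\<in>T. cball x R) \<subseteq> interior S"
    using compact_subset_open_imp_cball_epsilon_subset[OF T(1) open_interior T(2)] by blast
  \<comment> \<open>The closed \<open>R\<close>-neighbourhood of \<open>T\<close>, written as a sum
    of two compact sets because compactness is then immediate.\<close>
  define T' where "T' = (\<Union>x\<in>T. \<Union>y\<in>cball 0 R. {x + y})"
  have T'c: "compact T'" unfolding T'_def by (intro compact_sums' T compact_cball)
  have T'mem: "y \<in> T'" if "x \<in> T" "y \<in> cball x R" for x y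
    using that unfolding T'_def by (intro UN_I[of x] UN_I[of "y - x"]) (auto simp: dist_norm norm_minus_commute)
  have T'sub: "T' \<subseteq> interior S"
  proof
    fix z assume "z \<in> T'"
    then obtain x y where "x \<in> T" "norm y \<le> R" "z = x + y" by (auto simp: T'_def)
    then have "z \<in> cball x R" "x \<in> T" by (auto simp: dist_norm)
    then show "z \<in> interior S" using R(2) by blast
  qed
  have "\<exists>B. \<forall>x\<in>T'. \<bar>D2 i j x\<bar> \<le> B" for i j
  proof -
    have "continuous_on T' (D2 i j)"
      using D2c T'sub interior_subset by (meson continuous_on_subset order_trans)
    then have "bounded (D2 i j ` T')" by (intro compact_imp_bounded compact_continuous_image T'c)
    then show ?thesis by (auto simp: bounded_iff)
  qed
  then obtain B where B: "\<And>i j x. x \<in> T' \<Longrightarrow> \<bar>D2 i j x\<bar> \<le> B i j" by metis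
  define B2 where "B2 = (\<Sum>i\<in>UNIV. \<Sum>j\<in>UNIV. \<bar>B i j\<bar>)"
  have B2: "\<bar>D2 i j x\<bar> \<le> B2" if "x \<in> T'" for i j x
  proof -
    have "\<bar>D2 i j x\<bar> \<le> \<bar>B i j\<bar>" using B[OF that, of i j] by linarith
    also have "\<dots> \<le> (\<Sum>j\<in>UNIV. \<bar>B i j\<bar>)" by (rule member_le_sum) auto
    also have "\<dots> \<le> B2" unfolding B2_def by (rule member_le_sum[where f = "\<lambda>i. \<Sum>j\<in>UNIV. \<bar>B i j\<bar>"]) (auto intro: sum_nonneg)
    finally show ?thesis .
  qed
  have B2_0: "0 \<le> B2" unfolding B2_def by (intro sum_nonneg) auto
  define d where "d = real CARD('d)"
  have d0: "0 \<le> d" by (simp add: d_def)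
  have inT': "y \<in> T'" if "x \<in> T" "norm h \<le> R" "y \<in> cball x (norm h)" for x y h
    using that by (intro T'mem[of x]) auto
  have Tint: "y \<in> interior S" "y \<in> S" if "y \<in> T'" for y using that T'sub interior_subset by blast+
  have L1: "\<bar>D1 i (x + h) - D1 i x\<bar> \<le> B2 * d * norm h" if x: "x \<in> T" and h: "norm h \<le> R" for i x h
  proof -
    have "\<bar>D1 i (x + h) - D1 i x - (\<Sum>j\<in>UNIV. 0 * h $ j)\<bar> \<le> B2 * (\<Sum>j\<in>UNIV. \<bar>h $ j\<bar>)"
    proof (rule coordinate_walk)
      fix j y assume "y \<in> cball x (norm h)"
      then have y: "y \<in> T'" by (rule inT'[OF x h])
      show "((\<lambda>t. D1 i (y + t *\<^sub>R axis j 1)) has_real_derivative D2 i j y) (at 0)"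
        using D2[OF Tint(2)[OF y]] by (simp only: at[OF Tint(1)[OF y]])
      show "\<bar>D2 i j y - 0\<bar> \<le> B2" using B2[OF y] by simp
    qed
    also have "\<dots> \<le> B2 * (d * norm h)"
      unfolding d_def by (intro mult_left_mono sum_abs_component_le B2_0)
    finally show ?thesis by (simp add: mult.assoc)
  qed
  have D1bd: "\<exists>B. \<forall>x\<in>T. \<bar>D1 i x\<bar> \<le> B" for i
  proof (rule bounded_on_compact_of_local_lipschitz(2)[OF T(1) R(1), of "B2 * d"])
    show "\<bar>D1 i y - D1 i x\<bar> \<le> B2 * d * dist x y" if "x \<in> T" "y \<in> cball x R" for x y
      using L1[OF that(1), of "y - x" i] that(2) by (simp add: dist_norm norm_minus_commute)
  qed (use B2_0 d0 in auto)
  then obtain B1' where B1': "\<And>i x. x \<in> T \<Longrightarrow> \<bar>D1 i x\<bar> \<le> B1' i" by metis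
  define B1 where "B1 = (\<Sum>i\<in>UNIV. \<bar>B1' i\<bar>)"
  have B1_0: "0 \<le> B1" unfolding B1_def by (intro sum_nonneg) auto
  define G :: "real^'d \<Rightarrow> real^'d" where "G = (\<lambda>x. \<chi> i. D1 i x)"
  have Gb: "norm (G x) \<le> B1" if x: "x \<in> T" for x
  proof -
    have "norm (G x) \<le> (\<Sum>i\<in>UNIV. \<bar>G x $ i\<bar>)" by (rule norm_le_l1_cart)
    also have "\<dots> \<le> B1" unfolding B1_def G_def by (intro sum_mono) (simp add: order_trans[OF B1'[OF x] abs_ge_self])
    finally show ?thesis .
  qed
  have Gh: "G x \<bullet> h = (\<Sum>i\<in>UNIV. D1 i x * h $ i)" for x h by (simp add: G_def inner_vec_def)
  \<comment> \<open>The walk is used a second time, now with \<open>c i = D1 i x\<close>. By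
    \<open>L1\<close> the partials deviate from these values by order \<open>norm h\<close> only,
    which produces the square.\<close>
  have L2: "\<bar>u (x + h) - u x - G x \<bullet> h\<bar> \<le> B2 * d * d * (norm h)\<^sup>2" if x: "x \<in> T" and h: "norm h \<le> R" for x h
  proof -
    have "\<bar>u (x + h) - u x - (\<Sum>i\<in>UNIV. D1 i x * h $ i)\<bar> \<le> (B2 * d * norm h) * (\<Sum>j\<in>UNIV. \<bar>h $ j\<bar>)"
    proof (rule coordinate_walk)
      fix i y assume yb: "y \<in> cball x (norm h)"
      then have y: "y \<in> T'" by (rule inT'[OF x h])
      show "((\<lambda>t. u (y + t *\<^sub>R axis i 1)) has_real_derivative D1 i y) (at 0)"
        using D1[OF Tint(2)[OF y]] by (simp only: at[OF Tint(1)[OF y]])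
      have n: "norm (y - x) \<le> norm h" using yb by (simp add: dist_norm norm_minus_commute)
      have "\<bar>D1 i y - D1 i x\<bar> \<le> B2 * d * norm (y - x)"
        using L1[OF x, of "y - x" i] n h by simp
      also have "\<dots> \<le> B2 * d * norm h" using n B2_0 d0 by (intro mult_left_mono) auto
      finally show "\<bar>D1 i y - D1 i x\<bar> \<le> B2 * d * norm h" .
    qed
    also have "\<dots> \<le> (B2 * d * norm h) * (d * norm h)"
      unfolding d_def[symmetric] using B2_0 d0 sum_abs_component_le[of h] by (intro mult_left_mono) (auto simp: d_def)
    finally show ?thesis by (simp add: Gh power2_eq_square mult_ac)
  qed
  define C1 where "C1 = B1 + B2 * d * d * R"
  have C1_0: "0 \<le> C1" using B1_0 B2_0 d0 R by (simp add: C1_def)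
  have L3: "\<bar>u (x + h) - u x\<bar> \<le> C1 * norm h" if x: "x \<in> T" and h: "norm h \<le> R" for x h
  proof -
    have "\<bar>u (x + h) - u x\<bar> \<le> \<bar>u (x + h) - u x - G x \<bullet> h\<bar> + \<bar>G x \<bullet> h\<bar>" by linarith
    also have "\<dots> \<le> B2 * d * d * (norm h)\<^sup>2 + B1 * norm h"
      by (intro add_mono L2[OF that] order_trans[OF Cauchy_Schwarz_ineq2] mult_right_mono Gb[OF x]) auto
    also have "B2 * d * d * (norm h)\<^sup>2 \<le> B2 * d * d * (R * norm h)"
      unfolding power2_eq_square using h B2_0 d0 by (intro mult_left_mono mult_right_mono) auto
    finally show ?thesis by (simp add: C1_def algebra_simps)
  qed
  have lip: "\<bar>u y - u x\<bar> \<le> C1 * dist x y" if "x \<in> T" "y \<in> cball x R" for x y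
    using L3[OF that(1), of "y - x"] that(2) by (simp add: dist_norm norm_minus_commute)
  note ub = bounded_on_compact_of_local_lipschitz[OF T(1) R(1) C1_0 lip]
  then obtain B0 where B0: "\<And>x. x \<in> T \<Longrightarrow> \<bar>u x\<bar> \<le> B0" by blast
  define C where "C = C1 + B2 * d * d + B1 + (\<bar>B0\<bar> + C1 * R)"
  have nn: "0 \<le> B2 * d * d" "0 \<le> C1 * R" using B2_0 d0 C1_0 R by simp_all
  have Cge: "C1 \<le> C" "B2 * d * d \<le> C" "B1 \<le> C" "\<bar>B0\<bar> + C1 * R \<le> C"
    using nn C1_0 B1_0 by (simp_all add: C_def)
  show thesis
  proof (rule that[of R C G])
    show "0 \<le> C" using Cge(1) C1_0 by linarith
    show "\<bar>u (x + h) - u x\<bar> \<le> C * norm h" if "x \<in> T" "norm h \<le> R" for x h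
      using L3[OF that] mult_right_mono[OF Cge(1) norm_ge_zero[of h]] by linarith
    show "\<bar>u (x + h) - u x - G x \<bullet> h\<bar> \<le> C * (norm h)\<^sup>2" if "x \<in> T" "norm h \<le> R" for x h
      using L2[OF that] mult_right_mono[OF Cge(2) zero_le_power2[of "norm h"]] by linarith
    show "norm (G x) \<le> C" if "x \<in> T" for x using Gb[OF that] Cge(3) by linarith
    show "\<bar>u (x + h)\<bar> \<le> C" if "x \<in> T" "norm h \<le> R" for x h
      using L3[OF that] B0[OF that(1)] mult_left_mono[OF that(2) C1_0] Cge(4) by linarith
    show "continuous_on T u" by (rule ub(1))
  qed (rule R)
qed

section \<open>Scaling of Lebesgue integrals and an elementary exponential inequality\<close>

lemma lborel_integral_affine:
  fixes F :: "'a::euclidean_space \<Rightarrow> real"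
  assumes F: "F \<in> borel_measurable borel" and c: "c \<noteq> 0"
  shows "(\<integral>y. F y \<partial>lborel) = \<bar>c\<bar> ^ DIM('a) * (\<integral>z. F (x + c *\<^sub>R z) \<partial>lborel)"
proof -
  have "(\<integral>y. F y \<partial>lborel) = (\<integral>y. F y \<partial>(density (distr lborel borel (\<lambda>z. x + c *\<^sub>R z)) (\<lambda>_. ennreal (\<bar>c\<bar> ^ DIM('a)))))"
    using lborel_affine[OF c, of x] by (simp add: ennreal_power)
  also have "\<dots> = (\<integral>y. \<bar>c\<bar> ^ DIM('a) * F y \<partial>(distr lborel borel (\<lambda>z. x + c *\<^sub>R z)))"
    using F by (subst integral_density) auto
  also have "\<dots> = \<bar>c\<bar> ^ DIM('a) * (\<integral>z. F (x + c *\<^sub>R z) \<partial>lborel)"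
    using F by (subst integral_distr) auto
  finally show ?thesis .
qed

lemma
  fixes \<phi> :: "'a::euclidean_space \<Rightarrow> real"
  assumes m: "\<phi> \<in> borel_measurable borel"
    and out: "\<And>z. R < norm z \<Longrightarrow> \<phi> z = 0" and le: "\<And>z. norm z \<le> R \<Longrightarrow> \<bar>\<phi> z\<bar> \<le> C"
  shows integrable_bounded_cball: "integrable lborel \<phi>"
    and integral_bounded_cball: "\<bar>\<integral>z. \<phi> z \<partial>lborel\<bar> \<le> C * measure lborel (cball (0::'a) R)"
proof -
  have i: "integrable lborel (\<lambda>z. C * indicator (cball (0::'a) R) z :: real)"
    by (intro integrable_mult_right integrable_real_indicator) (auto simp: emeasure_bounded_finite[OF bounded_cball, unfolded infinity_ennreal_def])
  have b: "\<bar>\<phi> z\<bar> \<le> C * indicator (cball (0::'a) R) z" for z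
    using out[of z] le[of z] by (auto simp: indicator_def)
  show int: "integrable lborel \<phi>"
    by (rule Bochner_Integration.integrable_bound[OF i]) (use m b in \<open>auto intro!: AE_I2 order_trans[OF b]\<close>)
  have "\<bar>\<integral>z. \<phi> z \<partial>lborel\<bar> \<le> (\<integral>z. \<bar>\<phi> z\<bar> \<partial>lborel)" by (rule integral_abs_bound)
  also have "\<dots> \<le> (\<integral>z. C * indicator (cball (0::'a) R) z \<partial>lborel)"
    by (intro integral_mono integrable_abs int i b)
  also have "\<dots> = C * measure lborel (cball (0::'a) R)" by simp
  finally show "\<bar>\<integral>z. \<phi> z \<partial>lborel\<bar> \<le> C * measure lborel (cball (0::'a) R)" .
qed

lemma integral_odd_zero:
  fixes F :: "'a::euclidean_space \<Rightarrow> real"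
  assumes "F \<in> borel_measurable borel" "\<And>z. F (- z) = - F z"
  shows "(\<integral>z. F z \<partial>lborel) = 0"
  using lborel_integral_affine[OF assms(1), of "-1" 0] by (simp add: assms(2))

lemma exp_le_quadratic:
  fixes u :: real
  assumes "\<bar>u\<bar> \<le> 1"
  shows "exp u \<le> 1 + u + u\<^sup>2"
proof (cases "0 \<le> u")
  case True
  then show ?thesis using exp_bound[of u] assms by simp
next
  case False
  define v where "v = - u"
  have v: "0 \<le> v" "v \<le> 1" using False assms by (auto simp: v_def)
  \<comment> \<open>Multiplying by a lower Taylor polynomial of \<open>exp v\<close> reduces the
    claim to a polynomial without negative coefficients.\<close>
  have "1 \<le> (1 - v + v\<^sup>2) * (1 + v + v\<^sup>2 / 2)"
  proof -
    have "(1 - v + v\<^sup>2) * (1 + v + v\<^sup>2 / 2) = 1 + v\<^sup>2 / 2 + v ^ 3 / 2 + v ^ 4 / 2"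
      by (simp add: field_simps power2_eq_square power3_eq_cube power4_eq_xxxx)
    then show ?thesis using v by simp
  qed
  also have "\<dots> \<le> (1 - v + v\<^sup>2) * exp v"
    using v exp_lower_Taylor_quadratic[of v] by (intro mult_left_mono) auto
  finally have "exp (- v) \<le> 1 - v + v\<^sup>2"
    by (simp add: exp_minus field_simps)
  then show ?thesis by (simp add: v_def)
qed

section \<open>Exponential bounds and kernel moments\<close>

text \<open>Stated for the exponential moment and not for a tail probability, so that the
  leave-one-out version can still integrate it over the random centre. The condition
  \<open>l * B \<le> 1\<close> puts \<open>l * z y\<close> in the range of
  \<open>exp_le_quadratic\<close>, so bounds on two moments suffice.\<close>

lemma chernoff_PiM:
  fixes z :: "'a \<Rightarrow> real"
  assumes \<mu>: "prob_space \<mu>" and J: "finite J" and m: "z \<in> borel_measurable \<mu>"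
    and bd: "\<And>y. \<bar>z y\<bar> \<le> B" and l: "0 < l" "l * B \<le> 1"
    and a: "(\<integral>y. z y \<partial>\<mu>) \<le> a" and v: "(\<integral>y. (z y)\<^sup>2 \<partial>\<mu>) \<le> v"
  shows "(\<integral>\<^sup>+x. ennreal (exp (l * ((\<Sum>j\<in>J. z (x j)) - t))) \<partial>PiM J (\<lambda>_. \<mu>))
    \<le> ennreal (exp (real (card J) * (l * a + l\<^sup>2 * v) - l * t))"
proof -
  interpret prob_space \<mu> by fact
  interpret P: product_prob_space "\<lambda>_. \<mu>" J by unfold_locales
  have B: "0 \<le> B" using bd[of undefined] by linarith
  have zi: "integrable \<mu> z" by (rule integrable_const_bound[of _ B]) (use bd m in auto)
  have "(z y)\<^sup>2 \<le> B\<^sup>2" for y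
    using power_mono[OF bd abs_ge_zero, of y 2] by (simp only: power2_abs)
  then have z2i: "integrable \<mu> (\<lambda>y. (z y)\<^sup>2)"
    by (intro integrable_const_bound[of _ "B\<^sup>2"] AE_I2) (use m in \<open>simp_all only: real_norm_def abs_power2 borel_measurable_power\<close>)
  have lz: "\<bar>l * z y\<bar> \<le> 1" for y
  proof -
    have "\<bar>l * z y\<bar> = l * \<bar>z y\<bar>" using l by (simp add: abs_mult)
    also have "\<dots> \<le> l * B" using l bd by (intro mult_left_mono) auto
    finally show ?thesis using l by linarith
  qed
  have mz: "(\<lambda>x. z (x j)) \<in> borel_measurable (PiM J (\<lambda>_. \<mu>))" if "j \<in> J" for j
    by (rule measurable_compose[OF measurable_component_singleton[OF that] m])
  have one: "(\<integral>\<^sup>+y. ennreal (exp (l * z y)) \<partial>\<mu>) \<le> ennreal (exp (l * a + l\<^sup>2 * v))"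
  proof -
    have q: "0 \<le> 1 + l * z y + l\<^sup>2 * (z y)\<^sup>2" "exp (l * z y) \<le> 1 + l * z y + l\<^sup>2 * (z y)\<^sup>2" for y
      using exp_le_quadratic[OF lz[of y]] order_trans[OF exp_ge_zero, of "l * z y"]
      by (simp_all add: power_mult_distrib)
    have i: "integrable \<mu> (\<lambda>y. 1 + l * z y + l\<^sup>2 * (z y)\<^sup>2)"
      by (intro Bochner_Integration.integrable_add integrable_mult_right zi z2i) simp
    have "(\<integral>\<^sup>+y. ennreal (exp (l * z y)) \<partial>\<mu>) \<le> (\<integral>\<^sup>+y. ennreal (1 + l * z y + l\<^sup>2 * (z y)\<^sup>2) \<partial>\<mu>)"
      by (intro nn_integral_mono ennreal_leI q)
    also have "\<dots> = ennreal (\<integral>y. 1 + l * z y + l\<^sup>2 * (z y)\<^sup>2 \<partial>\<mu>)"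
      by (rule nn_integral_eq_integral[OF i]) (use q in auto)
    also have "(\<integral>y. 1 + l * z y + l\<^sup>2 * (z y)\<^sup>2 \<partial>\<mu>) = 1 + l * (\<integral>y. z y \<partial>\<mu>) + l\<^sup>2 * (\<integral>y. (z y)\<^sup>2 \<partial>\<mu>)"
      using zi z2i by (simp add: prob_space)
    also have "\<dots> \<le> 1 + (l * a + l\<^sup>2 * v)"
      using mult_left_mono[OF a, of l] mult_left_mono[OF v zero_le_power2[of l]] l by linarith
    also have "\<dots> \<le> exp (l * a + l\<^sup>2 * v)" by (rule exp_ge_add_one_self)
    finally show ?thesis by (simp add: ennreal_leI)
  qed
  have "(\<integral>\<^sup>+x. ennreal (exp (l * ((\<Sum>j\<in>J. z (x j)) - t))) \<partial>PiM J (\<lambda>_. \<mu>))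
      = (\<integral>\<^sup>+x. ennreal (exp (- l * t)) * (\<Prod>j\<in>J. ennreal (exp (l * z (x j)))) \<partial>PiM J (\<lambda>_. \<mu>))"
  proof (rule nn_integral_cong)
    fix x
    have "exp (l * ((\<Sum>j\<in>J. z (x j)) - t)) = exp (- l * t) * (\<Prod>j\<in>J. exp (l * z (x j)))"
      using J by (simp add: exp_sum[symmetric] sum_distrib_left exp_add[symmetric] algebra_simps)
    then show "ennreal (exp (l * ((\<Sum>j\<in>J. z (x j)) - t))) = ennreal (exp (- l * t)) * (\<Prod>j\<in>J. ennreal (exp (l * z (x j))))"
      by (simp add: ennreal_mult prod_ennreal prod_nonneg)
  qed
  also have "\<dots> = ennreal (exp (- l * t)) * (\<integral>\<^sup>+x. (\<Prod>j\<in>J. ennreal (exp (l * z (x j)))) \<partial>PiM J (\<lambda>_. \<mu>))"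
    by (intro nn_integral_cmult borel_measurable_prod_ennreal measurable_compose[OF _ measurable_ennreal]
        measurable_compose[OF _ borel_measurable_exp] borel_measurable_times borel_measurable_const mz)
  also have "(\<integral>\<^sup>+x. (\<Prod>j\<in>J. ennreal (exp (l * z (x j)))) \<partial>PiM J (\<lambda>_. \<mu>)) = (\<Prod>j\<in>J. \<integral>\<^sup>+y. ennreal (exp (l * z y)) \<partial>\<mu>)"
    using m by (intro P.product_nn_integral_prod J) measurable
  also have "\<dots> \<le> (\<Prod>j\<in>J. ennreal (exp (l * a + l\<^sup>2 * v)))"
  proof -
    have "(\<Prod>j\<in>J. p) \<le> (\<Prod>j\<in>J. q)" if "p \<le> q" for p q :: ennreal
      using J by (induction J rule: finite_induct) (auto intro: mult_mono that)
    then show ?thesis using one by blast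
  qed
  also have "\<dots> = ennreal (exp (real (card J) * (l * a + l\<^sup>2 * v)))"
    by (simp add: ennreal_power exp_of_nat_mult)
  also have "ennreal (exp (- l * t)) * \<dots> = ennreal (exp (real (card J) * (l * a + l\<^sup>2 * v) - l * t))"
    by (simp add: ennreal_mult[symmetric] exp_add[symmetric] algebra_simps)
  finally show ?thesis by (simp add: mult_left_mono)
qed

lemma chernoff_sum:
  fixes z :: "'a \<Rightarrow> real"
  assumes \<mu>: "prob_space \<mu>" and J: "finite J" and m: "z \<in> borel_measurable \<mu>"
    and bd: "\<And>y. \<bar>z y\<bar> \<le> B" and l: "0 < l" "l * B \<le> 1"
    and a: "(\<integral>y. z y \<partial>\<mu>) \<le> a" and v: "(\<integral>y. (z y)\<^sup>2 \<partial>\<mu>) \<le> v"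
  shows "{x \<in> space (PiM J (\<lambda>_. \<mu>)). t \<le> (\<Sum>j\<in>J. z (x j))} \<in> sets (PiM J (\<lambda>_. \<mu>))" (is "?A \<in> sets ?P")
    and "emeasure (PiM J (\<lambda>_. \<mu>)) {x \<in> space (PiM J (\<lambda>_. \<mu>)). t \<le> (\<Sum>j\<in>J. z (x j))}
      \<le> ennreal (exp (real (card J) * (l * a + l\<^sup>2 * v) - l * t))"
proof -
  have "(\<lambda>x. z (x j)) \<in> borel_measurable ?P" if "j \<in> J" for j
    by (rule measurable_compose[OF measurable_component_singleton[OF that] m])
  then have "(\<lambda>x. \<Sum>j\<in>J. z (x j)) \<in> borel_measurable ?P" by (rule borel_measurable_sum)
  then show A: "?A \<in> sets ?P" by measurable
  then have "emeasure ?P ?A = (\<integral>\<^sup>+x. indicator ?A x \<partial>?P)" by simp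
  also have "\<dots> \<le> (\<integral>\<^sup>+x. ennreal (exp (l * ((\<Sum>j\<in>J. z (x j)) - t))) \<partial>?P)"
    using l by (intro nn_integral_mono) (auto simp: indicator_def)
  also have "\<dots> \<le> ennreal (exp (real (card J) * (l * a + l\<^sup>2 * v) - l * t))"
    by (rule chernoff_PiM[OF assms])
  finally show "emeasure ?P ?A \<le> ennreal (exp (real (card J) * (l * a + l\<^sup>2 * v) - l * t))" .
qed

text \<open>The centre of the kernel is itself a sample point, so the summands are dependent. Once
  coordinate \<open>i\<close> is frozen at a point of \<open>S\<close> they are independent, with
  moment bounds uniform in that point; a centre outside \<open>S\<close> contributes nothing because
  of the indicator in \<open>?h\<close>.\<close>

lemma chernoff_leave_one_out:
  fixes Z :: "'a \<Rightarrow> 'a \<Rightarrow> real"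
  assumes \<mu>: "prob_space \<mu>" and I: "finite I" "i \<in> I" and S: "S \<in> sets \<mu>"
    and m: "(\<lambda>(x, y). Z x y) \<in> borel_measurable (\<mu> \<Otimes>\<^sub>M \<mu>)"
    and bd: "\<And>x y. x \<in> S \<Longrightarrow> \<bar>Z x y\<bar> \<le> B" and l: "0 < l" "l * B \<le> 1"
    and a: "\<And>x. x \<in> S \<Longrightarrow> (\<integral>y. Z x y \<partial>\<mu>) \<le> a" and v: "\<And>x. x \<in> S \<Longrightarrow> (\<integral>y. (Z x y)\<^sup>2 \<partial>\<mu>) \<le> v"
  shows "{x \<in> space (PiM I (\<lambda>_. \<mu>)). x i \<in> S \<and> t \<le> (\<Sum>j\<in>I - {i}. Z (x i) (x j))} \<in> sets (PiM I (\<lambda>_. \<mu>))"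
    and "emeasure (PiM I (\<lambda>_. \<mu>)) {x \<in> space (PiM I (\<lambda>_. \<mu>)). x i \<in> S \<and> t \<le> (\<Sum>j\<in>I - {i}. Z (x i) (x j))}
    \<le> ennreal (exp ((real (card I) - 1) * (l * a + l\<^sup>2 * v) - l * t))"
proof -
  interpret prob_space \<mu> by fact
  define J where "J = I - {i}"
  have J: "finite J" "i \<notin> J" "insert i J = I" using I by (auto simp: J_def)
  interpret P: product_prob_space "\<lambda>_. \<mu>" I by unfold_locales
  have cJ: "real (card J) = real (card I) - 1" using I by (simp add: J_def card_Diff_singleton of_nat_diff card_gt_0_iff Suc_leI)
      (metis Suc_leI card_gt_0_iff empty_iff of_nat_1 of_nat_diff One_nat_def)
  let ?P = "PiM I (\<lambda>_. \<mu>)"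
  let ?A = "{x \<in> space ?P. x i \<in> S \<and> t \<le> (\<Sum>j\<in>J. Z (x i) (x j))}"
  let ?h = "\<lambda>x. indicator S (x i) * ennreal (exp (l * ((\<Sum>j\<in>J. Z (x i) (x j)) - t)))"
  have mZ: "(\<lambda>x. Z (x i) (x j)) \<in> borel_measurable ?P" if "j \<in> J" for j
    using measurable_compose[OF measurable_Pair[OF measurable_component_singleton[of i I] measurable_component_singleton[of j I]] m] I that J_def
    by simp
  have mS: "(\<lambda>x. \<Sum>j\<in>J. Z (x i) (x j)) \<in> borel_measurable ?P" by (intro borel_measurable_sum mZ)
  have mI: "(\<lambda>x. x i) \<in> ?P \<rightarrow>\<^sub>M \<mu>" using I by simp
  have A: "?A \<in> sets ?P"
  proof -
    have "?A = ((\<lambda>x. x i) -` S \<inter> space ?P) \<inter> ((\<lambda>x. \<Sum>j\<in>J. Z (x i) (x j)) -` {t..} \<inter> space ?P)" by auto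
    then show ?thesis using measurable_sets[OF mI S] measurable_sets[OF mS, of "{t..}"] by auto
  qed
  have mh: "?h \<in> borel_measurable ?P"
    using mS measurable_compose[OF mI borel_measurable_indicator[OF S]]
    by (intro borel_measurable_times_ennreal measurable_compose[OF _ measurable_ennreal] measurable_compose[OF _ borel_measurable_exp]
        borel_measurable_times borel_measurable_diff borel_measurable_const)
  have "emeasure ?P ?A = (\<integral>\<^sup>+x. indicator ?A x \<partial>?P)" using A by simp
  also have "\<dots> \<le> (\<integral>\<^sup>+x. ?h x \<partial>?P)"
    using l by (intro nn_integral_mono) (auto simp: indicator_def)
  \<comment> \<open>Coordinate \<open>i\<close> is integrated last; for each of its values the inner
    integral is over independent coordinates.\<close>
  also have "\<dots> = (\<integral>\<^sup>+y. (\<integral>\<^sup>+x. ?h (x(i := y)) \<partial>PiM J (\<lambda>_. \<mu>)) \<partial>\<mu>)"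
    using P.product_nn_integral_insert_rev[OF J(1,2), of ?h] mh by (simp add: J(3))
  also have "\<dots> \<le> (\<integral>\<^sup>+y. ennreal (exp (real (card J) * (l * a + l\<^sup>2 * v) - l * t)) \<partial>\<mu>)"
  proof (rule nn_integral_mono)
    fix y assume y: "y \<in> space \<mu>"
    show "(\<integral>\<^sup>+x. ?h (x(i := y)) \<partial>PiM J (\<lambda>_. \<mu>)) \<le> ennreal (exp (real (card J) * (l * a + l\<^sup>2 * v) - l * t))"
    proof (cases "y \<in> S")
      case True
      have my: "Z y \<in> borel_measurable \<mu>" using measurable_Pair2[OF m y] by simp
      have "(\<integral>\<^sup>+x. ?h (x(i := y)) \<partial>PiM J (\<lambda>_. \<mu>)) = (\<integral>\<^sup>+x. ennreal (exp (l * ((\<Sum>j\<in>J. Z y (x j)) - t))) \<partial>PiM J (\<lambda>_. \<mu>))"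
      proof (rule nn_integral_cong)
        fix x
        have "(\<Sum>j\<in>J. Z ((x(i := y)) i) ((x(i := y)) j)) = (\<Sum>j\<in>J. Z y (x j))"
          using J(2) by (intro sum.cong) auto
        then show "?h (x(i := y)) = ennreal (exp (l * ((\<Sum>j\<in>J. Z y (x j)) - t)))" using True by simp
      qed
      also have "\<dots> \<le> ennreal (exp (real (card J) * (l * a + l\<^sup>2 * v) - l * t))"
        by (rule chernoff_PiM[OF \<mu> J(1) my bd[OF True] l a[OF True] v[OF True]])
      finally show ?thesis .
    qed simp
  qed
  also have "\<dots> = ennreal (exp ((real (card I) - 1) * (l * a + l\<^sup>2 * v) - l * t))"
    by (simp add: emeasure_space_1 cJ)
  finally show "emeasure ?P {x \<in> space ?P. x i \<in> S \<and> t \<le> (\<Sum>j\<in>I - {i}. Z (x i) (x j))}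
    \<le> ennreal (exp ((real (card I) - 1) * (l * a + l\<^sup>2 * v) - l * t))" by (simp add: J_def)
  show "{x \<in> space ?P. x i \<in> S \<and> t \<le> (\<Sum>j\<in>I - {i}. Z (x i) (x j))} \<in> sets ?P"
    using A by (simp add: J_def)
qed

text \<open>\<open>vol\<close> is a parameter because a definition would take the dimension type as an extra argument.\<close>

locale covariate_design =
  fixes g m :: "real^'d \<Rightarrow> real" and Gm :: "real^'d \<Rightarrow> real^'d" and S :: "(real^'d) set"
    and K :: "real^'d \<Rightarrow> real" and r C c0 B \<rho> :: real and vol :: "real \<Rightarrow> real"
  assumes vol_def: "vol = (\<lambda>R. measure lborel (cball (0 :: real^'d) R))"
    and g_meas[measurable]: "g \<in> borel_measurable borel" and g_nonneg: "\<And>x. 0 \<le> g x"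
    and prob_g: "prob_space (density lborel (\<lambda>x. ennreal (g x)))"
    and m_meas[measurable]: "m \<in> borel_measurable borel"
    and K_cont: "continuous_on UNIV K" and K_le: "\<And>z. \<bar>K z\<bar> \<le> B"
    and K_supp: "\<And>z. \<rho> < norm z \<Longrightarrow> K z = 0" and \<rho>: "0 < \<rho>"
    and K_sym: "\<And>z. K (- z) = K z" and K_int: "(\<integral>z. K z \<partial>lborel) = 1"
    and r: "0 < r" and C: "0 \<le> C" and c0: "0 < c0" and S: "S \<in> sets borel"
    and g_low: "\<And>x. x \<in> S \<Longrightarrow> c0 \<le> g x"
    and g_lip: "\<And>x h. x \<in> S \<Longrightarrow> norm h \<le> r \<Longrightarrow> \<bar>g (x + h) - g x\<bar> \<le> C * norm h"
    and g_bd: "\<And>x h. x \<in> S \<Longrightarrow> norm h \<le> r \<Longrightarrow> \<bar>g (x + h)\<bar> \<le> C"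
    and m_lip: "\<And>x h. x \<in> S \<Longrightarrow> norm h \<le> r \<Longrightarrow> \<bar>m (x + h) - m x\<bar> \<le> C * norm h"
    and m_taylor: "\<And>x h. x \<in> S \<Longrightarrow> norm h \<le> r \<Longrightarrow> \<bar>m (x + h) - m x - Gm x \<bullet> h\<bar> \<le> C * (norm h)\<^sup>2"
    and Gm_le: "\<And>x. x \<in> S \<Longrightarrow> norm (Gm x) \<le> C"
begin

abbreviation "\<mu> \<equiv> density lborel (\<lambda>x. ennreal (g x))"

sublocale prob_space \<mu> by (rule prob_g)

lemma K_meas[measurable]: "K \<in> borel_measurable borel"
  by (intro borel_measurable_continuous_onI K_cont)

lemma B_nonneg: "0 \<le> B" using K_le[of 0] by linarith
lemma vol_nonneg: "0 \<le> vol R" by (simp add: vol_def)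

lemma integral_\<mu>_affine:
  fixes \<phi> :: "real^'d \<Rightarrow> real"
  assumes [measurable]: "\<phi> \<in> borel_measurable borel" and b: "b > 0"
  shows "(\<integral>y. \<phi> y \<partial>\<mu>) = b ^ CARD('d) * (\<integral>z. \<phi> (x + b *\<^sub>R z) * g (x + b *\<^sub>R z) \<partial>lborel)"
proof -
  have "(\<integral>y. \<phi> y \<partial>\<mu>) = (\<integral>y. \<phi> y * g y \<partial>lborel)"
    using g_nonneg by (subst integral_density) (auto simp: mult.commute)
  also have "\<dots> = \<bar>b\<bar> ^ DIM(real^'d) * (\<integral>z. \<phi> (x + b *\<^sub>R z) * g (x + b *\<^sub>R z) \<partial>lborel)"
    by (rule lborel_integral_affine) (measurable, use b in simp)
  finally show ?thesis using b by simp
qed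

text \<open>Rescaling by \<open>b\<close> yields the factor \<open>b ^ CARD('d)\<close>. The density
  is bounded by \<open>C\<close> only near \<open>S\<close>, hence the condition that the ball of
  radius \<open>b * R\<close> fits into the radius \<open>r\<close>.\<close>

lemma integral_\<mu>_local:
  fixes \<phi> :: "real^'d \<Rightarrow> real"
  assumes [measurable]: "\<phi> \<in> borel_measurable borel" and b: "b > 0" "b * R \<le> r" and x: "x \<in> S"
    and out: "\<And>z. R < norm z \<Longrightarrow> \<phi> (x + b *\<^sub>R z) = 0"
    and le: "\<And>z. norm z \<le> R \<Longrightarrow> \<bar>\<phi> (x + b *\<^sub>R z)\<bar> \<le> q"
  shows "\<bar>\<integral>y. \<phi> y \<partial>\<mu>\<bar> \<le> q * C * vol R * b ^ CARD('d)"
proof -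
  have "\<bar>\<integral>z. \<phi> (x + b *\<^sub>R z) * g (x + b *\<^sub>R z) \<partial>lborel\<bar> \<le> (q * C) * measure lborel (cball (0 :: real^'d) R)"
  proof (rule integral_bounded_cball)
    fix z :: "real^'d" assume z: "norm z \<le> R"
    have "norm (b *\<^sub>R z) \<le> b * R" using b z by (simp add: mult_left_mono)
    then have "\<bar>g (x + b *\<^sub>R z)\<bar> \<le> C" using b by (intro g_bd x) linarith
    then show "\<bar>\<phi> (x + b *\<^sub>R z) * g (x + b *\<^sub>R z)\<bar> \<le> q * C"
      unfolding abs_mult using le[OF z] by (intro mult_mono) (auto intro: order_trans[OF abs_ge_zero])
  qed (use out in auto)
  then have "b ^ CARD('d) * \<bar>\<integral>z. \<phi> (x + b *\<^sub>R z) * g (x + b *\<^sub>R z) \<partial>lborel\<bar> \<le> b ^ CARD('d) * (q * C * vol R)"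
    using b unfolding vol_def by (intro mult_left_mono) auto
  then show ?thesis
    using b integral_\<mu>_affine[OF assms(1) b(1), of x] by (simp add: abs_mult mult.commute)
qed

definition "k b x y = K ((y - x) /\<^sub>R b)"

lemma k_affine: "b > 0 \<Longrightarrow> k b x (x + b *\<^sub>R z) = K z"
  by (simp add: k_def)

lemma k_le: "\<bar>k b x y\<bar> \<le> B" by (simp add: k_def K_le)

lemma k_outside:
  assumes b: "b > 0" and "\<rho> * b < dist x y"
  shows "k b x y = 0"
  unfolding k_def
proof (rule K_supp)
  have "\<rho> < dist x y / b" using assms by (simp add: pos_less_divide_eq)
  then show "\<rho> < norm ((y - x) /\<^sub>R b)" using b by (simp add: dist_norm norm_minus_commute divide_inverse_commute)
qed

lemma k_meas[measurable]: "k b x \<in> borel_measurable borel"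
  unfolding k_def by measurable

lemma k_second_moment:
  assumes "b > 0" "b * \<rho> \<le> r" "x \<in> S"
  shows "(\<integral>y. (k b x y)\<^sup>2 \<partial>\<mu>) \<le> B\<^sup>2 * C * vol \<rho> * b ^ CARD('d)"
proof -
  have "\<bar>(K z)\<^sup>2\<bar> \<le> B\<^sup>2" for z using power_mono[OF K_le abs_ge_zero, of z 2] by (simp only: power2_abs abs_power2)
  then have "\<bar>\<integral>y. (k b x y)\<^sup>2 \<partial>\<mu>\<bar> \<le> B\<^sup>2 * C * vol \<rho> * b ^ CARD('d)"
    by (intro integral_\<mu>_local[OF _ assms]) (use assms in \<open>simp_all add: k_affine K_supp\<close>)
  then show ?thesis by linarith
qed

text \<open>\<open>K\<close> may take negative values, so pointwise positivity is no help. As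
  \<open>K\<close> integrates to one and \<open>g\<close> is Lipschitz near \<open>x\<close>, the
  rescaled mean differs from \<open>g x\<close> by a multiple of \<open>b\<close>; the smallness
  assumption saves half of \<open>c0\<close>.\<close>

lemma k_first_moment:
  assumes b: "b > 0" "b * \<rho> \<le> r" and x: "x \<in> S" and small: "B * (C * (b * \<rho>)) * vol \<rho> \<le> c0 / 2"
  shows "c0 / 2 * b ^ CARD('d) \<le> (\<integral>y. k b x y \<partial>\<mu>)"
proof -
  have i1: "integrable lborel (\<lambda>z. K z * (g (x + b *\<^sub>R z) - g x))"
    and i1b: "\<bar>\<integral>z. K z * (g (x + b *\<^sub>R z) - g x) \<partial>lborel\<bar> \<le> B * (C * (b * \<rho>)) * measure lborel (cball (0 :: real^'d) \<rho>)"
  proof -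
    have le: "\<bar>K z * (g (x + b *\<^sub>R z) - g x)\<bar> \<le> B * (C * (b * \<rho>))" if z: "norm z \<le> \<rho>" for z
    proof -
      have n: "norm (b *\<^sub>R z) \<le> b * \<rho>" using b z by (simp add: mult_left_mono)
      then have "\<bar>g (x + b *\<^sub>R z) - g x\<bar> \<le> C * norm (b *\<^sub>R z)" using b by (intro g_lip x) linarith
      also have "\<dots> \<le> C * (b * \<rho>)" by (intro mult_left_mono n C)
      finally show ?thesis unfolding abs_mult using K_le by (intro mult_mono) (auto simp: B_nonneg)
    qed
    show "integrable lborel (\<lambda>z. K z * (g (x + b *\<^sub>R z) - g x))"
      by (rule integrable_bounded_cball[OF _ _ le]) (auto simp: K_supp)
    show "\<bar>\<integral>z. K z * (g (x + b *\<^sub>R z) - g x) \<partial>lborel\<bar> \<le> B * (C * (b * \<rho>)) * measure lborel (cball (0 :: real^'d) \<rho>)"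
      by (rule integral_bounded_cball[OF _ _ le]) (auto simp: K_supp)
  qed
  have iK: "integrable lborel K" by (rule integrable_bounded_cball[of _ \<rho> B]) (auto simp: K_supp K_le)
  have "(\<integral>z. K z * g (x + b *\<^sub>R z) \<partial>lborel) = (\<integral>z. K z * (g (x + b *\<^sub>R z) - g x) + K z * g x \<partial>lborel)"
    by (simp add: algebra_simps)
  also have "\<dots> = (\<integral>z. K z * (g (x + b *\<^sub>R z) - g x) \<partial>lborel) + g x"
    using i1 iK by (simp add: K_int)
  finally have "c0 / 2 \<le> (\<integral>z. K z * g (x + b *\<^sub>R z) \<partial>lborel)"
    using i1b small g_low[OF x] unfolding vol_def by linarith
  then have "b ^ CARD('d) * (c0 / 2) \<le> b ^ CARD('d) * (\<integral>z. K z * g (x + b *\<^sub>R z) \<partial>lborel)"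
    using b by (intro mult_left_mono) auto
  then show ?thesis using integral_\<mu>_affine[OF k_meas b(1), of b x x] by (simp add: k_affine b mult.commute)
qed

text \<open>Summand in the numerator of the smoothing bias at \<open>x\<close>. The normalised
  weights called \<open>w\<close> in \<open>loo_design\<close> are \<open>loo_weight\<close>
  here.\<close>

definition "w b x y = k b x y * (m y - m x)"

lemma w_meas[measurable]: "w b x \<in> borel_measurable borel"
  unfolding w_def by measurable

lemma w_le:
  assumes b: "b > 0" "b * \<rho> \<le> r" and x: "x \<in> S"
  shows "\<bar>w b x y\<bar> \<le> B * (C * (b * \<rho>))"
proof (cases "\<rho> * b < dist x y")
  case True
  then show ?thesis using b B_nonneg C \<rho> by (simp add: w_def k_outside)
next
  case False
  then have n: "norm (y - x) \<le> b * \<rho>" by (simp add: dist_norm norm_minus_commute mult.commute)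
  have "\<bar>m (x + (y - x)) - m x\<bar> \<le> C * norm (y - x)" using n b by (intro m_lip x) linarith
  also have "\<dots> \<le> C * (b * \<rho>)" by (intro mult_left_mono n C)
  finally show ?thesis unfolding w_def abs_mult using k_le by (intro mult_mono) (auto simp: B_nonneg)
qed

text \<open>On the kernel window \<open>m\<close> varies by at most a multiple of \<open>b\<close>,
  which is the source of the two extra powers of \<open>b\<close>.\<close>

lemma w_second_moment:
  assumes b: "b > 0" "b * \<rho> \<le> r" and x: "x \<in> S"
  shows "(\<integral>y. (w b x y)\<^sup>2 \<partial>\<mu>) \<le> (B * (C * \<rho>))\<^sup>2 * C * vol \<rho> * b ^ (CARD('d) + 2)"
proof -
  have "\<bar>(w b x y)\<^sup>2\<bar> \<le> (B * (C * (b * \<rho>)))\<^sup>2" for y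
    using power_mono[OF w_le[OF assms] abs_ge_zero, of y 2] by (simp only: power2_abs abs_power2)
  then have "\<bar>\<integral>y. (w b x y)\<^sup>2 \<partial>\<mu>\<bar> \<le> (B * (C * (b * \<rho>)))\<^sup>2 * C * vol \<rho> * b ^ CARD('d)"
    by (intro integral_\<mu>_local[OF _ assms])
      (measurable, simp add: w_def k_affine b K_supp)
  also have "\<dots> = (B * (C * \<rho>))\<^sup>2 * C * vol \<rho> * b ^ (CARD('d) + 2)"
    by (simp add: power_mult_distrib power_add power2_eq_square mult_ac)
  finally show ?thesis by linarith
qed

text \<open>The first order term \<open>Gm x \<bullet> z\<close> of the bias cancels because \<open>K\<close> is even.\<close>

lemma w_first_moment:
  assumes b: "b > 0" "b * \<rho> \<le> r" and x: "x \<in> S"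
  shows "\<bar>\<integral>y. w b x y \<partial>\<mu>\<bar> \<le> 2 * B * C\<^sup>2 * \<rho>\<^sup>2 * vol \<rho> * b ^ (CARD('d) + 2)"
proof -
  define R where "R = (\<lambda>z. K z * ((m (x + b *\<^sub>R z) - m x) * g (x + b *\<^sub>R z) - b * (Gm x \<bullet> z) * g x))"
  define q where "q = B * (2 * C\<^sup>2 * (b * \<rho>)\<^sup>2)"
  have le: "\<bar>R z\<bar> \<le> q" if z: "norm z \<le> \<rho>" for z
  proof -
    have n: "norm (b *\<^sub>R z) \<le> b * \<rho>" using b z by (simp add: mult_left_mono)
    then have nr: "norm (b *\<^sub>R z) \<le> r" using b by linarith
    have n2: "(norm (b *\<^sub>R z))\<^sup>2 \<le> (b * \<rho>)\<^sup>2" by (rule power_mono[OF n norm_ge_zero])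
    \<comment> \<open>Replacing both factors by their leading terms leaves two errors: the Taylor
      remainder of \<open>m\<close> times the density, and the linear term of \<open>m\<close> times
      the increment of \<open>g\<close>. Each is of second order in \<open>b\<close>.\<close>
    have eq: "(m (x + b *\<^sub>R z) - m x) * g (x + b *\<^sub>R z) - b * (Gm x \<bullet> z) * g x
        = (m (x + b *\<^sub>R z) - m x - Gm x \<bullet> (b *\<^sub>R z)) * g (x + b *\<^sub>R z)
          + (Gm x \<bullet> (b *\<^sub>R z)) * (g (x + b *\<^sub>R z) - g x)"
      by (simp add: algebra_simps)
    have "\<bar>(m (x + b *\<^sub>R z) - m x - Gm x \<bullet> (b *\<^sub>R z)) * g (x + b *\<^sub>R z)\<bar> \<le> (C * (norm (b *\<^sub>R z))\<^sup>2) * C"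
      unfolding abs_mult by (intro mult_mono m_taylor g_bd x nr) (use C in auto)
    moreover have "\<bar>(Gm x \<bullet> (b *\<^sub>R z)) * (g (x + b *\<^sub>R z) - g x)\<bar> \<le> (C * norm (b *\<^sub>R z)) * (C * norm (b *\<^sub>R z))"
      unfolding abs_mult
    proof (intro mult_mono g_lip x nr)
      show "\<bar>Gm x \<bullet> b *\<^sub>R z\<bar> \<le> C * norm (b *\<^sub>R z)"
        by (rule order_trans[OF Cauchy_Schwarz_ineq2]) (intro mult_right_mono Gm_le x norm_ge_zero)
    qed (use C in auto)
    ultimately have "\<bar>(m (x + b *\<^sub>R z) - m x) * g (x + b *\<^sub>R z) - b * (Gm x \<bullet> z) * g x\<bar>
        \<le> (C * (norm (b *\<^sub>R z))\<^sup>2) * C + (C * norm (b *\<^sub>R z)) * (C * norm (b *\<^sub>R z))"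
      unfolding eq by (intro order_trans[OF abs_triangle_ineq] add_mono)
    also have "\<dots> = 2 * C\<^sup>2 * (norm (b *\<^sub>R z))\<^sup>2" by (simp add: power2_eq_square)
    also have "\<dots> \<le> 2 * C\<^sup>2 * (b * \<rho>)\<^sup>2" by (intro mult_left_mono n2) auto
    finally show ?thesis unfolding R_def q_def abs_mult using K_le by (intro mult_mono) (auto simp: B_nonneg)
  qed
  have Rm[measurable]: "R \<in> borel_measurable borel" unfolding R_def by measurable
  have iR: "integrable lborel R"
    by (rule integrable_bounded_cball[OF Rm _ le]) (auto simp: R_def K_supp)
  have R_le: "\<bar>\<integral>z. R z \<partial>lborel\<bar> \<le> q * vol \<rho>" unfolding vol_def
    by (rule integral_bounded_cball[OF Rm _ le]) (auto simp: R_def K_supp)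
  have iO: "integrable lborel (\<lambda>z. K z * (Gm x \<bullet> z))"
  proof (rule integrable_bounded_cball[of _ \<rho> "B * (C * \<rho>)"])
    fix z :: "real^'d" assume z: "norm z \<le> \<rho>"
    have "\<bar>Gm x \<bullet> z\<bar> \<le> norm (Gm x) * norm z" by (rule Cauchy_Schwarz_ineq2)
    also have "\<dots> \<le> C * \<rho>" by (intro mult_mono Gm_le x z C) auto
    finally show "\<bar>K z * (Gm x \<bullet> z)\<bar> \<le> B * (C * \<rho>)"
      unfolding abs_mult using K_le by (intro mult_mono) (auto simp: B_nonneg)
  qed (auto simp: K_supp)
  have O: "(\<integral>z. K z * (Gm x \<bullet> z) \<partial>lborel) = 0"
    by (rule integral_odd_zero) (auto simp: K_sym)
  have "(\<integral>z. w b x (x + b *\<^sub>R z) * g (x + b *\<^sub>R z) \<partial>lborel) = (\<integral>z. R z + b * g x * (K z * (Gm x \<bullet> z)) \<partial>lborel)"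
    by (simp add: w_def k_affine b R_def algebra_simps)
  also have "\<dots> = (\<integral>z. R z \<partial>lborel)" using iR iO by (simp add: O)
  finally have "(\<integral>y. w b x y \<partial>\<mu>) = b ^ CARD('d) * (\<integral>z. R z \<partial>lborel)"
    using integral_\<mu>_affine[OF w_meas b(1), of b x x] by simp
  then have "\<bar>\<integral>y. w b x y \<partial>\<mu>\<bar> = b ^ CARD('d) * \<bar>\<integral>z. R z \<partial>lborel\<bar>" using b by (simp add: abs_mult)
  also have "\<dots> \<le> b ^ CARD('d) * (q * vol \<rho>)" using b by (intro mult_left_mono R_le) auto
  also have "\<dots> = 2 * B * C\<^sup>2 * \<rho>\<^sup>2 * vol \<rho> * b ^ (CARD('d) + 2)"
    by (simp add: q_def power_mult_distrib power_add power2_eq_square mult_ac)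
  finally show ?thesis .
qed

lemma ball_moment:
  assumes b: "b > 0" "b * (2 * \<rho>) \<le> r" and x: "x \<in> S"
  shows "(\<integral>y. indicator (cball x (2 * \<rho> * b)) y \<partial>\<mu>) \<le> C * vol (2 * \<rho>) * b ^ CARD('d)"
proof -
  have "\<bar>\<integral>y. indicator (cball x (2 * \<rho> * b)) y \<partial>\<mu>\<bar> \<le> 1 * C * vol (2 * \<rho>) * b ^ CARD('d)"
  proof (rule integral_\<mu>_local[OF _ b x])
    fix z :: "real^'d" assume "2 * \<rho> < norm z"
    then have "2 * \<rho> * b < b * norm z" using b by (simp add: mult.commute)
    then show "(indicator (cball x (2 * \<rho> * b)) (x + b *\<^sub>R z) :: real) = 0"
      using b by (simp add: indicator_def dist_norm)
  qed (auto simp: indicator_def)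
  then show ?thesis by linarith
qed

end

section \<open>Regular designs and their probability\<close>

context covariate_design begin

text \<open>The radius is twice that of the kernel: two points whose kernel windows share a third
  point are then near each other, which is what bounds the column sums in
  \<open>good_weights\<close>.\<close>

definition "near b x y = (if dist x y \<le> 2 * \<rho> * b then 1 else 0 :: real)"

text \<open>The thresholds leave room for deviations: half of the expected count in
  \<open>S\<close>, and a quarter of the lower bound \<open>c0 / 2\<close> for the scaled mean of
  the kernel. Divided by the denominators, the bound on the \<open>w\<close> sums gives a bias of
  order \<open>b\<^sup>2\<close>.\<close>

definition "good T U n b x \<longleftrightarrow>
  prob S / 2 * real n \<le> (\<Sum>j\<in>{1..n}. indicator S (x j)) \<and>
  (\<forall>i\<in>{1..n}. x i \<in> S \<longrightarrow>
    c0 / 8 * real n * b ^ CARD('d) \<le> (\<Sum>j\<in>{1..n} - {i}. k b (x i) (x j)) \<and>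
    \<bar>\<Sum>j\<in>{1..n} - {i}. w b (x i) (x j)\<bar> \<le> T * real n * b ^ (CARD('d) + 2) \<and>
    (\<Sum>j\<in>{1..n} - {i}. near b (x i) (x j)) \<le> U * real n * b ^ CARD('d))"

lemma k_pair_meas: "(\<lambda>(x, y). k b x y) \<in> borel_measurable (\<mu> \<Otimes>\<^sub>M \<mu>)"
  and w_pair_meas: "(\<lambda>(x, y). w b x y) \<in> borel_measurable (\<mu> \<Otimes>\<^sub>M \<mu>)"
  and near_pair_meas: "(\<lambda>(x, y). near b x y) \<in> borel_measurable (\<mu> \<Otimes>\<^sub>M \<mu>)"
  unfolding k_def w_def near_def by measurable

lemma near_first_moment:
  assumes "b > 0" "b * (2 * \<rho>) \<le> r" "x \<in> S"
  shows "(\<integral>y. near b x y \<partial>\<mu>) \<le> C * vol (2 * \<rho>) * b ^ CARD('d)"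
proof -
  have "near b x = indicator (cball x (2 * \<rho> * b))" by (auto simp: near_def indicator_def)
  then show ?thesis using ball_moment[OF assms] by simp
qed

text \<open>A union bound over one event for the count in \<open>S\<close> and four events per
  index. The weakest exponent belongs to the bias numerator: its variance and its threshold are both
  of order \<open>n * b^(d+2)\<close>, so its failure is exponential in that quantity and not in
  \<open>n * b^d\<close>. The other events with an index are weakened to the same exponent.\<close>

lemma good_probability:
  assumes pS: "prob S > 0"
  obtains \<tau> T U where "\<tau> > 0" "T > 0" "U > 0"
    "\<And>n b. n \<ge> 4 \<Longrightarrow> 0 < b \<Longrightarrow> b \<le> 1 \<Longrightarrow> b * (2 * \<rho>) \<le> r \<Longrightarrow> B * (C * (b * \<rho>)) * vol \<rho> \<le> c0 / 2 \<Longrightarrow>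
      \<exists>N\<in>sets (PiM {1..n} (\<lambda>_. \<mu>)).
        emeasure (PiM {1..n} (\<lambda>_. \<mu>)) N
          \<le> ennreal (exp (- (prob S / 16 * real n)) + real n * (4 * exp (- (\<tau> * (real n * b ^ (CARD('d) + 2)))))) \<and>
        (\<forall>x\<in>space (PiM {1..n} (\<lambda>_. \<mu>)) - N. good T U n b x)"
proof -
  define V0 where "V0 = B\<^sup>2 * C * vol \<rho>"
  define A2 where "A2 = 2 * B * C\<^sup>2 * \<rho>\<^sup>2 * vol \<rho>"
  define V2 where "V2 = (B * (C * \<rho>))\<^sup>2 * C * vol \<rho>"
  define A3 where "A3 = C * vol (2 * \<rho>)"
  define B2 where "B2 = B * (C * \<rho>)"
  have vol_nn: "0 \<le> vol R" for R by (rule vol_nonneg)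
  have nn: "0 \<le> V0" "0 \<le> A2" "0 \<le> V2" "0 \<le> A3" "0 \<le> B2"
    using B_nonneg C \<rho> vol_nn by (simp_all add: V0_def A2_def V2_def A3_def B2_def)
  \<comment> \<open>The first entry satisfies the Chernoff range condition; the second keeps the
    quadratic term below half of the drift \<open>c0 / 2\<close>.\<close>
  define l1 where "l1 = min (1 / (B + 1)) (c0 / 4 / (V0 + 1))"
  define l2 where "l2 = 1 / (B2 + 1)"
  \<comment> \<open>After multiplication by \<open>l2\<close> the first two summands pay for mean
    and second moment, and the last one leaves a surplus of \<open>n * b^(d+2)\<close> in the
    exponent. \<open>U\<close> is built in the same way for parameter one.\<close>
  define T where "T = A2 + l2 * V2 + 1 / l2"
  define U where "U = 2 * A3 + 1"
  define \<tau> where "\<tau> = min (l1 * c0 / 16) 1"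
  have l1: "0 < l1" "l1 * B \<le> 1" "l1 * V0 \<le> c0 / 4"
  proof -
    show "0 < l1" using B_nonneg c0 nn by (simp add: l1_def)
    have "l1 * B \<le> 1 / (B + 1) * B" using B_nonneg by (intro mult_right_mono) (simp_all add: l1_def)
    also have "\<dots> \<le> 1" using B_nonneg by simp
    finally show "l1 * B \<le> 1" .
    have "l1 * V0 \<le> c0 / 4 / (V0 + 1) * V0" using nn by (intro mult_right_mono) (simp_all add: l1_def)
    also have "\<dots> = c0 / 4 * (V0 / (V0 + 1))" by simp
    also have "\<dots> \<le> c0 / 4 * 1" using nn c0 by (intro mult_left_mono) simp_all
    finally show "l1 * V0 \<le> c0 / 4" by simp
  qed
  have l2: "0 < l2" "l2 * B2 \<le> 1" using nn by (simp_all add: l2_def)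
  have T: "0 < T" using nn l2 by (simp add: T_def add_nonneg_pos)
  have U: "0 < U" using nn by (simp add: U_def)
  have \<tau>: "0 < \<tau>" "\<tau> \<le> l1 * c0 / 16" "\<tau> \<le> 1" using l1 c0 by (simp_all add: \<tau>_def)
  have S\<mu>: "S \<in> sets \<mu>" using S by simp
  show thesis
  proof (rule that[OF \<tau>(1) T U])
    fix n :: nat and b :: real
    assume n: "n \<ge> 4" and b: "0 < b" "b \<le> 1" and br: "b * (2 * \<rho>) \<le> r" and small: "B * (C * (b * \<rho>)) * vol \<rho> \<le> c0 / 2"
    define I where "I = {1..n}"
    have I: "finite I" "card I = n" by (simp_all add: I_def)
    let ?P = "PiM I (\<lambda>_. \<mu>)"
    have b\<rho>: "b * \<rho> \<le> r" using br b \<rho> mult_pos_pos[OF b(1) \<rho>] by linarith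
    define D where "D = b ^ CARD('d)"
    have D: "0 < D" using b by (simp add: D_def)
    have D2: "b ^ (CARD('d) + 2) \<le> D" unfolding D_def using b by (intro power_decreasing) auto
    define D' where "D' = b ^ (CARD('d) + 2)"
    have D': "0 < D'" "D' \<le> D" using b D2 by (simp_all add: D'_def)
    define E where "E = exp (- (\<tau> * (real n * D')))"
    \<comment> \<open>Lower deviations are written as upper deviations of the negated summands, so
      that one Chernoff bound covers all events.\<close>
    define N0 where "N0 = {x \<in> space ?P. - (prob S / 2 * real n) \<le> (\<Sum>j\<in>I. - indicator S (x j))}"
    define N1 where "N1 = (\<lambda>i. {x \<in> space ?P. x i \<in> S \<and> - (c0 / 8 * real n * D) \<le> (\<Sum>j\<in>I - {i}. - k b (x i) (x j))})"
    define N2 where "N2 = (\<lambda>i. {x \<in> space ?P. x i \<in> S \<and> T * real n * D' \<le> (\<Sum>j\<in>I - {i}. w b (x i) (x j))})"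
    define N3 where "N3 = (\<lambda>i. {x \<in> space ?P. x i \<in> S \<and> T * real n * D' \<le> (\<Sum>j\<in>I - {i}. - w b (x i) (x j))})"
    define N4 where "N4 = (\<lambda>i. {x \<in> space ?P. x i \<in> S \<and> U * real n * D \<le> (\<Sum>j\<in>I - {i}. near b (x i) (x j))})"
    have n1: "real n - 1 \<ge> 3 / 4 * real n" "real n \<ge> 4" using n by simp_all
    have N0: "N0 \<in> sets ?P" "emeasure ?P N0 \<le> ennreal (exp (- (prob S / 16 * real n)))"
    proof -
      have m: "(\<lambda>y. - indicator S y :: real) \<in> borel_measurable \<mu>" using S\<mu> by measurable
      have a: "(\<integral>y. - indicator S y \<partial>\<mu>) \<le> - prob S" using S\<mu> by simp
      have "(\<lambda>y. (- indicator S y :: real)\<^sup>2) = indicator S" by (auto simp: indicator_def)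
      then have v: "(\<integral>y. (- indicator S y :: real)\<^sup>2 \<partial>\<mu>) \<le> prob S" using S\<mu> by simp
      have bd: "\<bar>- indicator S y :: real\<bar> \<le> 1" for y by (simp add: indicator_def)
      \<comment> \<open>With parameter \<open>1 / 4\<close> the exponent is
        \<open>prob S * n\<close> times \<open>- 1/4 + 1/16 + 1/8 = - 1/16\<close>.\<close>
      note c = chernoff_sum[OF prob_g I(1) m bd _ _ a v, of "1 / 4" "- (prob S / 2 * real n)"]
      show "N0 \<in> sets ?P" unfolding N0_def by (rule c(1)) auto
      have "emeasure ?P N0 \<le> ennreal (exp (real (card I) * (1 / 4 * - prob S + (1 / 4)\<^sup>2 * prob S) - 1 / 4 * - (prob S / 2 * real n)))"
        unfolding N0_def by (rule c(2)) auto
      also have "real (card I) * (1 / 4 * - prob S + (1 / 4)\<^sup>2 * prob S) - 1 / 4 * - (prob S / 2 * real n) = - (prob S / 16 * real n)"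
        by (simp add: I power2_eq_square field_simps)
      finally show "emeasure ?P N0 \<le> ennreal (exp (- (prob S / 16 * real n)))" .
    qed
    have N1: "N1 i \<in> sets ?P" "emeasure ?P (N1 i) \<le> ennreal E" if i: "i \<in> I" for i
    proof -
      have m: "(\<lambda>(x, y). - k b x y) \<in> borel_measurable (\<mu> \<Otimes>\<^sub>M \<mu>)"
        using k_pair_meas[of b] by (simp add: split_beta')
      have bd: "\<bar>- k b x y\<bar> \<le> B" for x y by (simp add: k_le)
      have a: "(\<integral>y. - k b x y \<partial>\<mu>) \<le> - (c0 / 2 * D)" if "x \<in> S" for x
        using k_first_moment[OF b(1) b\<rho> that small] by (simp add: D_def)
      have v: "(\<integral>y. (- k b x y)\<^sup>2 \<partial>\<mu>) \<le> V0 * D" if "x \<in> S" for x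
        using k_second_moment[OF b(1) b\<rho> that] by (simp add: D_def V0_def)
      note c = chernoff_leave_one_out[where Z = "\<lambda>x y. - k b x y", OF prob_g I(1) i S\<mu> m bd l1(1,2) a v, of "- (c0 / 8 * real n * D)"]
      show "N1 i \<in> sets ?P" unfolding N1_def by (rule c(1))
      have "emeasure ?P (N1 i) \<le> ennreal (exp ((real (card I) - 1) * (l1 * - (c0 / 2 * D) + l1\<^sup>2 * (V0 * D)) - l1 * - (c0 / 8 * real n * D)))"
        unfolding N1_def by (rule c(2))
      also have "\<dots> \<le> ennreal E"
      proof -
        have "(real n - 1) * (l1 * - (c0 / 2 * D) + l1\<^sup>2 * (V0 * D)) = (real n - 1) * (l1 * D * (l1 * V0 - c0 / 2))"
          by (simp add: power2_eq_square algebra_simps)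
        also have "\<dots> \<le> (real n - 1) * (l1 * D * (- c0 / 4))"
          using l1 D n1 by (intro mult_left_mono) auto
        also have "\<dots> = - (l1 * D * c0 / 4) * (real n - 1)" by simp
        \<comment> \<open>The sum has \<open>n - 1\<close> terms, and \<open>n \<ge> 4\<close> makes
          this at least \<open>3/4 * n\<close>. The drift is then \<open>- 3/16\<close>, the
          threshold adds \<open>2/16\<close>, and \<open>- 1/16\<close> remains, each times
          \<open>l1 * c0 * n * D\<close>.\<close>
        also have "\<dots> \<le> - (l1 * D * c0 / 4) * (3 / 4 * real n)"
          using n1 l1 D c0 by (intro mult_left_mono_neg) auto
        finally have "(real n - 1) * (l1 * - (c0 / 2 * D) + l1\<^sup>2 * (V0 * D)) - l1 * - (c0 / 8 * real n * D) \<le> - (l1 * c0 / 16 * (real n * D))"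
          by (simp add: algebra_simps)
        also have "\<dots> \<le> - (\<tau> * (real n * D'))"
          unfolding neg_le_iff_le using \<tau> D' l1 c0 by (intro mult_mono mult_left_mono) auto
        finally show ?thesis by (simp add: E_def I ennreal_leI)
      qed
      finally show "emeasure ?P (N1 i) \<le> ennreal E" .
    qed
    have expT: "exp ((real (card I) - 1) * (l2 * (A2 * D') + l2\<^sup>2 * (V2 * D')) - l2 * (T * real n * D')) \<le> E"
    proof -
      have "(real n - 1) * (l2 * (A2 * D') + l2\<^sup>2 * (V2 * D')) \<le> real n * (l2 * (A2 * D') + l2\<^sup>2 * (V2 * D'))"
        using l2 nn D' by (intro mult_right_mono) auto
      moreover have "l2 * (T * real n * D') = real n * (l2 * (A2 * D') + l2\<^sup>2 * (V2 * D')) + real n * D'"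
        using l2 by (simp add: T_def power2_eq_square algebra_simps)
      moreover have "\<tau> * (real n * D') \<le> 1 * (real n * D')" using \<tau> D' by (intro mult_right_mono) auto
      ultimately show ?thesis by (simp add: E_def I)
    qed
    have wb: "\<bar>w b x y\<bar> \<le> B2" if "x \<in> S" for x y
    proof -
      have "B * (C * (b * \<rho>)) \<le> B * (C * (1 * \<rho>))"
        using b B_nonneg C \<rho> by (intro mult_left_mono mult_right_mono) auto
      then show ?thesis using w_le[OF b(1) b\<rho> that, of y] by (simp add: B2_def)
    qed
    have w1: "\<bar>\<integral>y. w b x y \<partial>\<mu>\<bar> \<le> A2 * D'" if "x \<in> S" for x
      using w_first_moment[OF b(1) b\<rho> that] by (simp add: A2_def D'_def)
    have w2: "(\<integral>y. (w b x y)\<^sup>2 \<partial>\<mu>) \<le> V2 * D'" if "x \<in> S" for x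
      using w_second_moment[OF b(1) b\<rho> that] by (simp add: V2_def D'_def)
    have N2: "N2 i \<in> sets ?P" "emeasure ?P (N2 i) \<le> ennreal E" if i: "i \<in> I" for i
    proof -
      have a: "(\<integral>y. w b x y \<partial>\<mu>) \<le> A2 * D'" if "x \<in> S" for x using w1[OF that] by linarith
      note c = chernoff_leave_one_out[OF prob_g I(1) i S\<mu> w_pair_meas wb l2 a w2, of "T * real n * D'"]
      show "N2 i \<in> sets ?P" unfolding N2_def by (rule c(1))
      show "emeasure ?P (N2 i) \<le> ennreal E"
        unfolding N2_def by (rule order_trans[OF c(2) ennreal_leI[OF expT]])
    qed
    have N3: "N3 i \<in> sets ?P" "emeasure ?P (N3 i) \<le> ennreal E" if i: "i \<in> I" for i
    proof -
      have m: "(\<lambda>(x, y). - w b x y) \<in> borel_measurable (\<mu> \<Otimes>\<^sub>M \<mu>)"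
        using w_pair_meas[of b] by (simp add: split_beta')
      have a: "(\<integral>y. - w b x y \<partial>\<mu>) \<le> A2 * D'" if "x \<in> S" for x using w1[OF that] by simp
      have v: "(\<integral>y. (- w b x y)\<^sup>2 \<partial>\<mu>) \<le> V2 * D'" if "x \<in> S" for x using w2[OF that] by simp
      have bd: "\<bar>- w b x y\<bar> \<le> B2" if "x \<in> S" for x y using wb[OF that] by simp
      note c = chernoff_leave_one_out[where Z = "\<lambda>x y. - w b x y", OF prob_g I(1) i S\<mu> m bd l2 a v, of "T * real n * D'"]
      show "N3 i \<in> sets ?P" unfolding N3_def by (rule c(1))
      show "emeasure ?P (N3 i) \<le> ennreal E"
        unfolding N3_def by (rule order_trans[OF c(2) ennreal_leI[OF expT]])
    qed
    have N4: "N4 i \<in> sets ?P" "emeasure ?P (N4 i) \<le> ennreal E" if i: "i \<in> I" for i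
    proof -
      have bd: "\<bar>near b x y\<bar> \<le> 1" for x y by (simp add: near_def)
      have a: "(\<integral>y. near b x y \<partial>\<mu>) \<le> A3 * D" if "x \<in> S" for x
        using near_first_moment[OF b(1) br that] by (simp add: A3_def D_def)
      have sq: "(near b x y)\<^sup>2 = near b x y" for x y by (simp add: near_def)
      have v: "(\<integral>y. (near b x y)\<^sup>2 \<partial>\<mu>) \<le> A3 * D" if "x \<in> S" for x unfolding sq by (rule a[OF that])
      note c = chernoff_leave_one_out[OF prob_g I(1) i S\<mu> near_pair_meas bd _ _ a v, of 1 "U * real n * D"]
      show "N4 i \<in> sets ?P" unfolding N4_def by (rule c(1)) simp_all
      have "emeasure ?P (N4 i) \<le> ennreal (exp ((real (card I) - 1) * (1 * (A3 * D) + 1\<^sup>2 * (A3 * D)) - 1 * (U * real n * D)))"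
        unfolding N4_def by (rule c(2)) simp_all
      also have "\<dots> \<le> ennreal E"
      proof -
        have "(real n - 1) * (1 * (A3 * D) + 1\<^sup>2 * (A3 * D)) \<le> real n * (1 * (A3 * D) + 1\<^sup>2 * (A3 * D))"
          using nn D by (intro mult_right_mono) auto
        moreover have "1 * (U * real n * D) = real n * (1 * (A3 * D) + 1\<^sup>2 * (A3 * D)) + real n * D"
          by (simp add: U_def algebra_simps)
        moreover have "\<tau> * (real n * D') \<le> 1 * (real n * D)"
          using \<tau> D' D by (intro mult_mono mult_left_mono) auto
        ultimately show ?thesis by (simp add: E_def I ennreal_leI)
      qed
      finally show "emeasure ?P (N4 i) \<le> ennreal E" .
    qed
    define N where "N = N0 \<union> (\<Union>i\<in>I. N1 i \<union> N2 i \<union> (N3 i \<union> N4 i))"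
    have Ns: "N \<in> sets ?P" unfolding N_def using N0 N1 N2 N3 N4 I by (intro sets.Un sets.finite_UN) auto
    have "emeasure ?P N \<le> emeasure ?P N0 + emeasure ?P (\<Union>i\<in>I. N1 i \<union> N2 i \<union> (N3 i \<union> N4 i))"
      unfolding N_def using N0 N1 N2 N3 N4 I by (intro emeasure_subadditive sets.finite_UN sets.Un) auto
    also have "emeasure ?P (\<Union>i\<in>I. N1 i \<union> N2 i \<union> (N3 i \<union> N4 i)) \<le> (\<Sum>i\<in>I. emeasure ?P (N1 i \<union> N2 i \<union> (N3 i \<union> N4 i)))"
      using N1 N2 N3 N4 I by (intro emeasure_subadditive_finite) auto
    also have "\<dots> \<le> (\<Sum>i\<in>I. ennreal E + ennreal E + (ennreal E + ennreal E))"
    proof (rule sum_mono)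
      fix i assume i: "i \<in> I"
      have "emeasure ?P (N1 i \<union> N2 i \<union> (N3 i \<union> N4 i)) \<le> emeasure ?P (N1 i \<union> N2 i) + emeasure ?P (N3 i \<union> N4 i)"
        using N1 N2 N3 N4 i by (intro emeasure_subadditive) auto
      also have "\<dots> \<le> (emeasure ?P (N1 i) + emeasure ?P (N2 i)) + (emeasure ?P (N3 i) + emeasure ?P (N4 i))"
        using N1 N2 N3 N4 i by (intro add_mono emeasure_subadditive) auto
      also have "\<dots> \<le> ennreal E + ennreal E + (ennreal E + ennreal E)"
        by (intro add_mono N1 N2 N3 N4 i)
      finally show "emeasure ?P (N1 i \<union> N2 i \<union> (N3 i \<union> N4 i)) \<le> ennreal E + ennreal E + (ennreal E + ennreal E)" .
    qed
    also have "\<dots> = ennreal (real n * (4 * E))"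
    proof -
      have E0: "0 \<le> E" by (simp add: E_def)
      then have "ennreal E + ennreal E + (ennreal E + ennreal E) = ennreal (4 * E)" by (simp add: ennreal_plus[symmetric] del: ennreal_plus)
      then show ?thesis using E0 by (simp add: I ennreal_mult ennreal_of_nat_eq_real_of_nat)
    qed
    finally have "emeasure ?P N \<le> emeasure ?P N0 + ennreal (real n * (4 * E))" by (simp add: add_left_mono)
    also have "\<dots> \<le> ennreal (exp (- (prob S / 16 * real n))) + ennreal (real n * (4 * E))"
      by (intro add_right_mono N0)
    also have "\<dots> = ennreal (exp (- (prob S / 16 * real n)) + real n * (4 * E))"
      by (simp add: E_def)
    finally have Nm: "emeasure ?P N \<le> ennreal (exp (- (prob S / 16 * real n)) + real n * (4 * E))" .
    have "good T U n b x" if x: "x \<in> space ?P - N" for x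
      unfolding good_def I_def[symmetric] D_def[symmetric] D'_def[symmetric]
    proof (intro conjI ballI impI)
      have "x \<notin> N0" using x by (simp add: N_def)
      then show "prob S / 2 * real n \<le> (\<Sum>j\<in>I. indicator S (x j))"
        using x by (simp add: N0_def sum_negf)
      fix i assume i: "i \<in> I" and xi: "x i \<in> S"
      have "x \<notin> N1 i" "x \<notin> N2 i" "x \<notin> N3 i" "x \<notin> N4 i" using x i by (auto simp: N_def)
      then show "c0 / 8 * real n * D \<le> (\<Sum>j\<in>I - {i}. k b (x i) (x j))"
        "\<bar>\<Sum>j\<in>I - {i}. w b (x i) (x j)\<bar> \<le> T * real n * D'"
        "(\<Sum>j\<in>I - {i}. near b (x i) (x j)) \<le> U * real n * D"
        using x xi unfolding N1_def N2_def N3_def N4_def sum_negf by (auto simp: abs_le_iff)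
    qed
    then show "\<exists>N\<in>sets (PiM {1..n} (\<lambda>_. \<mu>)).
        emeasure (PiM {1..n} (\<lambda>_. \<mu>)) N
          \<le> ennreal (exp (- (prob S / 16 * real n)) + real n * (4 * exp (- (\<tau> * (real n * b ^ (CARD('d) + 2)))))) \<and>
        (\<forall>x\<in>space (PiM {1..n} (\<lambda>_. \<mu>)) - N. good T U n b x)"
      using Ns Nm unfolding I_def E_def D'_def by blast
  qed
qed

section \<open>Smoothing weights and biases on a regular design\<close>

definition "loo_weight n b x i j =
  (if j \<in> {1..n} - {i} then k b (x i) (x j) / (\<Sum>j\<in>{1..n} - {i}. k b (x i) (x j)) else 0)"
definition "loo_bias n b x i =
  (\<Sum>j\<in>{1..n} - {i}. w b (x i) (x j)) / (\<Sum>j\<in>{1..n} - {i}. k b (x i) (x j))"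

text \<open>Each weight is of order \<open>1 / (n * b^d)\<close> and a row has of the order of
  \<open>n * b^d\<close> nonzero ones, which gives the row sums of squares. Columns are harder:
  \<open>x j\<close> may lie outside \<open>S\<close>, where \<open>good\<close> says nothing about
  neighbour counts, so the count is taken around another sample point.\<close>

lemma good_weights:
  assumes good: "good T U n b x" and b: "0 < b" and n: "n \<ge> 1" and nb: "1 \<le> real n * b ^ CARD('d)"
    and U: "0 < U" and T: "0 < T"
  defines "J \<equiv> {i\<in>{1..n}. x i \<in> S}" and "q \<equiv> c0 / 8"
  shows "prob S / 2 * real n \<le> real (card J)"
    and "\<And>i. i \<in> J \<Longrightarrow> q * (real n * b ^ CARD('d)) \<le> (\<Sum>j\<in>{1..n} - {i}. k b (x i) (x j))"
    and "\<And>i. i \<in> J \<Longrightarrow> \<bar>loo_bias n b x i\<bar> \<le> T / q * b\<^sup>2"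
    and "\<And>i. i \<in> J \<Longrightarrow> (\<Sum>j\<in>{1..n}. (loo_weight n b x i j)\<^sup>2) \<le> (B / q)\<^sup>2 * U / (real n * b ^ CARD('d))"
    and "\<And>j. j \<in> {1..n} \<Longrightarrow> \<bar>\<Sum>i\<in>J. loo_weight n b x i j\<bar> \<le> B / q * (U + 1)"
proof -
  define D where "D = real n * b ^ CARD('d)"
  have D: "0 < D" "1 \<le> D" using nb by (simp_all add: D_def)
  have q: "0 < q" using c0 by (simp add: q_def)
  let ?den = "\<lambda>i. \<Sum>j\<in>{1..n} - {i}. k b (x i) (x j)"
  have g1: "q * D \<le> ?den i" if "i \<in> J" for i
    using good that unfolding good_def J_def q_def D_def by (auto simp: mult.assoc)
  have g2: "\<bar>\<Sum>j\<in>{1..n} - {i}. w b (x i) (x j)\<bar> \<le> T * b\<^sup>2 * D" if "i \<in> J" for i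
    using good that unfolding good_def J_def D_def by (auto simp: power_add power2_eq_square mult_ac)
  have g3: "(\<Sum>j\<in>{1..n} - {i}. near b (x i) (x j)) \<le> U * D" if "i \<in> J" for i
    using good that unfolding good_def J_def D_def by (auto simp: mult.assoc)
  have qD: "0 < q * D" using q D by simp
  show "q * (real n * b ^ CARD('d)) \<le> ?den i" if "i \<in> J" for i using g1[OF that] by (simp add: D_def)
  have "J = {1..n} \<inter> {j. x j \<in> S}" by (auto simp: J_def)
  then have "(\<Sum>j\<in>{1..n}. indicator S (x j)) = real (card J)"
    by (simp add: indicator_def sum.If_cases)
  then show "prob S / 2 * real n \<le> real (card J)" using good by (simp add: good_def)
  have w: "\<bar>loo_weight n b x i j\<bar> \<le> B / (q * D) * (if i \<noteq> j \<and> dist (x i) (x j) \<le> \<rho> * b then 1 else 0)"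
    if i: "i \<in> J" for i j
  proof (cases "j \<in> {1..n} - {i} \<and> dist (x i) (x j) \<le> \<rho> * b")
    case True
    have "\<bar>k b (x i) (x j)\<bar> / ?den i \<le> B / (q * D)"
      by (rule frac_le) (use k_le qD g1[OF i] B_nonneg in auto)
    then show ?thesis using True qD g1[OF i] by (simp add: loo_weight_def)
  next
    case False
    then have "loo_weight n b x i j = 0" using k_outside[OF b, of "x i" "x j"] by (auto simp: loo_weight_def)
    then show ?thesis using B_nonneg qD by simp
  qed
  show "\<bar>loo_bias n b x i\<bar> \<le> T / q * b\<^sup>2" if i: "i \<in> J" for i
  proof -
    have "\<bar>loo_bias n b x i\<bar> = \<bar>\<Sum>j\<in>{1..n} - {i}. w b (x i) (x j)\<bar> / ?den i"
      using g1[OF i] qD by (simp add: loo_bias_def)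
    also have "\<dots> \<le> (T * b\<^sup>2 * D) / (q * D)"
      by (rule frac_le) (use g1[OF i] g2[OF i] qD T D in auto)
    also have "\<dots> = T / q * b\<^sup>2" using D by simp
    finally show ?thesis .
  qed
  show "(\<Sum>j\<in>{1..n}. (loo_weight n b x i j)\<^sup>2) \<le> (B / q)\<^sup>2 * U / (real n * b ^ CARD('d))" if i: "i \<in> J" for i
  proof -
    have "(\<Sum>j\<in>{1..n}. (loo_weight n b x i j)\<^sup>2) = (\<Sum>j\<in>{1..n} - {i}. (loo_weight n b x i j)\<^sup>2)"
      by (intro sum.mono_neutral_right) (auto simp: loo_weight_def)
    also have "\<dots> \<le> (\<Sum>j\<in>{1..n} - {i}. (B / (q * D))\<^sup>2 * near b (x i) (x j))"
    proof (rule sum_mono)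
      fix j assume j: "j \<in> {1..n} - {i}"
      have b2: "\<rho> * b \<le> 2 * \<rho> * b" using \<rho> b by simp
      have "(loo_weight n b x i j)\<^sup>2 \<le> (B / (q * D) * (if i \<noteq> j \<and> dist (x i) (x j) \<le> \<rho> * b then 1 else 0))\<^sup>2"
        using power_mono[OF w[OF i, of j] abs_ge_zero, of 2] by (simp only: power2_abs)
      also have "\<dots> \<le> (B / (q * D))\<^sup>2 * near b (x i) (x j)"
        using b2 by (simp add: near_def)
      finally show "(loo_weight n b x i j)\<^sup>2 \<le> (B / (q * D))\<^sup>2 * near b (x i) (x j)" .
    qed
    also have "\<dots> \<le> (B / (q * D))\<^sup>2 * (U * D)"
      unfolding sum_distrib_left[symmetric] by (intro mult_left_mono g3 i) simp
    also have "\<dots> = (B / q)\<^sup>2 * U / D" using D by (simp add: power2_eq_square)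
    finally show ?thesis by (simp add: D_def)
  qed
  show "\<bar>\<Sum>i\<in>J. loo_weight n b x i j\<bar> \<le> B / q * (U + 1)" if j: "j \<in> {1..n}" for j
  proof -
    \<comment> \<open>The rows that really use observation \<open>j\<close>.\<close>
    define H where "H = {i\<in>J. i \<noteq> j \<and> dist (x i) (x j) \<le> \<rho> * b}"
    have fJ: "finite J" "J \<subseteq> {1..n}" by (auto simp: J_def)
    have cH: "real (card H) \<le> (U + 1) * D"
    proof (cases "H = {}")
      case True
      then show ?thesis using U D by simp
    next
      case False
      then obtain i0 where i0: "i0 \<in> H" by blast
      \<comment> \<open>By the triangle inequality through \<open>x j\<close>, all members of
        \<open>H\<close> are near \<open>x i0\<close>, and \<open>i0\<close> lies in
        \<open>J\<close>, where counts are controlled. A count around \<open>i0\<close> omits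
        \<open>i0\<close> itself; this is the one in \<open>U + 1\<close>, paid with
        \<open>1 \<le> D\<close>.\<close>
      have "H \<subseteq> insert i0 {i\<in>{1..n} - {i0}. dist (x i0) (x i) \<le> 2 * \<rho> * b}"
      proof
        fix i assume i: "i \<in> H"
        have "dist (x i0) (x i) \<le> dist (x i0) (x j) + dist (x i) (x j)"
          by (metis dist_commute dist_triangle)
        also have "\<dots> \<le> 2 * \<rho> * b" using i i0 by (auto simp: H_def)
        finally show "i \<in> insert i0 {i\<in>{1..n} - {i0}. dist (x i0) (x i) \<le> 2 * \<rho> * b}"
          using i fJ by (auto simp: H_def)
      qed
      then have "card H \<le> card (insert i0 {i\<in>{1..n} - {i0}. dist (x i0) (x i) \<le> 2 * \<rho> * b})"
        by (intro card_mono) auto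
      also have "\<dots> \<le> Suc (card {i\<in>{1..n} - {i0}. dist (x i0) (x i) \<le> 2 * \<rho> * b})"
        by (simp add: card_insert_if)
      finally have "real (card H) \<le> 1 + real (card {i\<in>{1..n} - {i0}. dist (x i0) (x i) \<le> 2 * \<rho> * b})" by simp
      also have "real (card {i\<in>{1..n} - {i0}. dist (x i0) (x i) \<le> 2 * \<rho> * b}) = (\<Sum>i\<in>{1..n} - {i0}. near b (x i0) (x i))"
        unfolding near_def by (subst sum.inter_filter[symmetric]) simp_all
      also have "\<dots> \<le> U * D" using i0 by (intro g3) (simp add: H_def)
      finally show ?thesis using D by (simp add: distrib_right)
    qed
    have "\<bar>\<Sum>i\<in>J. loo_weight n b x i j\<bar> \<le> (\<Sum>i\<in>J. B / (q * D) * (if i \<noteq> j \<and> dist (x i) (x j) \<le> \<rho> * b then 1 else 0))"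
      by (rule order_trans[OF sum_abs]) (intro sum_mono w)
    also have "\<dots> = B / (q * D) * real (card H)"
      unfolding sum_distrib_left[symmetric] H_def using fJ by (subst sum.inter_filter[symmetric]) simp_all
    also have "\<dots> \<le> B / (q * D) * ((U + 1) * D)"
      using B_nonneg qD by (intro mult_left_mono cH) auto
    also have "\<dots> = B / q * (U + 1)" using D by simp
    finally show ?thesis .
  qed
qed

end

section \<open>Error bound for a regular design\<close>

lemma trimmed_density_eq:
  "trimmed_density S K b n x u e
    = (\<Sum>i\<in>{i\<in>{1..n}. x i \<in> S}. K ((u i - e) / b)) / (b * real (card {i\<in>{1..n}. x i \<in> S}))"
proof -
  have eq: "(\<Sum>i=1..n. indicator S (x i) * h i) = (\<Sum>i\<in>{i\<in>{1..n}. x i \<in> S}. h i)" for h :: "nat \<Rightarrow> real"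
  proof -
    have "(\<Sum>i=1..n. indicator S (x i) * h i) = (\<Sum>i\<in>{1..n}. if x i \<in> S then h i else 0)"
      by (intro sum.cong) (auto simp: indicator_def)
    also have "\<dots> = (\<Sum>i\<in>{i\<in>{1..n}. x i \<in> S}. h i)" by (rule sum.inter_filter[symmetric]) simp
    finally show ?thesis .
  qed
  then show ?thesis using eq[of "\<lambda>_. 1"] by (simp add: trimmed_density_def)
qed

context covariate_design begin

text \<open>Subtracting \<open>m (x i)\<close> from the regression estimate relies on weights that
  sum to one. A nonzero denominator guarantees this; with a zero denominator the estimate would
  default to zero.\<close>

lemma estimated_residual_eq:
  assumes s: "(\<Sum>j\<in>{1..n} - {i}. k b (x i) (x j)) \<noteq> 0"
  shows "estimated_residual K b n x (\<lambda>j. m (x j) + y j) i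
    = y i - loo_bias n b x i - (\<Sum>j\<in>{1..n}. loo_weight n b x i j * y j)"
proof -
  let ?s = "\<Sum>j\<in>{1..n} - {i}. k b (x i) (x j)"
  have k: "K ((x j - x i) /\<^sub>R b) = k b (x i) (x j)" for j by (simp add: k_def)
  have "(\<Sum>j\<in>{1..n} - {i}. (m (x j) + y j) * k b (x i) (x j))
      = (\<Sum>j\<in>{1..n} - {i}. w b (x i) (x j) + m (x i) * k b (x i) (x j) + k b (x i) (x j) * y j)"
    by (intro sum.cong refl) (simp add: w_def algebra_simps)
  also have "\<dots> = (\<Sum>j\<in>{1..n} - {i}. w b (x i) (x j)) + m (x i) * ?s + (\<Sum>j\<in>{1..n} - {i}. k b (x i) (x j) * y j)"
    by (simp add: sum.distrib sum_distrib_left)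
  finally have "regression_loo K b n x (\<lambda>j. m (x j) + y j) i
      = loo_bias n b x i + m (x i) + (\<Sum>j\<in>{1..n} - {i}. k b (x i) (x j) * y j) / ?s"
    unfolding regression_loo_def k loo_bias_def using s by (simp add: add_divide_distrib)
  also have "(\<Sum>j\<in>{1..n} - {i}. k b (x i) (x j) * y j) / ?s = (\<Sum>j\<in>{1..n} - {i}. loo_weight n b x i j * y j)"
    unfolding sum_divide_distrib by (intro sum.cong refl) (simp add: loo_weight_def)
  also have "\<dots> = (\<Sum>j\<in>{1..n}. loo_weight n b x i j * y j)"
    by (intro sum.mono_neutral_left) (auto simp: loo_weight_def)
  finally show ?thesis by (simp add: estimated_residual_def)
qed

end

text \<open>Two lower bounds with direct use: the squared order of the smoothing bias, and the order
  of the noise in the centred parts. The latter keeps \<open>b0^d / b1^3\<close> from the first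
  bracket and \<open>1 / (n * b0^d)\<close> from its companion.\<close>

lemma remainder_rate_ge:
  assumes "0 < b0" "0 < b1" "0 < n"
  shows "b0 ^ 4 \<le> remainder_rate d n b0 b1"
    and "1 / (real n * b0 ^ d) / (real n * b1 ^ 3) \<le> remainder_rate d n b0 b1"
proof -
  define v where "v = b0 ^ 4 + 1 / (real n * b0 ^ d)"
  define p where "p = 1 / (real n * b0 ^ d)"
  have p: "0 < p" "p \<le> v" using assms by (simp_all add: p_def v_def)
  have s: "0 \<le> sqrt (b0 ^ d / b1 ^ 3)" "0 \<le> 1 / sqrt (real n * b1 ^ 5)" using assms by simp_all
  define t1 where "t1 = (1 / sqrt (real n * b1 ^ 5) + sqrt (b0 ^ d / b1 ^ 3))\<^sup>2 * v\<^sup>2"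
  define t2 where "t2 = (1 / b1 + sqrt (b0 ^ d / b1 ^ 7))\<^sup>2 * v ^ 3"
  have eq: "remainder_rate d n b0 b1 = b0 ^ 4 + t1 + t2"
    by (simp add: remainder_rate_def t1_def t2_def v_def)
  have nn: "0 \<le> t1" "0 \<le> t2" using p by (simp_all add: t1_def t2_def)
  show "b0 ^ 4 \<le> remainder_rate d n b0 b1" using nn by (simp add: eq)
  have "b0 ^ d / b1 ^ 3 * p\<^sup>2 \<le> t1" unfolding t1_def
  proof (rule mult_mono)
    have "b0 ^ d / b1 ^ 3 = (sqrt (b0 ^ d / b1 ^ 3))\<^sup>2" using assms by simp
    also have "\<dots> \<le> (1 / sqrt (real n * b1 ^ 5) + sqrt (b0 ^ d / b1 ^ 3))\<^sup>2"
      using s by (intro power_mono) linarith+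
    finally show "b0 ^ d / b1 ^ 3 \<le> (1 / sqrt (real n * b1 ^ 5) + sqrt (b0 ^ d / b1 ^ 3))\<^sup>2" .
    show "p\<^sup>2 \<le> v\<^sup>2" using p by (intro power_mono) auto
  qed auto
  moreover have "b0 ^ d / b1 ^ 3 * p\<^sup>2 = 1 / (real n * b0 ^ d) / (real n * b1 ^ 3)"
    using assms by (simp add: p_def power2_eq_square)
  moreover have "0 \<le> b0 ^ 4" by simp
  ultimately show "1 / (real n * b0 ^ d) / (real n * b1 ^ 3) \<le> remainder_rate d n b0 b1"
    unfolding eq using nn by linarith
qed

text \<open>The two constants are obtained before \<open>n\<close>, the bandwidths and the design
  are introduced, so the bound is uniform over all regular designs, as a statement about stochastic
  order requires.\<close>

lemma design_error_bound:
  fixes g m :: "real^'d \<Rightarrow> real"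
  assumes cd: "covariate_design g m Gm S K0 r C c0 B0 \<rho>0 vol"
    and kd: "kernel_density f f' A L K1 B \<Lambda> \<rho>"
    and moment2: "integrable (density lborel (\<lambda>t. ennreal (f t))) (\<lambda>t. t\<^sup>2)"
    and centred: "(\<integral>t. t \<partial>density lborel (\<lambda>t. ennreal (f t))) = 0"
    and T: "0 < T" and U: "0 < U" and pS: "0 < measure (density lborel (\<lambda>x. ennreal (g x))) S"
  obtains Cm C\<phi> where "0 < Cm" "0 < C\<phi>"
    "\<And>n b0 b1 x \<phi>. n \<ge> 1 \<Longrightarrow> covariate_design.good g m S K0 c0 \<rho>0 T U n b0 x \<Longrightarrow>
      0 < b0 \<Longrightarrow> b0 \<le> 1 \<Longrightarrow> 0 < b1 \<Longrightarrow> b1 \<le> 1 \<Longrightarrow> 4 * \<rho> * A * b1 \<le> 1 \<Longrightarrow>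
      1 \<le> real n * b0 ^ (CARD('d) + 2) \<Longrightarrow> 1 \<le> real n * b1 ^ 3 \<Longrightarrow>
      \<phi> = (\<integral>y. (f_tilde S K1 b1 n x y e - f e)\<^sup>2 \<partial>PiM {1..n} (\<lambda>_. density lborel (\<lambda>t. ennreal (f t)))) \<Longrightarrow>
      integrable (PiM {1..n} (\<lambda>_. density lborel (\<lambda>t. ennreal (f t))))
        (\<lambda>y. \<bar>f_hat S K0 K1 b0 b1 n x (\<lambda>i. m (x i) + y i) e - f e\<bar>) \<and>
      (\<integral>y. \<bar>f_hat S K0 K1 b0 b1 n x (\<lambda>i. m (x i) + y i) e - f e\<bar>
        \<partial>PiM {1..n} (\<lambda>_. density lborel (\<lambda>t. ennreal (f t))))
        \<le> Cm * sqrt (\<phi> + remainder_rate CARD('d) n b0 b1) \<and>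
      0 \<le> \<phi> \<and> \<phi> \<le> C\<phi> * (b1 ^ 4 + 1 / (real n * b1))"
proof -
  interpret cd: covariate_design g m Gm S K0 r C c0 B0 \<rho>0 vol by (rule cd)
  interpret kd: kernel_density f f' A L K1 B \<Lambda> \<rho> by (rule kd)
  define p where "p = cd.prob S / 2"
  have p: "0 < p" using pS by (simp add: p_def)
  define q where "q = c0 / 8"
  have q: "0 < q" using cd.c0 by (simp add: q_def)
  define s2 where "s2 = (\<integral>t. t\<^sup>2 \<partial>kd.\<nu>)"
  have s2: "0 \<le> s2" unfolding s2_def by (intro Bochner_Integration.integral_nonneg) auto
  define cb where "cb = T / q"
  define cW where "cW = (B0 / q)\<^sup>2 * U"
  define cc where "cc = B0 / q * (U + 1)"
  define c2 where "c2 = 2 * \<rho> * (B * L)"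
  define c1 where "c1 = 4 * A * \<rho> * \<Lambda>\<^sup>2"
  define a0 where "a0 = sqrt (8 * L * \<rho> * (2 * \<rho> * (B\<^sup>2 * A)))"
  define a1 where "a1 = sqrt (16 * L * \<rho> * s2 * cc\<^sup>2 * (1 / p))"
  define a2 where "a2 = c2 * (cb\<^sup>2 + s2 * cW)"
  define a3 where "a3 = sqrt (c1 / p * (cb\<^sup>2 + 2 * s2 * cW))"
  define C1 where "C1 = 1 + a0 * cb + a1 + a2 + a3"
  define C\<phi> where "C\<phi> = (2 * \<rho> * (B * (L * \<rho>\<^sup>2)))\<^sup>2 + 2 * \<rho> * (B\<^sup>2 * A) / p + 1"
  have nn: "0 < cb" "0 \<le> cW" "0 \<le> cc" "0 \<le> c2" "0 \<le> c1"
    using T U q cd.B_nonneg kd.\<rho>_pos kd.B_nonneg kd.L_pos kd.A_nonneg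
    by (simp_all add: cb_def cW_def cc_def c2_def c1_def)
  have a: "0 \<le> a0" "0 \<le> a1" "0 \<le> a2" "0 \<le> a3"
    using nn s2 p kd.\<rho>_pos kd.B_nonneg kd.L_pos kd.A_nonneg by (simp_all add: a0_def a1_def a2_def a3_def)
  have C1: "1 \<le> C1" using a nn by (simp add: C1_def)
  have C\<phi>: "0 < C\<phi>" using kd.\<rho>_pos kd.A_nonneg p by (simp add: C\<phi>_def add_nonneg_pos)
  show thesis
  proof (rule that[of "2 * C1" C\<phi>])
    fix n :: nat and b0 b1 :: real and x :: "nat \<Rightarrow> real^'d" and \<phi> :: real
    assume n: "n \<ge> 1" and good: "cd.good T U n b0 x" and b0: "0 < b0" "b0 \<le> 1" and b1: "0 < b1" "b1 \<le> 1"
      and b1s: "4 * \<rho> * A * b1 \<le> 1" and nb0: "1 \<le> real n * b0 ^ (CARD('d) + 2)" and nb1: "1 \<le> real n * b1 ^ 3"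
      and \<phi>: "\<phi> = (\<integral>y. (f_tilde S K1 b1 n x y e - f e)\<^sup>2 \<partial>PiM {1..n} (\<lambda>_. kd.\<nu>))"
    define D where "D = real n * b0 ^ CARD('d)"
    have n0: "0 < real n" using n by simp
    \<comment> \<open>The condition \<open>1 \<le> n * b0^(d+2)\<close> says that the smoothing
      variance \<open>1 / D\<close> is at most \<open>b0\<^sup>2\<close>.\<close>
    have D: "1 \<le> D" "1 / D \<le> b0\<^sup>2"
    proof -
      have "1 \<le> D * b0\<^sup>2" using nb0 by (simp add: D_def power_add power2_eq_square mult_ac)
      moreover have "0 < D" using n0 b0 by (simp add: D_def)
      moreover have "D * b0\<^sup>2 \<le> D * 1" using b0 \<open>0 < D\<close> by (intro mult_left_mono power_le_one) auto
      ultimately show "1 \<le> D" "1 / D \<le> b0\<^sup>2" by (simp_all add: pos_divide_le_eq mult.commute)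
    qed
    define J where "J = {i\<in>{1..n}. x i \<in> S}"
    note gw = cd.good_weights[OF good b0(1) n D(1)[unfolded D_def] U T, folded J_def q_def p_def D_def]
    have card: "p * real n \<le> real (card J)" using gw(1) by (simp add: p_def)
    then have Np: "0 < real (card J)" using p n0 mult_pos_pos[of p "real n"] by linarith
    then have Jne: "J \<noteq> {}" by auto
    interpret ld: loo_design f f' A L K1 B \<Lambda> \<rho> "{1..n}" J "cd.loo_weight n b0 x" "cd.loo_bias n b0 x" b1 e
      by unfold_locales (use Jne b1 moment2 centred in \<open>auto simp: J_def cd.loo_weight_def\<close>)
    have ft: "f_tilde S K1 b1 n x y e = ld.ft y" for y
      unfolding f_tilde_def trimmed_density_eq ld.ft_def J_def[symmetric] ..
    have fh: "f_hat S K0 K1 b0 b1 n x (\<lambda>i. m (x i) + y i) e = ld.fh y" for y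
    proof -
      have res: "estimated_residual K0 b0 n x (\<lambda>i. m (x i) + y i) i = y i + ld.\<delta> i y" if i: "i \<in> J" for i
      proof -
        have "0 < q * D" using q D by simp
        then have ne: "(\<Sum>j\<in>{1..n} - {i}. cd.k b0 (x i) (x j)) \<noteq> 0" using gw(2)[OF i] by linarith
        show ?thesis unfolding cd.estimated_residual_eq[OF ne] ld.\<delta>_def by simp
      qed
      show ?thesis
        unfolding f_hat_def trimmed_density_eq ld.fh_def J_def[symmetric]
        by (intro arg_cong2[where f = "(/)"] sum.cong refl) (simp add: res)
    qed
    have \<phi>m: "\<phi> = ld.msq" unfolding \<phi> ft ld.msq_def ..
    have \<phi>0: "0 \<le> \<phi>" unfolding \<phi> by (intro Bochner_Integration.integral_nonneg) auto
    define R where "R = remainder_rate CARD('d) n b0 b1"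
    note Rge = remainder_rate_ge[OF b0(1) b1(1), of n "CARD('d)", folded R_def D_def]
    have R1: "b0 ^ 4 \<le> R" using Rge(1) n by simp
    have R2: "1 / D / (real n * b1 ^ 3) \<le> R" using Rge(2) n by simp
    have R0: "0 \<le> R" using R1 zero_le_power[of b0 4] b0 by linarith
    \<comment> \<open>Terms that are linear in the bias are only of order \<open>b0\<^sup>2\<close>;
      this is exactly the square root of the first term of the rate.\<close>
    have b0R: "b0\<^sup>2 \<le> sqrt R"
      using R1 by (intro real_le_rsqrt) (simp add: power_mult[symmetric])
    have bound: "integrable (PiM {1..n} (\<lambda>_. kd.\<nu>)) (\<lambda>y. \<bar>ld.fh y - f e\<bar>)"
      "(\<integral>y. \<bar>ld.fh y - f e\<bar> \<partial>PiM {1..n} (\<lambda>_. kd.\<nu>)) \<le> sqrt ld.msq + \<bar>kd.slope b1 e\<bar> * (cb * b0\<^sup>2)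
      + sqrt (16 * L * \<rho> * s2 * cc\<^sup>2 * (1 / p) * b1 * ld.msq) + c2 * ((cb * b0\<^sup>2)\<^sup>2 + s2 * (cW / D))
      + sqrt (ld.c1 * ((cb * b0\<^sup>2)\<^sup>2 + 2 * s2 * (cW / D)) / real (card J)) / b1"
    proof -
      have k: "real (card {1..n}) \<le> 1 / p * real (card J)"
        using card p by (simp add: field_simps)
      note i = ld.integral_abs_error_le[of "cb * b0\<^sup>2" "cW / D" cc "1 / p", OF _ _ _ k b1s]
      have g: "\<And>i. i \<in> J \<Longrightarrow> \<bar>cd.loo_bias n b0 x i\<bar> \<le> cb * b0\<^sup>2"
        "\<And>i. i \<in> J \<Longrightarrow> (\<Sum>j\<in>{1..n}. (cd.loo_weight n b0 x i j)\<^sup>2) \<le> cW / D"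
        "\<And>j. j \<in> {1..n} \<Longrightarrow> \<bar>\<Sum>i\<in>J. cd.loo_weight n b0 x i j\<bar> \<le> cc"
        unfolding cb_def cW_def cc_def by (fact gw(3), fact gw(4), fact gw(5))
      show "integrable (PiM {1..n} (\<lambda>_. kd.\<nu>)) (\<lambda>y. \<bar>ld.fh y - f e\<bar>)" by (rule i(1)[OF g])
      show "(\<integral>y. \<bar>ld.fh y - f e\<bar> \<partial>PiM {1..n} (\<lambda>_. kd.\<nu>)) \<le> sqrt ld.msq + \<bar>kd.slope b1 e\<bar> * (cb * b0\<^sup>2)
      + sqrt (16 * L * \<rho> * s2 * cc\<^sup>2 * (1 / p) * b1 * ld.msq) + c2 * ((cb * b0\<^sup>2)\<^sup>2 + s2 * (cW / D))
      + sqrt (ld.c1 * ((cb * b0\<^sup>2)\<^sup>2 + 2 * s2 * (cW / D)) / real (card J)) / b1"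
        unfolding s2_def c2_def by (rule i(2)[OF g])
    qed
    have t1: "\<bar>kd.slope b1 e\<bar> * (cb * b0\<^sup>2) \<le> a0 * cb * sqrt R"
    proof -
      have "(kd.slope b1 e)\<^sup>2 \<le> 8 * L * \<rho> * (2 * \<rho> * (B\<^sup>2 * A))"
      proof -
        have "8 * L * \<rho> * kd.V b1 e \<le> 8 * L * \<rho> * (2 * \<rho> * (B\<^sup>2 * A))"
          using kd.L_pos kd.\<rho>_pos by (intro mult_left_mono kd.V_le) auto
        then show ?thesis using kd.slope_square_le[of b1 e] by linarith
      qed
      then have "\<bar>kd.slope b1 e\<bar> \<le> a0" unfolding a0_def by (intro real_le_rsqrt) (simp only: power2_abs)
      then have "\<bar>kd.slope b1 e\<bar> * (cb * b0\<^sup>2) \<le> a0 * (cb * sqrt R)"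
        using nn b0R a by (intro mult_mono mult_left_mono) auto
      then show ?thesis by (simp only: mult.assoc)
    qed
    have t2: "sqrt (16 * L * \<rho> * s2 * cc\<^sup>2 * (1 / p) * b1 * ld.msq) \<le> a1 * sqrt \<phi>"
    proof -
      have k0: "0 \<le> 16 * L * \<rho> * s2 * cc\<^sup>2 * (1 / p)" using kd.L_pos kd.\<rho>_pos s2 p by simp
      have "16 * L * \<rho> * s2 * cc\<^sup>2 * (1 / p) * b1 * \<phi> \<le> 16 * L * \<rho> * s2 * cc\<^sup>2 * (1 / p) * 1 * \<phi>"
        by (intro mult_right_mono mult_left_mono b1 k0 \<phi>0)
      then show ?thesis unfolding \<phi>m[symmetric] a1_def real_sqrt_mult[symmetric] by simp
    qed
    \<comment> \<open>The quadratic remainder has order \<open>b0^4 + 1 / D\<close>. Both summands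
      are at most \<open>b0\<^sup>2\<close>, hence at most \<open>sqrt R\<close>.\<close>
    have t3: "c2 * ((cb * b0\<^sup>2)\<^sup>2 + s2 * (cW / D)) \<le> a2 * sqrt R"
    proof -
      have "(b0\<^sup>2)\<^sup>2 \<le> b0\<^sup>2 * 1" unfolding power2_eq_square[of "b0\<^sup>2"] using b0 by (intro mult_left_mono power_le_one) auto
      then have "cb\<^sup>2 * (b0\<^sup>2)\<^sup>2 \<le> cb\<^sup>2 * sqrt R" using b0R by (intro mult_left_mono) auto
      moreover have "s2 * cW * (1 / D) \<le> s2 * cW * sqrt R" using D b0R s2 nn by (intro mult_left_mono) auto
      ultimately have "(cb * b0\<^sup>2)\<^sup>2 + s2 * (cW / D) \<le> (cb\<^sup>2 + s2 * cW) * sqrt R"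
        by (simp add: power_mult_distrib distrib_right)
      then show ?thesis unfolding a2_def mult.assoc using nn by (intro mult_left_mono)
    qed
    \<comment> \<open>Squaring the outer \<open>1 / b1\<close> and adding the power inside
      \<open>ld.c1\<close> gives \<open>Z / (n * b1^3)\<close>. The bias part of \<open>Z\<close> is
      absorbed by \<open>1 \<le> n * b1^3\<close>; the noise part is the second bound of
      \<open>remainder_rate_ge\<close>.\<close>
    have t4: "sqrt (ld.c1 * ((cb * b0\<^sup>2)\<^sup>2 + 2 * s2 * (cW / D)) / real (card J)) / b1 \<le> a3 * sqrt R"
    proof -
      define Z where "Z = (cb * b0\<^sup>2)\<^sup>2 + 2 * s2 * (cW / D)"
      have Z0: "0 \<le> Z" using s2 nn D by (simp add: Z_def)
      have "sqrt (ld.c1 * Z / real (card J)) / b1 = sqrt (ld.c1 * Z / real (card J) / b1\<^sup>2)"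
        using b1 by (simp only: real_sqrt_divide real_sqrt_abs abs_of_pos)
      also have "\<dots> \<le> sqrt (c1 / p * (cb\<^sup>2 + 2 * s2 * cW) * R)"
      proof (rule real_sqrt_le_mono)
        have "ld.c1 * Z / real (card J) / b1\<^sup>2 = c1 / b1 * Z / b1\<^sup>2 / real (card J)"
          by (simp add: ld.c1_def c1_def)
        also have "\<dots> \<le> c1 / b1 * Z / b1\<^sup>2 / (p * real n)"
          using card p n0 nn b1 Z0 Np by (intro divide_left_mono mult_pos_pos divide_nonneg_nonneg mult_nonneg_nonneg) auto
        also have "\<dots> = c1 / p * (Z / (real n * b1 ^ 3))"
          by (simp add: power2_eq_square power3_eq_cube)
        also have "\<dots> \<le> c1 / p * ((cb\<^sup>2 + 2 * s2 * cW) * R)"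
        proof (rule mult_left_mono)
          have "cb\<^sup>2 * (b0 ^ 4 / (real n * b1 ^ 3)) \<le> cb\<^sup>2 * R"
          proof (rule mult_left_mono)
            have "b0 ^ 4 / (real n * b1 ^ 3) \<le> b0 ^ 4 / 1" using nb1 b0 by (intro divide_left_mono) auto
            then show "b0 ^ 4 / (real n * b1 ^ 3) \<le> R" using R1 by simp
          qed simp
          moreover have "2 * s2 * cW * (1 / D / (real n * b1 ^ 3)) \<le> 2 * s2 * cW * R"
            using R2 s2 nn by (intro mult_left_mono) auto
          moreover have "Z / (real n * b1 ^ 3) = cb\<^sup>2 * (b0 ^ 4 / (real n * b1 ^ 3)) + 2 * s2 * cW * (1 / D / (real n * b1 ^ 3))"
            by (simp add: Z_def add_divide_distrib power_mult_distrib power_mult[symmetric])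
          ultimately show "Z / (real n * b1 ^ 3) \<le> (cb\<^sup>2 + 2 * s2 * cW) * R" by (simp add: distrib_right)
        qed (use nn p in simp)
        finally show "ld.c1 * Z / real (card J) / b1\<^sup>2 \<le> c1 / p * (cb\<^sup>2 + 2 * s2 * cW) * R" by (simp only: mult.assoc)
      qed
      finally show ?thesis unfolding Z_def a3_def real_sqrt_mult .
    qed
    have sq: "sqrt \<phi> \<le> sqrt (\<phi> + R)" "sqrt R \<le> sqrt (\<phi> + R)" using \<phi>0 R0 by simp_all
    have "(\<integral>y. \<bar>ld.fh y - f e\<bar> \<partial>PiM {1..n} (\<lambda>_. kd.\<nu>)) \<le> (1 + a1) * sqrt \<phi> + (a0 * cb + a2 + a3) * sqrt R"
      using bound(2) t1 t2 t3 t4 unfolding \<phi>m[symmetric] by (simp only: distrib_right mult_1_left)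
    also have "\<dots> \<le> (1 + a1) * sqrt (\<phi> + R) + (a0 * cb + a2 + a3) * sqrt (\<phi> + R)"
      using a nn sq by (intro add_mono mult_left_mono) auto
    also have "\<dots> = C1 * sqrt (\<phi> + R)" by (simp add: C1_def algebra_simps)
    also have "\<dots> \<le> 2 * C1 * sqrt (\<phi> + R)" using C1 \<phi>0 R0 by simp
    finally have main: "(\<integral>y. \<bar>ld.fh y - f e\<bar> \<partial>PiM {1..n} (\<lambda>_. kd.\<nu>)) \<le> 2 * C1 * sqrt (\<phi> + R)" .
    have "\<phi> \<le> (2 * \<rho> * (B * (L * (b1 * \<rho>)\<^sup>2)))\<^sup>2 + 2 * \<rho> * (B\<^sup>2 * A) / (b1 * real (card J))"
      unfolding \<phi>m by (rule ld.msq_le)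
    also have "(2 * \<rho> * (B * (L * (b1 * \<rho>)\<^sup>2)))\<^sup>2 = (2 * \<rho> * (B * (L * \<rho>\<^sup>2)))\<^sup>2 * b1 ^ 4"
      by (simp add: power_mult_distrib power_mult[symmetric])
    also have "2 * \<rho> * (B\<^sup>2 * A) / (b1 * real (card J)) \<le> 2 * \<rho> * (B\<^sup>2 * A) / (b1 * (p * real n))"
      using card p n0 b1 kd.\<rho>_pos kd.A_nonneg Np by (intro divide_left_mono mult_left_mono mult_pos_pos) auto
    also have "\<dots> = 2 * \<rho> * (B\<^sup>2 * A) / p * (1 / (real n * b1))" by simp
    also have "(2 * \<rho> * (B * (L * \<rho>\<^sup>2)))\<^sup>2 * b1 ^ 4 + 2 * \<rho> * (B\<^sup>2 * A) / p * (1 / (real n * b1))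
        \<le> C\<phi> * b1 ^ 4 + C\<phi> * (1 / (real n * b1))"
      using b1 n0 kd.\<rho>_pos kd.A_nonneg p by (intro add_mono mult_right_mono) (simp_all add: C\<phi>_def)
    finally have "\<phi> \<le> C\<phi> * (b1 ^ 4 + 1 / (real n * b1))" by (simp only: distrib_left)
    with bound(1) main \<phi>0
    show "integrable (PiM {1..n} (\<lambda>_. kd.\<nu>)) (\<lambda>y. \<bar>f_hat S K0 K1 b0 b1 n x (\<lambda>i. m (x i) + y i) e - f e\<bar>) \<and>
      (\<integral>y. \<bar>f_hat S K0 K1 b0 b1 n x (\<lambda>i. m (x i) + y i) e - f e\<bar> \<partial>PiM {1..n} (\<lambda>_. kd.\<nu>))
        \<le> 2 * C1 * sqrt (\<phi> + remainder_rate CARD('d) n b0 b1) \<and>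
      0 \<le> \<phi> \<and> \<phi> \<le> C\<phi> * (b1 ^ 4 + 1 / (real n * b1))"
      unfolding fh R_def by blast
  qed (use C1 C\<phi> in auto)
qed

section \<open>Conditioning on the design\<close>

text \<open>Events of the conditioning sigma-algebra are preimages under \<open>\<xi>\<close>, so
  the defining identity of the conditional expectation is Fubini for the product law. Boundedness of
  \<open>h\<close> supplies every integrability condition.\<close>

lemma (in prob_space) real_cond_exp_of_product_law:
  fixes h :: "'b \<times> 'c \<Rightarrow> real"
  assumes PQ: "prob_space P" "prob_space Q"
    and \<xi>: "\<xi> \<in> M \<rightarrow>\<^sub>M P" and \<eta>: "\<eta> \<in> M \<rightarrow>\<^sub>M Q"
    and law: "distr M (P \<Otimes>\<^sub>M Q) (\<lambda>\<omega>. (\<xi> \<omega>, \<eta> \<omega>)) = P \<Otimes>\<^sub>M Q"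
    and h: "h \<in> borel_measurable (P \<Otimes>\<^sub>M Q)" and bd: "\<And>z. \<bar>h z\<bar> \<le> C"
  shows "AE \<omega> in M. real_cond_exp M (vimage_algebra (space M) \<xi> P) (\<lambda>\<omega>. h (\<xi> \<omega>, \<eta> \<omega>)) \<omega> = (\<integral>y. h (\<xi> \<omega>, y) \<partial>Q)"
proof -
  interpret P: prob_space P by fact
  interpret Q: prob_space Q by fact
  interpret PQ: pair_prob_space P Q ..
  let ?F = "vimage_algebra (space M) \<xi> P"
  have \<xi>F: "\<xi> \<in> ?F \<rightarrow>\<^sub>M P" by (rule measurable_vimage_algebra1) (use measurable_space[OF \<xi>] in auto)
  have sub: "subalgebra M ?F"
    unfolding subalgebra_def using sets_vimage_algebra2[of \<xi> "space M" P] measurable_space[OF \<xi>] measurable_sets[OF \<xi>]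
    by auto
  interpret F: sigma_finite_subalgebra M ?F
    by (rule finite_measure_subalgebra_is_sigma_finite) (unfold_locales, rule sub)
  note pm = measurable_Pair[OF \<xi> \<eta>]
  define \<phi> where "\<phi> = (\<lambda>x. \<integral>y. h (x, y) \<partial>Q)"
  have \<phi>m: "\<phi> \<in> borel_measurable P"
    unfolding \<phi>_def using h by (intro Q.borel_measurable_lebesgue_integral) simp
  have C: "0 \<le> C" using bd[of undefined] by linarith
  have hi: "integrable (P \<Otimes>\<^sub>M Q) h" by (rule PQ.integrable_const_bound[of _ C]) (use bd h in auto)
  have hMi: "integrable M (\<lambda>\<omega>. h (\<xi> \<omega>, \<eta> \<omega>))"
    by (rule integrable_const_bound[of _ C]) (use bd measurable_compose[OF pm h] in auto)
  have \<phi>b: "\<bar>\<phi> x\<bar> \<le> C" for x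
  proof (cases "integrable Q (\<lambda>y. h (x, y))")
    case True
    have "(\<integral>y. \<bar>h (x, y)\<bar> \<partial>Q) \<le> C" using True bd by (intro Q.integral_le_const) auto
    then show ?thesis unfolding \<phi>_def by (rule order_trans[OF integral_abs_bound])
  next
    case False
    then show ?thesis using C by (simp add: \<phi>_def not_integrable_integral_eq)
  qed
  have \<phi>i: "integrable P \<phi>" by (rule P.integrable_const_bound[of _ C]) (use \<phi>b \<phi>m in auto)
  have \<phi>Mi: "integrable M (\<lambda>\<omega>. \<phi> (\<xi> \<omega>))"
    by (rule integrable_const_bound[of _ C]) (use \<phi>b measurable_compose[OF \<xi> \<phi>m] in auto)
  have lawP: "distr M P \<xi> = P"
  proof -
    have "distr M P \<xi> = distr (distr M (P \<Otimes>\<^sub>M Q) (\<lambda>\<omega>. (\<xi> \<omega>, \<eta> \<omega>))) P fst"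
      using pm by (subst distr_distr) (auto simp: comp_def)
    also have "\<dots> = P" unfolding law by (rule Q.distr_pair_fst)
    finally show ?thesis .
  qed
  have "AE \<omega> in M. real_cond_exp M ?F (\<lambda>\<omega>. h (\<xi> \<omega>, \<eta> \<omega>)) \<omega> = \<phi> (\<xi> \<omega>)"
  proof (rule F.real_cond_exp_charact[OF _ hMi \<phi>Mi])
    fix A assume "A \<in> sets ?F"
    then obtain A' where A': "A' \<in> sets P" "A = \<xi> -` A' \<inter> space M"
      using sets_vimage_algebra2[of \<xi> "space M" P] measurable_space[OF \<xi>] by auto
    have iA: "integrable (P \<Otimes>\<^sub>M Q) (\<lambda>z. indicator A' (fst z) * h z)"
      by (rule PQ.integrable_const_bound[of _ C]) (use bd h A' C in \<open>auto simp: indicator_def\<close>)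
    have "(\<integral>\<omega>\<in>A. h (\<xi> \<omega>, \<eta> \<omega>) \<partial>M) = (\<integral>\<omega>. (\<lambda>z. indicator A' (fst z) * h z) (\<xi> \<omega>, \<eta> \<omega>) \<partial>M)"
      unfolding set_lebesgue_integral_def
      by (intro Bochner_Integration.integral_cong) (auto simp: A' indicator_def)
    also have "\<dots> = (\<integral>z. indicator A' (fst z) * h z \<partial>(P \<Otimes>\<^sub>M Q))"
      using integral_distr[OF pm borel_measurable_integrable[OF iA]] by (simp add: law)
    also have "\<dots> = (\<integral>x. (\<integral>y. indicator A' x * h (x, y) \<partial>Q) \<partial>P)"
      using PQ.integral_fst'[OF iA] by simp
    also have "\<dots> = (\<integral>x. indicator A' x * \<phi> x \<partial>P)" by (simp add: \<phi>_def)
    also have "\<dots> = (\<integral>\<omega>. indicator A' (\<xi> \<omega>) * \<phi> (\<xi> \<omega>) \<partial>M)"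
    proof -
      have "(\<lambda>x. indicator A' x * \<phi> x) \<in> borel_measurable P" using A' \<phi>m by measurable
      from integral_distr[OF \<xi> this] show ?thesis by (simp add: lawP)
    qed
    also have "\<dots> = (\<integral>\<omega>\<in>A. \<phi> (\<xi> \<omega>) \<partial>M)"
      unfolding set_lebesgue_integral_def
      by (intro Bochner_Integration.integral_cong) (auto simp: A' indicator_def)
    finally show "(\<integral>\<omega>\<in>A. h (\<xi> \<omega>, \<eta> \<omega>) \<partial>M) = (\<integral>\<omega>\<in>A. \<phi> (\<xi> \<omega>) \<partial>M)" .
  qed (use measurable_compose[OF \<xi>F \<phi>m] in simp)
  then show ?thesis by (simp add: \<phi>_def)
qed

text \<open>The threshold depends on the design, so Markov's inequality is applied on each fibre,
  where it is a positive constant and cancels. Designs in \<open>N\<close> are given up entirely and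
  cost \<open>\<delta>1\<close>.\<close>

lemma (in prob_space) conditional_markov:
  fixes H :: "'b \<times> 'c \<Rightarrow> real" and \<psi> :: "'b \<Rightarrow> real"
  assumes PQ: "prob_space P" "prob_space Q"
    and \<xi>: "\<xi> \<in> M \<rightarrow>\<^sub>M P" and \<eta>: "\<eta> \<in> M \<rightarrow>\<^sub>M Q"
    and law: "distr M (P \<Otimes>\<^sub>M Q) (\<lambda>\<omega>. (\<xi> \<omega>, \<eta> \<omega>)) = P \<Otimes>\<^sub>M Q"
    and H: "H \<in> borel_measurable (P \<Otimes>\<^sub>M Q)" "\<And>z. 0 \<le> H z" and \<psi>: "\<psi> \<in> borel_measurable P"
    and N: "N \<in> sets P" "emeasure P N \<le> ennreal \<delta>1" and \<delta>: "0 < \<delta>2" "0 \<le> \<delta>1" and c: "0 < c"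
    and le: "\<And>x. x \<in> space P - N \<Longrightarrow> integrable Q (\<lambda>y. H (x, y)) \<and> (\<integral>y. H (x, y) \<partial>Q) \<le> c * \<psi> x \<and> 0 < \<psi> x"
  shows "{\<omega> \<in> space M. H (\<xi> \<omega>, \<eta> \<omega>) > c / \<delta>2 * \<psi> (\<xi> \<omega>)} \<in> events"
    and "prob {\<omega> \<in> space M. H (\<xi> \<omega>, \<eta> \<omega>) > c / \<delta>2 * \<psi> (\<xi> \<omega>)} \<le> \<delta>1 + \<delta>2"
proof -
  interpret P: prob_space P by fact
  interpret Q: prob_space Q by fact
  interpret PQ: pair_prob_space P Q ..
  note pm = measurable_Pair[OF \<xi> \<eta>]
  define A where "A = {z \<in> space (P \<Otimes>\<^sub>M Q). H z > c / \<delta>2 * \<psi> (fst z)}"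
  have A: "A \<in> sets (P \<Otimes>\<^sub>M Q)"
    unfolding A_def using H(1) measurable_compose[OF measurable_fst \<psi>] by measurable
  have eq: "{\<omega> \<in> space M. H (\<xi> \<omega>, \<eta> \<omega>) > c / \<delta>2 * \<psi> (\<xi> \<omega>)} = (\<lambda>\<omega>. (\<xi> \<omega>, \<eta> \<omega>)) -` A \<inter> space M"
    using measurable_space[OF \<xi>] measurable_space[OF \<eta>] by (auto simp: A_def space_pair_measure)
  show "{\<omega> \<in> space M. H (\<xi> \<omega>, \<eta> \<omega>) > c / \<delta>2 * \<psi> (\<xi> \<omega>)} \<in> events"
    unfolding eq by (rule measurable_sets[OF pm A])
  have "emeasure M {\<omega> \<in> space M. H (\<xi> \<omega>, \<eta> \<omega>) > c / \<delta>2 * \<psi> (\<xi> \<omega>)} = emeasure (P \<Otimes>\<^sub>M Q) A"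
    unfolding eq using emeasure_distr[OF pm A] by (simp add: law)
  also have "\<dots> = (\<integral>\<^sup>+x. emeasure Q (Pair x -` A) \<partial>P)" by (rule Q.emeasure_pair_measure_alt[OF A])
  \<comment> \<open>On exceptional designs the section has mass at most one, on all others at most
    \<open>\<delta>2\<close>.\<close>
  also have "\<dots> \<le> (\<integral>\<^sup>+x. indicator N x + ennreal \<delta>2 \<partial>P)"
  proof (rule nn_integral_mono)
    fix x assume x: "x \<in> space P"
    show "emeasure Q (Pair x -` A) \<le> indicator N x + ennreal \<delta>2"
    proof (cases "x \<in> N")
      case True
      then show ?thesis using Q.emeasure_le_1[of "Pair x -` A"] by (simp add: add_increasing2)
    next
      case False
      note l = le[of x] 
      have l1: "integrable Q (\<lambda>y. H (x, y))" "(\<integral>y. H (x, y) \<partial>Q) \<le> c * \<psi> x" "0 < \<psi> x" using l x False by auto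
      have t: "0 < c / \<delta>2 * \<psi> x" using c \<delta> l1 by simp
      have Aeq: "Pair x -` A \<subseteq> {y \<in> space Q. H (x, y) \<ge> c / \<delta>2 * \<psi> x}"
        by (auto simp: A_def space_pair_measure)
      have "emeasure Q (Pair x -` A) \<le> emeasure Q {y \<in> space Q. H (x, y) \<ge> c / \<delta>2 * \<psi> x}"
        by (rule emeasure_mono[OF Aeq]) (use borel_measurable_integrable[OF l1(1)] in measurable)
      also have "\<dots> = ennreal (Q.prob {y \<in> space Q. H (x, y) \<ge> c / \<delta>2 * \<psi> x})" by (rule Q.emeasure_eq_measure)
      also have "\<dots> \<le> ennreal ((\<integral>y. H (x, y) \<partial>Q) / (c / \<delta>2 * \<psi> x))"
        by (intro ennreal_leI integral_Markov_inequality_measure[OF l1(1) sets.empty_sets _ t]) (use H in auto)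
      also have "\<dots> \<le> ennreal \<delta>2"
      proof (rule ennreal_leI)
        have "(\<integral>y. H (x, y) \<partial>Q) / (c / \<delta>2 * \<psi> x) \<le> c * \<psi> x / (c / \<delta>2 * \<psi> x)"
          using t l1 by (intro divide_right_mono) auto
        also have "\<dots> = \<delta>2" using c l1 \<delta> by simp
        finally show "(\<integral>y. H (x, y) \<partial>Q) / (c / \<delta>2 * \<psi> x) \<le> \<delta>2" .
      qed
      finally show ?thesis using False by simp
    qed
  qed
  also have "\<dots> = emeasure P N + ennreal \<delta>2"
    using N by (subst nn_integral_add) (auto simp: P.emeasure_space_1)
  also have "\<dots> \<le> ennreal \<delta>1 + ennreal \<delta>2" by (intro add_right_mono N)
  also have "\<dots> = ennreal (\<delta>1 + \<delta>2)" using \<delta> by simp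
  finally show "prob {\<omega> \<in> space M. H (\<xi> \<omega>, \<eta> \<omega>) > c / \<delta>2 * \<psi> (\<xi> \<omega>)} \<le> \<delta>1 + \<delta>2"
    unfolding emeasure_eq_measure using \<delta> by (subst (asm) ennreal_le_iff) auto
qed

section \<open>Measurability, boundedness and finite dependence of the estimators\<close>

lemma f_hat_measurable:
  fixes m :: "real^'d \<Rightarrow> real"
  assumes [measurable]: "S \<in> sets borel" "K0 \<in> borel_measurable borel" "K1 \<in> borel_measurable borel" "m \<in> borel_measurable borel"
  shows "(\<lambda>z. f_hat S K0 K1 b0 b1 n (fst z) (\<lambda>i. m (fst z i) + snd z i) e)
    \<in> borel_measurable (PiM {1..n} (\<lambda>_. borel) \<Otimes>\<^sub>M PiM {1..n} (\<lambda>_. borel))" (is "_ \<in> borel_measurable ?M")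
proof -
  have x[measurable]: "(\<lambda>z. fst z i) \<in> ?M \<rightarrow>\<^sub>M borel" and y[measurable]: "(\<lambda>z. snd z i) \<in> ?M \<rightarrow>\<^sub>M borel"
    if "i \<in> {1..n}" for i using that by measurable
  have k: "(\<lambda>z. K0 ((fst z j - fst z i) /\<^sub>R b0)) \<in> borel_measurable ?M" if "i \<in> {1..n}" "j \<in> {1..n} - {i}" for i j
  proof -
    have "j \<in> {1..n}" using that by simp
    note [measurable] = x[OF that(1)] x[OF this]
    show ?thesis by measurable
  qed
  have r: "(\<lambda>z. m (fst z i) + snd z i) \<in> borel_measurable ?M" if "i \<in> {1..n}" for i
  proof -
    note [measurable] = x[OF that] y[OF that]
    show ?thesis by measurable
  qed
  have reg: "(\<lambda>z. regression_loo K0 b0 n (fst z) (\<lambda>i. m (fst z i) + snd z i) i) \<in> borel_measurable ?M" if "i \<in> {1..n}" for i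
    unfolding regression_loo_def using k[OF that] r
    by (intro borel_measurable_divide borel_measurable_sum borel_measurable_times) auto
  have res: "(\<lambda>z. K1 ((estimated_residual K0 b0 n (fst z) (\<lambda>i. m (fst z i) + snd z i) i - e) / b1)) \<in> borel_measurable ?M"
    if "i \<in> {1..n}" for i
  proof -
    note [measurable] = reg[OF that] r[OF that]
    show ?thesis unfolding estimated_residual_def by measurable
  qed
  have ind: "(\<lambda>z. indicator S (fst z i) :: real) \<in> borel_measurable ?M" if "i \<in> {1..n}" for i
  proof -
    note [measurable] = x[OF that]
    show ?thesis by measurable
  qed
  show ?thesis
    unfolding f_hat_def trimmed_density_def using res ind
    by (intro borel_measurable_divide borel_measurable_sum borel_measurable_times borel_measurable_const) auto
qed

lemma f_tilde_measurable:
  assumes [measurable]: "S \<in> sets borel" "K1 \<in> borel_measurable borel"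
  shows "(\<lambda>z. f_tilde S K1 b1 n (fst z) (snd z) e)
    \<in> borel_measurable (PiM {1..n} (\<lambda>_. borel) \<Otimes>\<^sub>M PiM {1..n} (\<lambda>_. borel))" (is "_ \<in> borel_measurable ?M")
proof -
  have x: "(\<lambda>z. indicator S (fst z i) :: real) \<in> borel_measurable ?M" and y: "(\<lambda>z. K1 ((snd z i - e) / b1)) \<in> borel_measurable ?M"
    if "i \<in> {1..n}" for i using that by measurable
  show ?thesis
    unfolding f_tilde_def trimmed_density_def using x y
    by (intro borel_measurable_divide borel_measurable_sum borel_measurable_times borel_measurable_const) auto
qed

lemma f_tilde_bounded:
  assumes K: "\<And>v. \<bar>K1 v\<bar> \<le> B" and b: "0 < b"
  shows "\<bar>f_tilde S K1 b n x y e\<bar> \<le> B / b"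
proof -
  define N where "N = (\<Sum>i=1..n. indicator S (x i) :: real)"
  have N: "0 \<le> N" unfolding N_def by (intro sum_nonneg) simp
  define Z where "Z = (\<Sum>i=1..n. indicator S (x i) * K1 ((y i - e) / b))"
  have "\<bar>Z\<bar> \<le> (\<Sum>i=1..n. indicator S (x i) * B)"
    unfolding Z_def by (rule order_trans[OF sum_abs]) (intro sum_mono, simp add: abs_mult mult_left_mono K)
  then have "\<bar>Z\<bar> \<le> N * B" unfolding N_def sum_distrib_right .
  moreover have "f_tilde S K1 b n x y e = Z / (b * N)" by (simp only: f_tilde_def trimmed_density_def N_def Z_def)
  moreover have "\<bar>b * N\<bar> = b * N" using b N by simp
  ultimately have "\<bar>f_tilde S K1 b n x y e\<bar> \<le> N * B / (b * N)"
    unfolding abs_divide using b N by (simp only: abs_divide) (intro divide_right_mono, auto)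
  \<comment> \<open>If no observation falls into \<open>S\<close>, the ratio takes its default value
    zero, which the bound covers.\<close>
  also have "\<dots> \<le> B / b" using b N order_trans[OF abs_ge_zero K] by (cases "N = 0") simp_all
  finally show ?thesis .
qed

lemma f_hat_cong:
  assumes "\<And>i. i \<in> {1..n} \<Longrightarrow> x i = x' i" "\<And>i. i \<in> {1..n} \<Longrightarrow> y i = y' i"
  shows "f_hat S K0 K1 b0 b1 n x y e = f_hat S K0 K1 b0 b1 n x' y' e"
  unfolding f_hat_def trimmed_density_def estimated_residual_def regression_loo_def
  using assms by (intro arg_cong2[where f = "(/)"] arg_cong2[where f = "(*)"] sum.cong refl
      arg_cong[where f = K1] arg_cong2[where f = "(-)"] arg_cong[where f = K0]
      arg_cong2[where f = scaleR] arg_cong[where f = "indicator S"]) auto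

lemma f_tilde_cong:
  assumes "\<And>i. i \<in> {1..n} \<Longrightarrow> x i = x' i" "\<And>i. i \<in> {1..n} \<Longrightarrow> y i = y' i"
  shows "f_tilde S K1 b1 n x y e = f_tilde S K1 b1 n x' y' e"
  unfolding f_tilde_def trimmed_density_def
  using assms by (intro arg_cong2[where f = "(/)"] arg_cong2[where f = "(*)"] sum.cong refl) auto

section \<open>Kernel and bandwidth conditions in usable form\<close>

lemma compactly_supported_C1:
  fixes K :: "real \<Rightarrow> real"
  assumes C: "continuously_differentiable k K" "2 \<le> k" and supp: "compact (closure {v. K v \<noteq> 0})"
  obtains B \<Lambda> \<rho> where "0 < \<rho>" "\<And>v. \<rho> < \<bar>v\<bar> \<Longrightarrow> K v = 0" "\<And>v. \<bar>K v\<bar> \<le> B"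
    "\<And>u v. \<bar>K u - K v\<bar> \<le> \<Lambda> * \<bar>u - v\<bar>" "continuous_on UNIV K"
proof -
  \<comment> \<open>Two orders of differentiability are taken: the derivative of \<open>K\<close> is
    itself differentiable, therefore continuous, therefore bounded on a compact interval.\<close>
  have d: "((deriv ^^ j) K) field_differentiable at x" if "j < 2" for j x
    using C that by (simp add: continuously_differentiable_def)
  have d0: "K field_differentiable at x" for x using d[of 0 x] by simp
  have d1: "deriv K field_differentiable at x" for x using d[of 1 x] by simp
  have D: "(K has_field_derivative deriv K x) (at x)" for x
    using d0 by (simp add: field_differentiable_derivI)
  have c0: "continuous_on UNIV K"
    by (intro continuous_at_imp_continuous_on ballI field_differentiable_imp_continuous_at d0)
  have c1: "continuous_on UNIV (deriv K)"
    by (intro continuous_at_imp_continuous_on ballI field_differentiable_imp_continuous_at d1)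
  obtain R where R: "\<And>v. v \<in> closure {v. K v \<noteq> 0} \<Longrightarrow> norm v \<le> R"
    using compact_imp_bounded[OF supp] unfolding bounded_iff by blast
  \<comment> \<open>The maximum with one ensures a positive radius.\<close>
  define \<rho> where "\<rho> = max R 1"
  have z: "K v = 0" if "\<rho> < \<bar>v\<bar>" for v
  proof (rule ccontr)
    assume "K v \<noteq> 0"
    then have "norm v \<le> R" using closure_subset[of "{v. K v \<noteq> 0}"] by (intro R) auto
    then show False using that by (simp add: \<rho>_def)
  qed
  have z1: "deriv K v = 0" if v: "\<rho> < \<bar>v\<bar>" for v
  proof (rule DERIV_imp_deriv)
    have "open {v :: real. \<rho> < \<bar>v\<bar>}" by (intro open_Collect_less continuous_intros)
    then show "(K has_field_derivative 0) (at v)"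
      by (rule has_field_derivative_transform_within_open[OF DERIV_const[of 0]]) (use v z in auto)
  qed
  have bd: "\<exists>B. \<forall>v. \<bar>h v\<bar> \<le> B" if c: "continuous_on UNIV h" and hz: "\<And>v. \<rho> < \<bar>v\<bar> \<Longrightarrow> h v = 0" for h :: "real \<Rightarrow> real"
  proof -
    have "bounded (h ` {-\<rho>..\<rho>})"
      by (intro compact_imp_bounded compact_continuous_image continuous_on_subset[OF c]) auto
    then obtain B where B: "\<And>v. v \<in> {-\<rho>..\<rho>} \<Longrightarrow> \<bar>h v\<bar> \<le> B" unfolding bounded_iff by (metis image_eqI real_norm_def)
    have "\<bar>h v\<bar> \<le> max B 0" for v
    proof (cases "\<rho> < \<bar>v\<bar>")
      case True
      then show ?thesis by (simp add: hz)
    next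
      case False
      then have "\<bar>h v\<bar> \<le> B" by (intro B) auto
      then show ?thesis by simp
    qed
    then show ?thesis by blast
  qed
  obtain B where B: "\<And>v. \<bar>K v\<bar> \<le> B" using bd[OF c0 z] by blast
  obtain \<Lambda> where \<Lambda>: "\<And>v. \<bar>deriv K v\<bar> \<le> \<Lambda>" using bd[OF c1 z1] by blast
  have "\<bar>K u - K v\<bar> \<le> \<Lambda> * \<bar>u - v\<bar>" for u v
    using field_differentiable_bound[of UNIV K "deriv K" \<Lambda> u v] D \<Lambda> by (auto simp: has_field_derivative_at_within)
  then show thesis using z B c0 by (intro that[of \<rho> B \<Lambda>]) (auto simp: \<rho>_def)
qed

text \<open>Once \<open>b0 n < 1\<close>, lowering the exponent from \<open>D\<close> to
  \<open>k\<close> only increases the power, so the rate condition at the larger exponent covers all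
  smaller ones.\<close>

lemma bandwidth_large:
  fixes b0 :: "nat \<Rightarrow> real"
  assumes pos: "\<And>n. n \<ge> 1 \<Longrightarrow> 0 < b0 n" and lim: "b0 \<longlonglongrightarrow> 0"
    and rate: "filterlim (\<lambda>n. real n * b0 n ^ D / ln (real n)) at_top sequentially" and k: "k \<le> D"
  shows "\<forall>\<^sub>F n in sequentially. c * ln (real n) \<le> real n * b0 n ^ k"
proof -
  have "\<forall>\<^sub>F n in sequentially. b0 n < 1" using order_tendstoD(2)[OF lim, of 1] by simp
  moreover have "\<forall>\<^sub>F n in sequentially. c \<le> real n * b0 n ^ D / ln (real n)"
    using rate by (simp add: filterlim_at_top)
  moreover have "\<forall>\<^sub>F n in sequentially. n \<ge> 2" by (rule eventually_ge_at_top)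
  ultimately show ?thesis
  proof eventually_elim
    case (elim n)
    have "0 < ln (real n)" using elim(3) by simp
    then have "c * ln (real n) \<le> real n * b0 n ^ D" using elim(2) by (simp add: pos_le_divide_eq)
    also have "\<dots> \<le> real n * b0 n ^ k"
      using elim(1,3) pos[of n] k by (intro mult_left_mono power_decreasing) auto
    finally show ?case .
  qed
qed

text \<open>The union bound has a factor \<open>n\<close>, so every single failure must be
  \<open>o(1 / n)\<close>. Growth faster than \<open>ln n\<close> in the exponent provides
  this.\<close>

lemma design_failure_small:
  fixes b0 :: "nat \<Rightarrow> real"
  assumes pos: "\<And>n. n \<ge> 1 \<Longrightarrow> 0 < b0 n" and lim: "b0 \<longlonglongrightarrow> 0"
    and rate: "filterlim (\<lambda>n. real n * b0 n ^ D / ln (real n)) at_top sequentially" and k: "k \<le> D"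
    and \<tau>: "0 < \<tau>" and p: "0 < p" and \<delta>: "0 < \<delta>"
  shows "\<forall>\<^sub>F n in sequentially. exp (- (p * real n)) + real n * (4 * exp (- (\<tau> * (real n * b0 n ^ k)))) \<le> \<delta>"
proof -
  have "\<forall>\<^sub>F n in sequentially. real n \<ge> (1 / p + 4) / \<delta>"
    using filterlim_real_sequentially by (simp add: filterlim_at_top)
  moreover have "\<forall>\<^sub>F n in sequentially. n \<ge> 1" by (rule eventually_ge_at_top)
  \<comment> \<open>The constant \<open>2 / \<tau>\<close> turns the exponential into
    \<open>n^(-2)\<close>, and the total over all indices into \<open>4 / n\<close>.\<close>
  moreover have "\<forall>\<^sub>F n in sequentially. 2 / \<tau> * ln (real n) \<le> real n * b0 n ^ k"
    by (rule bandwidth_large[OF pos lim rate k])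
  ultimately show ?thesis
  proof eventually_elim
    case (elim n)
    have n: "0 < real n" using elim(2) by simp
    have "exp (- (\<tau> * (real n * b0 n ^ k))) \<le> exp (- (2 * ln (real n)))"
      using elim(3) \<tau> by (simp add: pos_divide_le_eq mult.commute)
    also have "\<dots> = 1 / (real n)\<^sup>2"
    proof -
      have "exp (2 * ln (real n)) = (real n)\<^sup>2" using n by (simp add: exp_double)
      then show ?thesis by (simp add: exp_minus field_simps)
    qed
    finally have "real n * (4 * exp (- (\<tau> * (real n * b0 n ^ k)))) \<le> real n * (4 * (1 / (real n)\<^sup>2))"
      using n by (intro mult_left_mono) auto
    also have "\<dots> = 4 / real n" using n by (simp add: power2_eq_square)
    finally have 1: "real n * (4 * exp (- (\<tau> * (real n * b0 n ^ k)))) \<le> 4 / real n" .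
    have "p * real n \<le> exp (p * real n)" using exp_ge_add_one_self[of "p * real n"] by linarith
    then have "exp (- (p * real n)) \<le> 1 / (p * real n)"
      unfolding exp_minus inverse_eq_divide using n p by (intro divide_left_mono) auto
    then have "exp (- (p * real n)) + real n * (4 * exp (- (\<tau> * (real n * b0 n ^ k)))) \<le> (1 / p + 4) / real n"
      using 1 n p by (simp add: add_divide_distrib)
    also have "\<dots> \<le> \<delta>" using elim(1) n \<delta> by (simp add: pos_divide_le_eq mult.commute)
    finally show ?case .
  qed
qed

text \<open>As \<open>3 * (d + 8) \<le> 7 * (d + 4)\<close> and \<open>b1 n < 1\<close>, the rate
  condition bounds the power \<open>d + 8\<close> of \<open>n * b1^3\<close> from below by one, and
  hence the base as well.\<close>

lemma second_bandwidth_large: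
  fixes b1 :: "nat \<Rightarrow> real"
  assumes pos: "\<And>n. n \<ge> 1 \<Longrightarrow> 0 < b1 n" and lim: "b1 \<longlonglongrightarrow> 0"
    and rate: "filterlim (\<lambda>n. real n ^ (d + 8) * b1 n ^ (7 * (d + 4))) at_top sequentially"
  shows "\<forall>\<^sub>F n in sequentially. 1 \<le> real n * b1 n ^ 3"
proof -
  have "\<forall>\<^sub>F n in sequentially. b1 n < 1" using order_tendstoD(2)[OF lim, of 1] by simp
  moreover have "\<forall>\<^sub>F n in sequentially. 1 \<le> real n ^ (d + 8) * b1 n ^ (7 * (d + 4))"
    using rate by (simp add: filterlim_at_top)
  moreover have "\<forall>\<^sub>F n in sequentially. n \<ge> 1" by (rule eventually_ge_at_top)
  ultimately show ?thesis
  proof eventually_elim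
    case (elim n)
    have b: "0 < b1 n" using pos elim(3) by simp
    have "1 \<le> real n ^ (d + 8) * b1 n ^ (7 * (d + 4))" by (rule elim(2))
    also have "\<dots> \<le> real n ^ (d + 8) * b1 n ^ (3 * (d + 8))"
      using elim b by (intro mult_left_mono power_decreasing) auto
    also have "\<dots> = (real n * b1 n ^ 3) ^ (d + 8)" by (simp only: power_mult_distrib power_mult)
    finally have ge: "1 \<le> (real n * b1 n ^ 3) ^ (d + 8)" .
    show ?case
    proof (rule ccontr)
      assume "\<not> 1 \<le> real n * b1 n ^ 3"
      then have "(real n * b1 n ^ 3) ^ (d + 8) < 1 ^ (d + 8)" using b by (intro power_strict_mono) auto
      with ge show False by simp
    qed
  qed
qed

text \<open>The error is a fixed measurable function of the pair \<open>(X, Y)\<close>, so the pairs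
  of covariate and error inherit independence and identical laws over the indices. Independence
  inside a pair is given by sigma-algebras and is checked on rectangles.\<close>

lemma (in prob_space) regression_sample_law:
  fixes X :: "nat \<Rightarrow> 'a \<Rightarrow> real^'d" and Y eps :: "nat \<Rightarrow> 'a \<Rightarrow> real" and m :: "real^'d \<Rightarrow> real"
  assumes indep: "indep_vars (\<lambda>_. borel) (\<lambda>i \<omega>. (X i \<omega>, Y i \<omega>)) UNIV"
    and ident: "\<And>i. distr M borel (\<lambda>\<omega>. (X i \<omega>, Y i \<omega>)) = distr M borel (\<lambda>\<omega>. (X 0 \<omega>, Y 0 \<omega>))"
    and m: "m \<in> borel_measurable borel" and eps: "\<And>i \<omega>. Y i \<omega> = m (X i \<omega>) + eps i \<omega>"
    and eps_indep: "\<And>i. indep_set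
      (sets (vimage_algebra (space M) (eps i) borel)) (sets (vimage_algebra (space M) (X i) borel))"
    and X0: "distr M borel (X 0) = \<mu>" and E0: "distr M borel (eps 0) = \<nu>"
    and I: "finite I" "I \<noteq> {}"
  shows "\<And>i. X i \<in> borel_measurable M" "\<And>i. eps i \<in> borel_measurable M"
    and "distr M (PiM I (\<lambda>_. borel) \<Otimes>\<^sub>M PiM I (\<lambda>_. borel)) (\<lambda>\<omega>. (\<lambda>i\<in>I. X i \<omega>, \<lambda>i\<in>I. eps i \<omega>))
      = PiM I (\<lambda>_. \<mu>) \<Otimes>\<^sub>M PiM I (\<lambda>_. \<nu>)"
proof -
  have XY: "(\<lambda>\<omega>. (X i \<omega>, Y i \<omega>)) \<in> borel_measurable M" for i
    using indep by (simp add: indep_vars_def)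
  have e: "eps i = (\<lambda>\<omega>. Y i \<omega> - m (X i \<omega>))" for i using eps by auto
  have X: "X i \<in> borel_measurable M" and Y: "Y i \<in> borel_measurable M" for i
    using measurable_compose[OF XY borel_measurable_continuous_onI[OF continuous_on_fst[OF continuous_on_id]], of i]
      measurable_compose[OF XY borel_measurable_continuous_onI[OF continuous_on_snd[OF continuous_on_id]], of i] by simp_all
  show Xm: "X i \<in> borel_measurable M" for i by (rule X)
  show Em: "eps i \<in> borel_measurable M" for i
    unfolding e using X Y m by measurable
  define \<Psi> where "\<Psi> = (\<lambda>p :: (real^'d) \<times> real. (fst p, snd p - m (fst p)))"
  have fm: "(fst :: (real^'d) \<times> real \<Rightarrow> _) \<in> borel_measurable borel" and sm: "(snd :: (real^'d) \<times> real \<Rightarrow> _) \<in> borel_measurable borel"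
    by (intro borel_measurable_continuous_onI continuous_intros)+
  have em: "(\<lambda>p :: (real^'d) \<times> real. snd p - m (fst p)) \<in> borel_measurable borel"
    using fm sm m by measurable
  have \<Psi>m: "\<Psi> \<in> borel \<rightarrow>\<^sub>M borel \<Otimes>\<^sub>M borel" unfolding \<Psi>_def using fm em by (rule measurable_Pair)
  have dX: "distr M borel (X i) = \<mu>" for i
  proof -
    have "distr M borel (X i) = distr (distr M borel (\<lambda>\<omega>. (X i \<omega>, Y i \<omega>))) borel fst"
      by (subst distr_distr[OF fm XY]) (simp add: comp_def)
    also have "\<dots> = distr (distr M borel (\<lambda>\<omega>. (X 0 \<omega>, Y 0 \<omega>))) borel fst" by (simp only: ident[of i])
    also have "\<dots> = distr M borel (X 0)" by (subst distr_distr[OF fm XY]) (simp add: comp_def)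
    finally show ?thesis using X0 by simp
  qed
  have dE: "distr M borel (eps i) = \<nu>" for i
  proof -
    have "distr M borel (eps i) = distr (distr M borel (\<lambda>\<omega>. (X i \<omega>, Y i \<omega>))) borel (\<lambda>p. snd p - m (fst p))"
      by (subst distr_distr[OF em XY]) (simp add: comp_def e)
    also have "\<dots> = distr (distr M borel (\<lambda>\<omega>. (X 0 \<omega>, Y 0 \<omega>))) borel (\<lambda>p. snd p - m (fst p))" by (simp only: ident[of i])
    also have "\<dots> = distr M borel (eps 0)" by (subst distr_distr[OF em XY]) (simp add: comp_def e)
    finally show ?thesis using E0 by simp
  qed
  have iv: "indep_vars (\<lambda>_. borel \<Otimes>\<^sub>M borel) (\<lambda>i \<omega>. (X i \<omega>, eps i \<omega>)) I"
  proof -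
    have "indep_vars (\<lambda>_. borel \<Otimes>\<^sub>M borel) (\<lambda>i \<omega>. \<Psi> (X i \<omega>, Y i \<omega>)) I"
      by (rule indep_vars_compose2[OF indep_vars_subset[OF indep]]) (use \<Psi>m in auto)
    then show ?thesis by (simp add: \<Psi>_def e)
  qed
  have ps: "prob_space \<mu>" "prob_space \<nu>"
    using prob_space_distr[OF Xm[of 0]] prob_space_distr[OF Em[of 0]] X0 E0 by simp_all
  have pair: "distr M (borel \<Otimes>\<^sub>M borel) (\<lambda>\<omega>. (X i \<omega>, eps i \<omega>)) = \<mu> \<Otimes>\<^sub>M \<nu>" for i
  proof -
    interpret \<mu>: prob_space \<mu> by (rule ps)
    interpret \<nu>: prob_space \<nu> by (rule ps)
    have m2: "(\<lambda>\<omega>. (X i \<omega>, eps i \<omega>)) \<in> M \<rightarrow>\<^sub>M borel \<Otimes>\<^sub>M borel" using Xm Em by (rule measurable_Pair)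
    have "\<mu> \<Otimes>\<^sub>M \<nu> = distr M (borel \<Otimes>\<^sub>M borel) (\<lambda>\<omega>. (X i \<omega>, eps i \<omega>))"
    proof (rule pair_measure_eqI)
      fix A B assume AB: "A \<in> sets \<mu>" "B \<in> sets \<nu>"
      then have AB': "A \<in> sets borel" "B \<in> sets borel" using X0 E0 by auto
      define a where "a = X i -` A \<inter> space M"
      define b where "b = eps i -` B \<inter> space M"
      have "a \<in> sets (vimage_algebra (space M) (X i) borel)" "b \<in> sets (vimage_algebra (space M) (eps i) borel)"
        unfolding a_def b_def by (intro in_vimage_algebra AB')+
      then have "prob (b \<inter> a) = prob b * prob a" using eps_indep[of i] unfolding indep_sets2_eq by blast
      then have "emeasure M (b \<inter> a) = emeasure M b * emeasure M a"
        by (simp add: emeasure_eq_measure ennreal_mult)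
      moreover have "emeasure \<mu> A = emeasure M a" "emeasure \<nu> B = emeasure M b"
        unfolding dX[of i, symmetric] dE[of i, symmetric] a_def b_def
        by (intro emeasure_distr Xm Em AB')+
      moreover have "emeasure (distr M (borel \<Otimes>\<^sub>M borel) (\<lambda>\<omega>. (X i \<omega>, eps i \<omega>))) (A \<times> B) = emeasure M (b \<inter> a)"
        using AB' by (subst emeasure_distr[OF m2]) (auto simp: a_def b_def intro!: arg_cong2[where f = emeasure])
      ultimately show "emeasure \<mu> A * emeasure \<nu> B = emeasure (distr M (borel \<Otimes>\<^sub>M borel) (\<lambda>\<omega>. (X i \<omega>, eps i \<omega>))) (A \<times> B)"
        by (simp add: mult.commute)
    qed (use X0 E0 in \<open>auto intro!: sets_pair_measure_cong \<mu>.sigma_finite_measure_axioms \<nu>.sigma_finite_measure_axioms\<close>)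
    then show ?thesis ..
  qed
  show "distr M (PiM I (\<lambda>_. borel) \<Otimes>\<^sub>M PiM I (\<lambda>_. borel)) (\<lambda>\<omega>. (\<lambda>i\<in>I. X i \<omega>, \<lambda>i\<in>I. eps i \<omega>))
      = PiM I (\<lambda>_. \<mu>) \<Otimes>\<^sub>M PiM I (\<lambda>_. \<nu>)"
    using X0 E0 by (intro distr_sample_pair[OF I iv pair ps]) auto
qed

section \<open>Passage from regular designs to stochastic orders\<close>

theorem theorem3p1:
  fixes M :: "'w measure"
    and X :: "nat \<Rightarrow> 'w \<Rightarrow> real^'d"
    and Y eps :: "nat \<Rightarrow> 'w \<Rightarrow> real"
    and m g :: "real^'d \<Rightarrow> real"
    and f :: "real \<Rightarrow> real"
    and supp X0 :: "(real^'d) set"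
    and K0 :: "real^'d \<Rightarrow> real"
    and K1 :: "real \<Rightarrow> real"
    and b0 b1 :: "nat \<Rightarrow> real"
    and e :: real
  assumes prob: "prob_space M"
    \<comment> \<open>index 0 is the generic copy (X,Y); indices 1, 2, ... are the sample\<close>
    and indep: "prob_space.indep_vars M (\<lambda>_. borel) (\<lambda>i \<omega>. (X i \<omega>, Y i \<omega>)) UNIV"
    and ident: "\<And>i. distr M borel (\<lambda>\<omega>. (X i \<omega>, Y i \<omega>)) = distr M borel (\<lambda>\<omega>. (X 0 \<omega>, Y 0 \<omega>))"
    and Y_int: "integrable M (Y 0)"
    and m_meas: "m \<in> borel_measurable borel"
    and m_cond: "AE \<omega> in M.
      real_cond_exp M (vimage_algebra (space M) (X 0) borel) (Y 0) \<omega> = m (X 0 \<omega>)"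
    and eps: "\<And>i \<omega>. Y i \<omega> = m (X i \<omega>) + eps i \<omega>"
    and supp: "supp = law_support M (X 0)"
    and supp_compact: "compact supp"
    and X0: "closed X0" "X0 \<subseteq> interior supp" "interior X0 \<noteq> {}"
    and g_nonneg: "\<And>x. 0 \<le> g x"
    and g_pdf: "distributed M lborel (X 0) (\<lambda>x. ennreal (g x))"
    and g_pos: "\<And>x. x \<in> X0 \<Longrightarrow> 0 < g x"
    and g_C2: "continuous_second_partials_on supp g"
    and m_C2: "continuous_second_partials_on supp m"
    and eps_moment: "integrable M (\<lambda>\<omega>. eps 0 \<omega> ^ 6)"
    and eps_centered: "integral\<^sup>L M (eps 0) = 0"
    and eps_indep: "\<And>i. prob_space.indep_set M
      (sets (vimage_algebra (space M) (eps i) borel)) (sets (vimage_algebra (space M) (X i) borel))"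
    and f_nonneg: "\<And>t. 0 \<le> f t"
    and f_pdf: "distributed M lborel (eps 0) (\<lambda>t. ennreal (f t))"
    and f_C2: "continuously_differentiable 2 f" "bounded (range (deriv (deriv f)))"
    and h_bounded: "\<And>p k :: nat. p \<le> 2 \<Longrightarrow> k \<le> 2 \<Longrightarrow>
      bounded (range ((deriv ^^ k) (\<lambda>t. t ^ p * f t)))"
    and K0_sym: "\<And>z. K0 (- z) = K0 z"
    and K0_cont: "continuous_on UNIV K0"
    and K0_supp: "closure {z. K0 z \<noteq> 0} \<subseteq> {z. \<forall>i. -1/2 \<le> z $ i \<and> z $ i \<le> 1/2}"
    and K0_int: "(LINT z|lborel. K0 z) = 1"
    and K1_supp: "compact (closure {v. K1 v \<noteq> 0})"
    and K1_C3: "continuously_differentiable 3 K1"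
    and K1_int: "(LINT v|lborel. K1 v) = 1"
    and K1_first: "(LINT v|lborel. v * K1 v) = 0"
    and b0_pos: "\<And>n. n \<ge> 1 \<Longrightarrow> 0 < b0 n"
    and b0_decr: "antimono_on {1..} b0" "b0 \<longlonglongrightarrow> 0"
    and b0_rate: "filterlim (\<lambda>n. real n * b0 n ^ max (CARD('d) + 2) (2 * CARD('d)) / ln (real n))
      at_top sequentially"
    and b0_log: "filterlim (\<lambda>n. ln (1 / b0 n) / ln (ln (real n))) at_top sequentially"
    and b1_pos: "\<And>n. n \<ge> 1 \<Longrightarrow> 0 < b1 n"
    and b1_decr: "antimono_on {1..} b1" "b1 \<longlonglongrightarrow> 0"
    and b1_rate: "filterlim (\<lambda>n. real n ^ (CARD('d) + 8) * b1 n ^ (7 * (CARD('d) + 4)))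
      at_top sequentially"
  shows "bigO_prob M
      (\<lambda>n \<omega>. f_hat X0 K0 K1 (b0 n) (b1 n) n (\<lambda>i. X i \<omega>) (\<lambda>i. Y i \<omega>) e - f e)
      (\<lambda>n \<omega>. sqrt (amse M X0 K1 X eps f e (b1 n) n \<omega>
                    + remainder_rate CARD('d) n (b0 n) (b1 n)))
    \<and> bigO_prob M
      (\<lambda>n \<omega>. amse M X0 K1 X eps f e (b1 n) n \<omega>)
      (\<lambda>n \<omega>. b1 n ^ 4 + 1 / (real n * b1 n))"
proof -
  interpret prob_space M by (rule prob)
  let ?\<mu> = "density lborel (\<lambda>x. ennreal (g x))"
  let ?\<nu> = "density lborel (\<lambda>t. ennreal (f t))"
  let ?D = "max (CARD('d) + 2) (2 * CARD('d))"
  have dX0: "distr M borel (X 0) = ?\<mu>"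
    using distributed_distr_eq_density[OF g_pdf] by (simp cong: distr_cong)
  have dE0: "distr M borel (eps 0) = ?\<nu>"
    using distributed_distr_eq_density[OF f_pdf] by (simp cong: distr_cong)
  note law_n = regression_sample_law[OF indep ident m_meas eps eps_indep dX0 dE0]
  have Xm: "X i \<in> borel_measurable M" and Em: "eps i \<in> borel_measurable M" for i
    using law_n(1,2)[of "{0}"] by auto
  have ps: "prob_space ?\<mu>" "prob_space ?\<nu>"
    using prob_space_distr[OF Xm[of 0]] prob_space_distr[OF Em[of 0]] dX0 dE0 by simp_all
  have g_meas: "g \<in> borel_measurable borel"
  proof -
    \<comment> \<open>The density is known to be measurable only as an extended nonnegative
      function; nonnegativity of \<open>g\<close> allows the way back.\<close>
    have "(\<lambda>x. enn2real (ennreal (g x))) \<in> borel_measurable borel"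
      using distributed_borel_measurable[OF g_pdf] by (intro borel_measurable_enn2real) simp
    then show ?thesis using g_nonneg by simp
  qed
  have X0_supp: "X0 \<subseteq> supp" using X0(2) interior_subset by blast
  have X0_compact: "compact X0"
    using compact_Int_closed[OF supp_compact X0(1)] X0_supp by (simp add: Int_absorb1)
  have X0_ne: "X0 \<noteq> {}" using X0(3) interior_subset by fastforce
  have X0_borel: "X0 \<in> sets borel" using X0(1) by simp
  obtain rg Cg Gg where tg: "0 < rg" "0 \<le> Cg"
    "\<And>x h. x \<in> X0 \<Longrightarrow> norm h \<le> rg \<Longrightarrow> \<bar>g (x + h) - g x\<bar> \<le> Cg * norm h"
    "\<And>x h. x \<in> X0 \<Longrightarrow> norm h \<le> rg \<Longrightarrow> \<bar>g (x + h)\<bar> \<le> Cg" "continuous_on X0 g"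
    using continuous_second_partials_taylor[OF g_C2 X0_compact X0(2)] by metis
  obtain rm Cm Gm where tm: "0 < rm" "0 \<le> Cm"
    "\<And>x h. x \<in> X0 \<Longrightarrow> norm h \<le> rm \<Longrightarrow> \<bar>m (x + h) - m x\<bar> \<le> Cm * norm h"
    "\<And>x h. x \<in> X0 \<Longrightarrow> norm h \<le> rm \<Longrightarrow> \<bar>m (x + h) - m x - Gm x \<bullet> h\<bar> \<le> Cm * (norm h)\<^sup>2"
    "\<And>x. x \<in> X0 \<Longrightarrow> norm (Gm x) \<le> Cm"
    using continuous_second_partials_taylor[OF m_C2 X0_compact X0(2)] by metis
  \<comment> \<open>One radius and one constant serve both \<open>g\<close> and
    \<open>m\<close>.\<close>
  define r where "r = min rg rm"
  define C where "C = max Cg Cm"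
  have rC: "0 < r" "r \<le> rg" "r \<le> rm" "0 \<le> C" "Cg \<le> C" "Cm \<le> C"
    using tg(1,2) tm(1) by (auto simp: r_def C_def)
  \<comment> \<open>The minimum of \<open>g\<close> over the compact trimming set is the constant
    \<open>c0\<close> of \<open>covariate_design\<close>.\<close>
  obtain x0 where x0: "x0 \<in> X0" "\<And>x. x \<in> X0 \<Longrightarrow> g x0 \<le> g x"
    using continuous_attains_inf[OF X0_compact X0_ne tg(5)] by blast
  \<comment> \<open>The cube of side one has all its points at norm at most \<open>d / 2\<close>, so
    the dimension is a generous radius for the support.\<close>
  define \<rho>0 where "\<rho>0 = real CARD('d)"
  have \<rho>0: "0 < \<rho>0" by (simp add: \<rho>0_def)
  have K0z: "K0 z = 0" if z: "\<rho>0 < norm z" for z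
  proof (rule ccontr)
    assume "K0 z \<noteq> 0"
    then have "z \<in> closure {z. K0 z \<noteq> 0}" using closure_subset[of "{z. K0 z \<noteq> 0}"] by blast
    then have b: "- 1 / 2 \<le> z $ i" "z $ i \<le> 1 / 2" for i using K0_supp by blast+
    have "\<bar>z $ i\<bar> \<le> 1 / 2" for i using b[of i] by (intro abs_leI) auto
    then have "(\<Sum>i\<in>UNIV. \<bar>z $ i\<bar>) \<le> (\<Sum>i\<in>(UNIV :: 'd set). 1 / 2)" by (intro sum_mono)
    then have "norm z \<le> \<rho>0 / 2" using norm_le_l1_cart[of z] by (simp add: \<rho>0_def)
    then show False using z \<rho>0 by simp
  qed
  obtain B0 where B0: "\<And>z. \<bar>K0 z\<bar> \<le> B0"
  proof -
    have "bounded (K0 ` cball 0 \<rho>0)"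
      by (intro compact_imp_bounded compact_continuous_image continuous_on_subset[OF K0_cont]) auto
    then obtain B where B: "\<And>z. z \<in> cball 0 \<rho>0 \<Longrightarrow> \<bar>K0 z\<bar> \<le> B"
      unfolding bounded_iff by (metis image_eqI real_norm_def)
    have "\<bar>K0 z\<bar> \<le> max B 0" for z
    proof (cases "\<rho>0 < norm z")
      case True
      then show ?thesis by (simp add: K0z)
    next
      case False
      then have "\<bar>K0 z\<bar> \<le> B" by (intro B) simp
      then show ?thesis by simp
    qed
    then show thesis by (rule that)
  qed
  define vol where "vol = (\<lambda>R. measure lborel (cball (0 :: real^'d) R))"
  have cd: "covariate_design g m Gm X0 K0 r C (g x0) B0 \<rho>0 vol"
  proof (rule covariate_design.intro)
    show "\<bar>g (x + h) - g x\<bar> \<le> C * norm h" if "x \<in> X0" "norm h \<le> r" for x h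
      using tg(3)[OF that(1), of h] that(2) rC mult_right_mono[OF rC(5) norm_ge_zero[of h]] by linarith
    show "\<bar>g (x + h)\<bar> \<le> C" if "x \<in> X0" "norm h \<le> r" for x h
      using tg(4)[OF that(1), of h] that(2) rC by linarith
    show "\<bar>m (x + h) - m x\<bar> \<le> C * norm h" if "x \<in> X0" "norm h \<le> r" for x h
      using tm(3)[OF that(1), of h] that(2) rC mult_right_mono[OF rC(6) norm_ge_zero[of h]] by linarith
    show "\<bar>m (x + h) - m x - Gm x \<bullet> h\<bar> \<le> C * (norm h)\<^sup>2" if "x \<in> X0" "norm h \<le> r" for x h
      using tm(4)[OF that(1), of h] that(2) rC mult_right_mono[OF rC(6) zero_le_power2[of "norm h"]] by linarith
    show "norm (Gm x) \<le> C" if "x \<in> X0" for x using tm(5)[OF that] rC by linarith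
  qed (assumption | rule vol_def g_meas g_nonneg ps m_meas K0_cont B0 K0z \<rho>0 K0_sym K0_int rC X0_borel
      x0(2) g_pos[OF x0(1)])+
  interpret cd: covariate_design g m Gm X0 K0 r C "g x0" B0 \<rho>0 vol by (rule cd)
  obtain B \<Lambda> \<rho> where K1: "0 < \<rho>" "\<And>v. \<rho> < \<bar>v\<bar> \<Longrightarrow> K1 v = 0" "\<And>v. \<bar>K1 v\<bar> \<le> B"
    "\<And>u v. \<bar>K1 u - K1 v\<bar> \<le> \<Lambda> * \<bar>u - v\<bar>" "continuous_on UNIV K1"
  proof -
    have two: "(2 :: nat) \<le> 3" by simp
    show thesis by (rule compactly_supported_C1[OF K1_C3 two K1_supp]) (rule that; assumption)
  qed
  obtain A where A: "\<And>t. \<bar>f t\<bar> \<le> A"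
  proof -
    have "bounded (range f)" using h_bounded[of 0 0] by simp
    then show thesis using that unfolding bounded_iff by (metis rangeI real_norm_def)
  qed
  obtain L' where L': "\<And>t. \<bar>deriv (deriv f) t\<bar> \<le> L'"
    using f_C2(2) unfolding bounded_iff by (metis rangeI real_norm_def)
  \<comment> \<open>The maximum with one makes the Lipschitz constant positive.\<close>
  define L where "L = max L' 1"
  have fd: "((deriv ^^ j) f) field_differentiable at x" if "j < 2" for j x
    using f_C2(1) that by (simp add: continuously_differentiable_def)
  have fD: "(f has_real_derivative deriv f x) (at x)" "(deriv f has_real_derivative deriv (deriv f) x) (at x)" for x
    using fd[of 0 x] fd[of 1 x] by (simp_all add: field_differentiable_derivI)
  have kd: "kernel_density f (deriv f) A L K1 B \<Lambda> \<rho>"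
  proof (intro kernel_density.intro smooth_density.intro kernel_density_axioms.intro)
    show "f t \<le> A" for t using A[of t] by linarith
    show "\<bar>deriv f s - deriv f t\<bar> \<le> L * \<bar>s - t\<bar>" for s t
    proof -
      have "norm (deriv f s - deriv f t) \<le> L * norm (s - t)"
      proof (rule field_differentiable_bound[of UNIV])
        show "(deriv f has_field_derivative deriv (deriv f) z) (at z within UNIV)" for z using fD(2) by simp
        show "norm (deriv (deriv f) z) \<le> L" for z using L'[of z] by (simp add: L_def)
      qed auto
      then show ?thesis by simp
    qed
    show "0 < L" by (simp add: L_def)
  qed (assumption | rule f_nonneg fD ps K1 K1_int K1_first)+
  interpret kd: kernel_density f "deriv f" A L K1 B \<Lambda> \<rho> by (rule kd)
  have sq_int: "integrable M (\<lambda>\<omega>. (eps 0 \<omega>)\<^sup>2)"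
  proof (rule Bochner_Integration.integrable_bound)
    show "integrable M (\<lambda>\<omega>. 1 + eps 0 \<omega> ^ 6)" using eps_moment by simp
    \<comment> \<open>The sixth moment controls the second one: below one the constant dominates,
      above one the higher power does.\<close>
    have "t\<^sup>2 \<le> 1 + t ^ 6" for t :: real
    proof (cases "\<bar>t\<bar> \<le> 1")
      case True
      then have "t\<^sup>2 \<le> 1" by (simp add: abs_square_le_1)
      moreover have "0 \<le> t ^ 6" by simp
      ultimately show ?thesis by linarith
    next
      case False
      then have "\<bar>t\<bar> ^ 2 \<le> \<bar>t\<bar> ^ 6" by (intro power_increasing) auto
      then show ?thesis by simp
    qed
    then show "AE \<omega> in M. norm ((eps 0 \<omega>)\<^sup>2) \<le> norm (1 + eps 0 \<omega> ^ 6)"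
      by (auto intro!: AE_I2 order_trans[OF _ abs_ge_self])
  qed (use Em in measurable)
  have moment2: "integrable ?\<nu> (\<lambda>t. t\<^sup>2)"
    unfolding dE0[symmetric] using sq_int by (subst integrable_distr_eq[OF Em]) auto
  have centred: "(\<integral>t. t \<partial>?\<nu>) = 0"
    unfolding dE0[symmetric] using eps_centered by (subst integral_distr[OF Em]) auto
  \<comment> \<open>An interior point of the trimming set lies in the support of the law, so the
    open interior already has positive mass.\<close>
  have pS: "0 < measure ?\<mu> X0"
  proof -
    obtain x where x: "x \<in> interior X0" using X0(3) by blast
    then have "x \<in> supp" using X0_supp interior_subset by blast
    then have "0 < measure (distr M borel (X 0)) (interior X0)"
      using x open_interior unfolding supp law_support_def by blast
    also have "\<dots> = measure ?\<mu> (interior X0)" by (simp only: dX0)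
    also have "\<dots> \<le> measure ?\<mu> X0"
      by (rule cd.finite_measure_mono[OF interior_subset]) (use X0_borel in simp)
    finally show ?thesis .
  qed
  obtain \<tau> T U where gp: "\<tau> > 0" "T > 0" "U > 0"
    "\<And>n b. n \<ge> 4 \<Longrightarrow> 0 < b \<Longrightarrow> b \<le> 1 \<Longrightarrow> b * (2 * \<rho>0) \<le> r \<Longrightarrow> B0 * (C * (b * \<rho>0)) * vol \<rho>0 \<le> g x0 / 2 \<Longrightarrow>
      \<exists>N\<in>sets (PiM {1..n} (\<lambda>_. ?\<mu>)).
        emeasure (PiM {1..n} (\<lambda>_. ?\<mu>)) N
          \<le> ennreal (exp (- (measure ?\<mu> X0 / 16 * real n)) + real n * (4 * exp (- (\<tau> * (real n * b ^ (CARD('d) + 2)))))) \<and>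
        (\<forall>x\<in>space (PiM {1..n} (\<lambda>_. ?\<mu>)) - N. cd.good T U n b x)"
  proof -
    show thesis by (rule cd.good_probability[OF pS]) (rule that; assumption)
  qed
  obtain CM C\<phi> where CM: "0 < CM" "0 < C\<phi>" and
    de: "\<And>n b0 b1 x \<phi>. n \<ge> 1 \<Longrightarrow> cd.good T U n b0 x \<Longrightarrow>
      0 < b0 \<Longrightarrow> b0 \<le> 1 \<Longrightarrow> 0 < b1 \<Longrightarrow> b1 \<le> 1 \<Longrightarrow> 4 * \<rho> * A * b1 \<le> 1 \<Longrightarrow>
      1 \<le> real n * b0 ^ (CARD('d) + 2) \<Longrightarrow> 1 \<le> real n * b1 ^ 3 \<Longrightarrow>
      \<phi> = (\<integral>y. (f_tilde X0 K1 b1 n x y e - f e)\<^sup>2 \<partial>PiM {1..n} (\<lambda>_. ?\<nu>)) \<Longrightarrow>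
      integrable (PiM {1..n} (\<lambda>_. ?\<nu>)) (\<lambda>y. \<bar>f_hat X0 K0 K1 b0 b1 n x (\<lambda>i. m (x i) + y i) e - f e\<bar>) \<and>
      (\<integral>y. \<bar>f_hat X0 K0 K1 b0 b1 n x (\<lambda>i. m (x i) + y i) e - f e\<bar> \<partial>PiM {1..n} (\<lambda>_. ?\<nu>))
        \<le> CM * sqrt (\<phi> + remainder_rate CARD('d) n b0 b1) \<and>
      0 \<le> \<phi> \<and> \<phi> \<le> C\<phi> * (b1 ^ 4 + 1 / (real n * b1))"
  proof -
    show thesis
      by (rule design_error_bound[OF cd kd moment2 centred gp(2,3) pS, where e = e]) (rule that; assumption)
  qed
  define \<phi> where "\<phi> = (\<lambda>n x. \<integral>y. (f_tilde X0 K1 (b1 n) n x y e - f e)\<^sup>2 \<partial>PiM {1..n} (\<lambda>_. ?\<nu>))"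
  \<comment> \<open>Both vectors are restricted to the indices from one to \<open>n\<close>; the
    generic copy with index zero is left out.\<close>
  define \<xi> where "\<xi> = (\<lambda>n :: nat. \<lambda>\<omega>. \<lambda>i\<in>{1..n}. X i \<omega>)"
  define \<eta> where "\<eta> = (\<lambda>n :: nat. \<lambda>\<omega>. \<lambda>i\<in>{1..n}. eps i \<omega>)"
  let ?P = "\<lambda>n. PiM {1..n::nat} (\<lambda>_. ?\<mu>)"
  let ?Q = "\<lambda>n. PiM {1..n::nat} (\<lambda>_. ?\<nu>)"
  have setsP: "sets (?P n) = sets (PiM {1..n} (\<lambda>_. borel))" and setsQ: "sets (?Q n) = sets (PiM {1..n} (\<lambda>_. borel))" for n
    by (auto intro!: sets_PiM_cong)
  have PQ: "prob_space (?P n)" "prob_space (?Q n)" for n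
    using ps by (auto intro!: prob_space_PiM)
  have \<xi>m: "\<xi> n \<in> M \<rightarrow>\<^sub>M ?P n" for n
    unfolding \<xi>_def using Xm by (intro measurable_restrict) simp
  have \<eta>m: "\<eta> n \<in> M \<rightarrow>\<^sub>M ?Q n" for n
    unfolding \<eta>_def using Em by (intro measurable_restrict) simp
  have law: "distr M (?P n \<Otimes>\<^sub>M ?Q n) (\<lambda>\<omega>. (\<xi> n \<omega>, \<eta> n \<omega>)) = ?P n \<Otimes>\<^sub>M ?Q n" if n: "n \<ge> 1" for n
  proof -
    have "distr M (?P n \<Otimes>\<^sub>M ?Q n) (\<lambda>\<omega>. (\<xi> n \<omega>, \<eta> n \<omega>))
        = distr M (PiM {1..n} (\<lambda>_. borel) \<Otimes>\<^sub>M PiM {1..n} (\<lambda>_. borel)) (\<lambda>\<omega>. (\<xi> n \<omega>, \<eta> n \<omega>))"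
      by (rule distr_cong[OF refl sets_pair_measure_cong[OF setsP setsQ]]) simp
    also have "\<dots> = ?P n \<Otimes>\<^sub>M ?Q n"
      unfolding \<xi>_def \<eta>_def by (rule law_n(3)) (use n in auto)
    finally show ?thesis .
  qed
  have setsPQ: "sets (?P n \<Otimes>\<^sub>M ?Q n) = sets (PiM {1..n} (\<lambda>_. borel) \<Otimes>\<^sub>M PiM {1..n} (\<lambda>_. borel))" for n
    by (rule sets_pair_measure_cong[OF setsP setsQ])
  have fhm: "(\<lambda>z. \<bar>f_hat X0 K0 K1 (b0 n) (b1 n) n (fst z) (\<lambda>i. m (fst z i) + snd z i) e - f e\<bar>)
      \<in> borel_measurable (?P n \<Otimes>\<^sub>M ?Q n)" for n
    unfolding measurable_cong_sets[OF setsPQ refl]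
    by (intro borel_measurable_abs borel_measurable_diff borel_measurable_const
        f_hat_measurable X0_borel cd.K_meas kd.K_measurable m_meas)
  have ftm: "(\<lambda>z. (f_tilde X0 K1 (b1 n) n (fst z) (snd z) e - f e)\<^sup>2) \<in> borel_measurable (?P n \<Otimes>\<^sub>M ?Q n)" for n
    unfolding measurable_cong_sets[OF setsPQ refl]
    by (intro borel_measurable_power borel_measurable_diff borel_measurable_const
        f_tilde_measurable X0_borel kd.K_measurable)
  have \<phi>m: "\<phi> n \<in> borel_measurable (?P n)" for n
  proof -
    interpret Q: prob_space "?Q n" by (rule PQ)
    show ?thesis unfolding \<phi>_def by (rule Q.borel_measurable_lebesgue_integral) (use ftm[of n] in \<open>simp add: split_beta'\<close>)
  qed
  \<comment> \<open>A conditional expectation is fixed up to null sets, so the AMSE is replaced by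
    its fixed-design value \<open>\<phi>\<close> almost surely, and events are compared almost
    surely below.\<close>
  have amse_eq: "AE \<omega> in M. amse M X0 K1 X eps f e (b1 n) n \<omega> = \<phi> n (\<xi> n \<omega>)" if n: "n \<ge> 1" for n
  proof -
    let ?h = "\<lambda>z. (f_tilde X0 K1 (b1 n) n (fst z) (snd z) e - f e)\<^sup>2"
    have bd: "\<bar>?h z\<bar> \<le> (B / b1 n + \<bar>f e\<bar>)\<^sup>2" for z
    proof -
      have "\<bar>f_tilde X0 K1 (b1 n) n (fst z) (snd z) e - f e\<bar> \<le> B / b1 n + \<bar>f e\<bar>"
        by (rule order_trans[OF abs_triangle_ineq4 add_right_mono])
          (rule f_tilde_bounded[OF K1(3) b1_pos[OF n]])
      from power_mono[OF this abs_ge_zero, of 2] show ?thesis by (simp only: power2_abs abs_power2)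
    qed
    \<comment> \<open>The sigma-algebra generated by the design depends only on the measurable sets
      of the target, not on the law placed there.\<close>
    have F: "vimage_algebra (space M) (\<xi> n) (?P n) = vimage_algebra (space M) (\<xi> n) (PiM {1..n} (\<lambda>_. borel))"
      by (rule vimage_algebra_cong) (use setsP in auto)
    have "AE \<omega> in M. real_cond_exp M (vimage_algebra (space M) (\<xi> n) (?P n)) (\<lambda>\<omega>. ?h (\<xi> n \<omega>, \<eta> n \<omega>)) \<omega>
        = (\<integral>y. ?h (\<xi> n \<omega>, y) \<partial>?Q n)"
      by (rule real_cond_exp_of_product_law[OF PQ \<xi>m \<eta>m law[OF n] ftm bd])
    moreover have "f_tilde X0 K1 (b1 n) n (\<lambda>i. X i \<omega>) (\<lambda>i. eps i \<omega>) e = f_tilde X0 K1 (b1 n) n (\<xi> n \<omega>) (\<eta> n \<omega>) e" for \<omega>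
      by (rule f_tilde_cong) (auto simp: \<xi>_def \<eta>_def)
    moreover have "vimage_algebra (space M) (\<lambda>\<omega>. \<lambda>i\<in>{1..n}. X i \<omega>) (PiM {1..n} (\<lambda>_. borel))
        = vimage_algebra (space M) (\<xi> n) (?P n)" by (simp only: F) (simp only: \<xi>_def)
    ultimately show ?thesis by (simp only: amse_def cond_exp_sample_def \<phi>_def fst_conv snd_conv)
  qed
  have ev: "\<forall>\<^sub>F n in sequentially. n \<ge> 4 \<and> b0 n \<le> 1 \<and> b0 n * (2 * \<rho>0) \<le> r
      \<and> B0 * (C * (b0 n * \<rho>0)) * vol \<rho>0 \<le> g x0 / 2 \<and> b1 n \<le> 1 \<and> 4 * \<rho> * A * b1 n \<le> 1
      \<and> 1 \<le> real n * b0 n ^ (CARD('d) + 2) \<and> 1 \<le> real n * b1 n ^ 3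
      \<and> exp (- (measure ?\<mu> X0 / 16 * real n)) + real n * (4 * exp (- (\<tau> * (real n * b0 n ^ (CARD('d) + 2))))) \<le> \<delta>"
    if \<delta>: "0 < \<delta>" for \<delta>
  proof -
    have k: "CARD('d) + 2 \<le> ?D" by simp
    have small: "\<forall>\<^sub>F n in sequentially. c * b n \<le> a" if b: "b \<longlonglongrightarrow> 0" and a: "0 < a" for c a :: real and b :: "nat \<Rightarrow> real"
    proof -
      have "(\<lambda>n. c * b n) \<longlonglongrightarrow> c * 0" by (intro tendsto_mult tendsto_const b)
      then have "\<forall>\<^sub>F n in sequentially. c * b n < a" using a by (intro order_tendstoD(2)) auto
      then show ?thesis by eventually_elim simp
    qed
    have "g x0 / 2 > 0" using cd.c0 by simp
    note s0 = small[OF b0_decr(2), of 1 1] small[OF b0_decr(2) rC(1), of "2 * \<rho>0"]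
      small[OF b0_decr(2) \<open>g x0 / 2 > 0\<close>, of "B0 * C * \<rho>0 * vol \<rho>0"]
      small[OF b1_decr(2), of 1 1] small[OF b1_decr(2), of 1 "4 * \<rho> * A"]
    have ln: "\<forall>\<^sub>F n in sequentially. 1 \<le> real n * b0 n ^ (CARD('d) + 2)"
    proof -
      have "\<forall>\<^sub>F n in sequentially. (1 / ln 2) * ln (real n) \<le> real n * b0 n ^ (CARD('d) + 2)"
        by (rule bandwidth_large[OF b0_pos b0_decr(2) b0_rate k])
      moreover have "\<forall>\<^sub>F n :: nat in sequentially. n \<ge> 2" by (rule eventually_ge_at_top)
      ultimately show ?thesis
      proof eventually_elim
        case (elim n)
        have "1 \<le> (1 / ln 2) * ln (real n)" using elim(2) by (simp add: pos_le_divide_eq)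
        then show ?case using elim(1) by linarith
      qed
    qed
    have p16: "0 < measure ?\<mu> X0 / 16" using pS by simp
    have fail: "\<forall>\<^sub>F n in sequentially. exp (- (measure ?\<mu> X0 / 16 * real n))
        + real n * (4 * exp (- (\<tau> * (real n * b0 n ^ (CARD('d) + 2))))) \<le> \<delta>"
      by (rule design_failure_small[OF b0_pos b0_decr(2) b0_rate k gp(1) p16 \<delta>])
    have b1l: "\<forall>\<^sub>F n in sequentially. 1 \<le> real n * b1 n ^ 3"
      by (rule second_bandwidth_large[OF b1_pos b1_decr(2) b1_rate])
    have "\<forall>\<^sub>F n :: nat in sequentially. n \<ge> 4" by (rule eventually_ge_at_top)
    with s0(1)[OF zero_less_one] s0(2,3) s0(4)[OF zero_less_one] s0(5)[OF zero_less_one] ln fail b1l show ?thesis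
    proof eventually_elim
      case (elim n)
      then show ?case by (intro conjI) (simp_all add: mult_ac)
    qed
  qed
  \<comment> \<open>\<open>conditional_markov\<close> requires a strictly positive normaliser, and
    \<open>\<phi>\<close> alone might vanish.\<close>
  have R_pos: "0 < remainder_rate CARD('d) n (b0 n) (b1 n)" if n: "n \<ge> 1" for n
  proof -
    have "0 < b0 n ^ 4" using b0_pos[OF n] by simp
    then show ?thesis using remainder_rate_ge(1)[OF b0_pos[OF n] b1_pos[OF n], of n "CARD('d)"] n by linarith
  qed
  show ?thesis
  proof
    show "bigO_prob M
      (\<lambda>n \<omega>. f_hat X0 K0 K1 (b0 n) (b1 n) n (\<lambda>i. X i \<omega>) (\<lambda>i. Y i \<omega>) e - f e)
      (\<lambda>n \<omega>. sqrt (amse M X0 K1 X eps f e (b1 n) n \<omega> + remainder_rate CARD('d) n (b0 n) (b1 n)))"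
      unfolding bigO_prob_def
    proof (intro allI impI)
      fix \<delta> :: real assume \<delta>: "0 < \<delta>"
      have \<delta>2: "0 < \<delta> / 2" using \<delta> by simp
      show "\<exists>C'>0. \<forall>\<^sub>F n in sequentially. prob {\<omega> \<in> space M.
          \<bar>f_hat X0 K0 K1 (b0 n) (b1 n) n (\<lambda>i. X i \<omega>) (\<lambda>i. Y i \<omega>) e - f e\<bar>
          > C' * \<bar>sqrt (amse M X0 K1 X eps f e (b1 n) n \<omega> + remainder_rate CARD('d) n (b0 n) (b1 n))\<bar>} \<le> \<delta>"
      proof (intro exI conjI)
        \<comment> \<open>Half of the probability budget goes to irregular designs, the other half
          to Markov's inequality; the latter fixes the constant.\<close>
        show "0 < CM / (\<delta> / 2)" using CM \<delta> by simp
        show "\<forall>\<^sub>F n in sequentially. prob {\<omega> \<in> space M.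
          \<bar>f_hat X0 K0 K1 (b0 n) (b1 n) n (\<lambda>i. X i \<omega>) (\<lambda>i. Y i \<omega>) e - f e\<bar>
          > CM / (\<delta> / 2) * \<bar>sqrt (amse M X0 K1 X eps f e (b1 n) n \<omega> + remainder_rate CARD('d) n (b0 n) (b1 n))\<bar>} \<le> \<delta>"
          using ev[OF \<delta>2]
        proof eventually_elim
          case (elim n)
          then have n: "n \<ge> 1" by simp
          let ?R = "remainder_rate CARD('d) n (b0 n) (b1 n)"
          let ?H = "\<lambda>z. \<bar>f_hat X0 K0 K1 (b0 n) (b1 n) n (fst z) (\<lambda>i. m (fst z i) + snd z i) e - f e\<bar>"
          let ?\<psi> = "\<lambda>x. sqrt (\<phi> n x + ?R)"
          obtain N where N: "N \<in> sets (?P n)" "emeasure (?P n) N \<le> ennreal (\<delta> / 2)"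
            "\<And>x. x \<in> space (?P n) - N \<Longrightarrow> cd.good T U n (b0 n) x"
            using gp(4)[of n "b0 n"] elim b0_pos[OF n] by (meson ennreal_leI order_trans)
          have \<psi>m: "?\<psi> \<in> borel_measurable (?P n)" using \<phi>m[of n] by measurable
          have le: "integrable (?Q n) (\<lambda>y. ?H (x, y)) \<and> (\<integral>y. ?H (x, y) \<partial>?Q n) \<le> CM * ?\<psi> x \<and> 0 < ?\<psi> x"
            if x: "x \<in> space (?P n) - N" for x
          proof -
            note d = de[OF n N(3)[OF x] b0_pos[OF n] _ b1_pos[OF n], of "\<phi> n x"]
            have "0 \<le> \<phi> n x" using d elim by (simp add: \<phi>_def)
            then have "0 < \<phi> n x + ?R" using R_pos[OF n] by linarith
            then show ?thesis using d elim by (simp add: \<phi>_def)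
          qed
          have H0: "0 \<le> ?H z" for z by simp
          have \<delta>0: "0 \<le> \<delta> / 2" using \<delta> by simp
          note cm = conditional_markov[where H = ?H and \<psi> = ?\<psi>, OF PQ \<xi>m \<eta>m law[OF n] fhm H0 \<psi>m N(1,2) \<delta>2 \<delta>0 CM(1) le]
          let ?E = "{\<omega> \<in> space M. ?H (\<xi> n \<omega>, \<eta> n \<omega>) > CM / (\<delta> / 2) * ?\<psi> (\<xi> n \<omega>)}"
          have E: "?E \<in> events" "prob ?E \<le> \<delta> / 2 + \<delta> / 2" by (rule cm(1), assumption, rule cm(2), assumption)
          have Yeq: "f_hat X0 K0 K1 (b0 n) (b1 n) n (\<lambda>i. X i \<omega>) (\<lambda>i. Y i \<omega>) e
              = f_hat X0 K0 K1 (b0 n) (b1 n) n (\<xi> n \<omega>) (\<lambda>i. m (\<xi> n \<omega> i) + \<eta> n \<omega> i) e" for \<omega>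
            by (rule f_hat_cong) (auto simp: \<xi>_def \<eta>_def eps)
          have "prob {\<omega> \<in> space M.
              \<bar>f_hat X0 K0 K1 (b0 n) (b1 n) n (\<lambda>i. X i \<omega>) (\<lambda>i. Y i \<omega>) e - f e\<bar>
              > CM / (\<delta> / 2) * \<bar>sqrt (amse M X0 K1 X eps f e (b1 n) n \<omega> + ?R)\<bar>} \<le> prob ?E"
          \<comment> \<open>The comparison is made with an event stated through
            \<open>\<phi>\<close>, whose measurability is known from
            \<open>conditional_markov\<close>.\<close>
          proof (rule finite_measure_mono_AE[OF _ E(1)])
            show "AE \<omega> in M. \<omega> \<in> {\<omega> \<in> space M.
              \<bar>f_hat X0 K0 K1 (b0 n) (b1 n) n (\<lambda>i. X i \<omega>) (\<lambda>i. Y i \<omega>) e - f e\<bar>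
              > CM / (\<delta> / 2) * \<bar>sqrt (amse M X0 K1 X eps f e (b1 n) n \<omega> + ?R)\<bar>} \<longrightarrow> \<omega> \<in> ?E"
              using amse_eq[OF n]
            proof eventually_elim
              case (elim \<omega>)
              have "0 \<le> \<phi> n (\<xi> n \<omega>)" unfolding \<phi>_def by (intro Bochner_Integration.integral_nonneg) simp
              then have "0 \<le> \<phi> n (\<xi> n \<omega>) + ?R" using R_pos[OF n] by linarith
              then have "\<bar>sqrt (amse M X0 K1 X eps f e (b1 n) n \<omega> + ?R)\<bar> = ?\<psi> (\<xi> n \<omega>)" by (simp add: elim)
              then show ?case unfolding Yeq by simp
            qed
          qed
          then show ?case using E(2) by simp
        qed
      qed
    qed
    show "bigO_prob M
      (\<lambda>n \<omega>. amse M X0 K1 X eps f e (b1 n) n \<omega>)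
      (\<lambda>n \<omega>. b1 n ^ 4 + 1 / (real n * b1 n))"
      unfolding bigO_prob_def
    proof (intro allI impI)
      fix \<delta> :: real assume \<delta>: "0 < \<delta>"
      show "\<exists>C'>0. \<forall>\<^sub>F n in sequentially. prob {\<omega> \<in> space M.
          \<bar>amse M X0 K1 X eps f e (b1 n) n \<omega>\<bar> > C' * \<bar>b1 n ^ 4 + 1 / (real n * b1 n)\<bar>} \<le> \<delta>"
      proof (intro exI conjI)
        \<comment> \<open>On a regular design the bound on \<open>\<phi>\<close> is deterministic,
          so one constant serves every \<open>\<delta>\<close>, and the exceptional event is
          contained, up to a null set, in the irregularity of the design.\<close>
        show "0 < C\<phi>" by (rule CM)
        show "\<forall>\<^sub>F n in sequentially. prob {\<omega> \<in> space M.
          \<bar>amse M X0 K1 X eps f e (b1 n) n \<omega>\<bar> > C\<phi> * \<bar>b1 n ^ 4 + 1 / (real n * b1 n)\<bar>} \<le> \<delta>"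
          using ev[OF \<delta>]
        proof eventually_elim
          case (elim n)
          then have n: "n \<ge> 1" by simp
          note conds = elim
          obtain N where N: "N \<in> sets (?P n)" "emeasure (?P n) N \<le> ennreal \<delta>"
            "\<And>x. x \<in> space (?P n) - N \<Longrightarrow> cd.good T U n (b0 n) x"
            using gp(4)[of n "b0 n"] elim b0_pos[OF n] by (meson ennreal_leI order_trans)
          let ?E = "\<xi> n -` N \<inter> space M"
          have E: "?E \<in> events" by (rule measurable_sets[OF \<xi>m N(1)])
          have "emeasure M ?E = emeasure (distr M (?P n) (\<xi> n)) N" by (rule emeasure_distr[OF \<xi>m N(1), symmetric])
          also have "distr M (?P n) (\<xi> n) = ?P n"
          proof -
            interpret Q: prob_space "?Q n" by (rule PQ)
            have "distr M (?P n) (\<xi> n) = distr (distr M (?P n \<Otimes>\<^sub>M ?Q n) (\<lambda>\<omega>. (\<xi> n \<omega>, \<eta> n \<omega>))) (?P n) fst"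
              using measurable_Pair[OF \<xi>m \<eta>m] by (subst distr_distr) (auto simp: comp_def)
            then show ?thesis unfolding law[OF n] using Q.distr_pair_fst by simp
          qed
          finally have "ennreal (prob ?E) \<le> ennreal \<delta>" using N(2) by (simp only: emeasure_eq_measure)
          then have "prob ?E \<le> \<delta>" using \<delta> by (simp add: ennreal_le_iff)
          moreover have "prob {\<omega> \<in> space M.
              \<bar>amse M X0 K1 X eps f e (b1 n) n \<omega>\<bar> > C\<phi> * \<bar>b1 n ^ 4 + 1 / (real n * b1 n)\<bar>} \<le> prob ?E"
          proof (rule finite_measure_mono_AE[OF _ E])
            show "AE \<omega> in M. \<omega> \<in> {\<omega> \<in> space M.
              \<bar>amse M X0 K1 X eps f e (b1 n) n \<omega>\<bar> > C\<phi> * \<bar>b1 n ^ 4 + 1 / (real n * b1 n)\<bar>} \<longrightarrow> \<omega> \<in> ?E"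
              using amse_eq[OF n]
            proof eventually_elim
              case (elim \<omega>)
              show ?case
              proof (rule impI, rule ccontr)
                assume big: "\<omega> \<in> {\<omega> \<in> space M.
                  \<bar>amse M X0 K1 X eps f e (b1 n) n \<omega>\<bar> > C\<phi> * \<bar>b1 n ^ 4 + 1 / (real n * b1 n)\<bar>}" and "\<omega> \<notin> ?E"
                then have x: "\<xi> n \<omega> \<in> space (?P n) - N" using measurable_space[OF \<xi>m] by auto
                note d = de[OF n N(3)[OF x] b0_pos[OF n] _ b1_pos[OF n], of "\<phi> n (\<xi> n \<omega>)"]
                have "0 \<le> \<phi> n (\<xi> n \<omega>) \<and> \<phi> n (\<xi> n \<omega>) \<le> C\<phi> * (b1 n ^ 4 + 1 / (real n * b1 n))"
                  using d conds by (simp add: \<phi>_def)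
                moreover have "0 \<le> b1 n ^ 4 + 1 / (real n * b1 n)" using b1_pos[OF n] n by simp
                ultimately show False using big by (simp add: elim)
              qed
            qed
          qed
          ultimately show ?case by linarith
        qed
      qed
    qed
  qed
qed

end
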